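(* Let $\mathbb{K}$ be a field with $\mathrm{char}(\mathbb{K})=0$ and let $\delta\in\mathbb{Z}$. Then: (a) for $r,s\in\mathbb{Z}_{\geq 0}$ not both zero, the walled Brauer algebra $\mathcal{B}_{r,s}(\delta)$ over $\mathbb{K}$ is semisimple if and only if the walled Brauer algebra $\mathcal{B}_{r,s}(\delta)$ over $\mathbb{F}_p$ (with $\delta$ replaced by its image in $\mathbb{F}_p$) is semisimple for infinitely many primes $p$; (b) for $d\in\mathbb{Z}_{>0}$, the Brauer algebra $\mathcal{B}_d(\delta)$ over $\mathbb{K}$ is semisimple if and only if the Brauer algebra $\mathcal{B}_d(\delta)$ over $\mathbb{F}_p$ is semisimple for infinitely many primes $p$.
   Context: For a commutative ring $R$ and $\delta\in R$: the walled Brauer algebra $\mathcal{B}_{r,s}(\delta)$ over $R$ is the free $R$-module with basis the walled Brauer diagrams (Brauer diagrams on $r+s$ top and $r+s$ bottom points with a wall separating the first $r$ from the last $s$ points, such that vertical strands connect points on the same side of the wall and horizontal arcs connect points on opposite sides), with multiplication given by concatenation where each closed loop is replaced by the factor $\delta$; over a field it is equivalently generated by $\sigma_i$ ($i\neq r$) and $u_r$ with the standard walled Brauer relations ($\sigma_i^2=1$, braid relations, $u_r^2=\delta u_r$, $u_r=u_r\sigma_{r\pm1}u_r$, $u_r\sigma_j=\sigma_ju_r$ for $|r-j|>1$, $u_r\sigma_{r-1}\sigma_{r+1}u_r\sigma_{r-1}\sigma_{r+1}=u_r\sigma_{r-1}\sigma_{r+1}u_r=\sigma_{r-1}\sigma_{r+1}u_r\sigma_{r-1}\sigma_{r+1}u_r$).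 The Brauer algebra $\mathcal{B}_d(\delta)$ over $R$ is the free $R$-module with basis all Brauer diagrams (perfect matchings of $d$ top and $d$ bottom points), multiplied by concatenation with closed loops replaced by $\delta$. Both algebras over a field are obtained from the integral versions over $\mathbb{Z}$ by scalar extension. *)

theory Defs
  imports "HOL-Algebra.Algebra" "HOL-Number_Theory.Residues"
begin

text \<open>Points of a diagram on d top and d bottom points: (True, i) is the i-th top point,
 (False, i) the i-th bottom point, for i < d. A Brauer diagram (perfect matching)
 is a fixed-point-free involution of the point set, extended by the identity elsewhere.\<close>

type_synonym diagram = "bool \<times> nat \<Rightarrow> bool \<times> nat"

definition pts :: "nat \<Rightarrow> (bool \<times> nat) set" where
  "pts d = UNIV \<times> {..<d}"

definition brauer_diagrams :: "nat \<Rightarrow> diagram set" where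
  "brauer_diagrams d = {m. (\<forall>p\<in>pts d. m p \<in> pts d \<and> m p \<noteq> p \<and> m (m p) = p)
                          \<and> (\<forall>p. p \<notin> pts d \<longrightarrow> m p = p)}"

text \<open>Walled Brauer diagrams on r+s points: points with index < r lie left of the wall.
 Vertical strands (top to bottom) stay on one side; horizontal arcs cross the wall.\<close>

definition walled_brauer_diagrams :: "nat \<Rightarrow> nat \<Rightarrow> diagram set" where
  "walled_brauer_diagrams r s = {m \<in> brauer_diagrams (r + s).
     \<forall>p\<in>pts (r + s).
       (if fst (m p) = fst p then (snd (m p) < r) \<noteq> (snd p < r)
        else (snd (m p) < r) = (snd p < r))}"

definition id_diagram :: "nat \<Rightarrow> diagram" where
  "id_diagram d = (\<lambda>(t, i). if i < d then (\<not> t, i) else (t, i))"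

text \<open>Stacking a on top of b: level 0 = top row of a, level 1 = middle row
 (bottom of a identified with top of b), level 2 = bottom row of b.\<close>

definition lvl_a :: "bool \<times> nat \<Rightarrow> nat \<times> nat" where
  "lvl_a p = (if fst p then 0 else 1, snd p)"

definition lvl_b :: "bool \<times> nat \<Rightarrow> nat \<times> nat" where
  "lvl_b p = (if fst p then 1 else 2, snd p)"

definition lvl_out :: "bool \<times> nat \<Rightarrow> nat \<times> nat" where
  "lvl_out p = (if fst p then 0 else 2, snd p)"

definition unlvl :: "nat \<times> nat \<Rightarrow> bool \<times> nat" where
  "unlvl v = (fst v = 0, snd v)"

definition stack_edges :: "nat \<Rightarrow> diagram \<Rightarrow> diagram \<Rightarrow> ((nat \<times> nat) \<times> (nat \<times> nat)) set" where
  "stack_edges d a b = {(lvl_a p, lvl_a (a p)) | p. p \<in> pts d}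
                     \<union> {(lvl_b p, lvl_b (b p)) | p. p \<in> pts d}"

definition stack_conn :: "nat \<Rightarrow> diagram \<Rightarrow> diagram \<Rightarrow> ((nat \<times> nat) \<times> (nat \<times> nat)) set" where
  "stack_conn d a b = ((stack_edges d a b) \<union> (stack_edges d a b)\<inverse>)\<^sup>*"

definition outer :: "nat \<Rightarrow> nat \<times> nat \<Rightarrow> bool" where
  "outer d v \<longleftrightarrow> fst v \<noteq> 1 \<and> fst v \<le> 2 \<and> snd v < d"

definition compose :: "nat \<Rightarrow> diagram \<Rightarrow> diagram \<Rightarrow> diagram" where
  "compose d a b = (\<lambda>p. if p \<in> pts d then
       unlvl (THE w. w \<noteq> lvl_out p \<and> outer d w \<and> (lvl_out p, w) \<in> stack_conn d a b)
     else p)"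

definition loops :: "nat \<Rightarrow> diagram \<Rightarrow> diagram \<Rightarrow> nat" where
  "loops d a b = card {stack_conn d a b `` {v} | v.
       fst v = 1 \<and> snd v < d \<and> (\<forall>w \<in> stack_conn d a b `` {v}. \<not> outer d w)}"

definition diagram_alg :: "('a, 'm) ring_scheme \<Rightarrow> int \<Rightarrow> nat \<Rightarrow> diagram set
    \<Rightarrow> (diagram \<Rightarrow> 'a) ring" where
  "diagram_alg R \<delta> d D =
    \<lparr> carrier = {f. (\<forall>x\<in>D. f x \<in> carrier R) \<and> (\<forall>x. x \<notin> D \<longrightarrow> f x = \<zero>\<^bsub>R\<^esub>)},
      monoid.mult = (\<lambda>f g c. if c \<in> D then
          finsum R (\<lambda>(a, b). (f a \<otimes>\<^bsub>R\<^esub> g b) \<otimes>\<^bsub>R\<^esub>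
                     ((add_pow R \<delta> \<one>\<^bsub>R\<^esub>) [^]\<^bsub>R\<^esub> (loops d a b)))
                   {(a, b). a \<in> D \<and> b \<in> D \<and> compose d a b = c}
        else \<zero>\<^bsub>R\<^esub>),
      one = (\<lambda>c. if c = id_diagram d then \<one>\<^bsub>R\<^esub> else \<zero>\<^bsub>R\<^esub>),
      ring.zero = (\<lambda>c. \<zero>\<^bsub>R\<^esub>),
      ring.add = (\<lambda>f g c. if c \<in> D then f c \<oplus>\<^bsub>R\<^esub> g c else \<zero>\<^bsub>R\<^esub>) \<rparr>"

definition brauer_alg :: "('a, 'm) ring_scheme \<Rightarrow> int \<Rightarrow> nat \<Rightarrow> (diagram \<Rightarrow> 'a) ring" where
  "brauer_alg R \<delta> d = diagram_alg R \<delta> d (brauer_diagrams d)"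

definition walled_brauer_alg :: "('a, 'm) ring_scheme \<Rightarrow> int \<Rightarrow> nat \<Rightarrow> nat \<Rightarrow> (diagram \<Rightarrow> 'a) ring" where
  "walled_brauer_alg R \<delta> r s = diagram_alg R \<delta> (r + s) (walled_brauer_diagrams r s)"

definition left_ideal :: "'a set \<Rightarrow> ('a, 'm) ring_scheme \<Rightarrow> bool" where
  "left_ideal I A \<longleftrightarrow> I \<subseteq> carrier A \<and> \<zero>\<^bsub>A\<^esub> \<in> I
     \<and> (\<forall>x\<in>I. \<forall>y\<in>I. x \<oplus>\<^bsub>A\<^esub> y \<in> I)
     \<and> (\<forall>x\<in>I. \<ominus>\<^bsub>A\<^esub> x \<in> I)
     \<and> (\<forall>a\<in>carrier A. \<forall>x\<in>I. a \<otimes>\<^bsub>A\<^esub> x \<in> I)"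

definition semisimple :: "('a, 'm) ring_scheme \<Rightarrow> bool" where
  "semisimple A \<longleftrightarrow> (\<forall>I. left_ideal I A \<longrightarrow>
     (\<exists>J. left_ideal J A \<and> I \<inter> J = {\<zero>\<^bsub>A\<^esub>}
          \<and> (\<forall>x\<in>carrier A. \<exists>i\<in>I. \<exists>j\<in>J. x = i \<oplus>\<^bsub>A\<^esub> j)))"

end

theory Submission
  imports Defs "Jordan_Normal_Form.Determinant"
begin

text \<open>
  The diagrams form a basis with integral structure constants, so the trace form
  \<open>(a, b) \<mapsto> tr (left multiplication by ab)\<close> has an integral Gram matrix \<open>G\<close>, independent of the field.
  If \<open>det G\<close> is nonzero in the field, dual bases for the trace form give a Casimir element
  \<open>\<Sum> a\<^sub>i \<otimes> b\<^sub>i\<close> with \<open>\<Sum> a\<^sub>i b\<^sub>i = 1\<close>, and averaging a linear projection onto a left ideal with it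
  yields a right unit of that ideal; hence the algebra is semisimple.
  If \<open>det G\<close> vanishes in the field, the radical of the trace form is a nonzero left ideal; were the
  algebra semisimple, this ideal would have an idempotent right unit \<open>e \<noteq> 0\<close>, and the trace of
  left multiplication by \<open>e\<close>, namely its rank, would be zero in the field. This is impossible if the
  characteristic is zero or exceeds the dimension.
  So both sides of the equivalence amount to \<open>det G \<noteq> 0\<close> over the integers.

  Associativity of the diagram calculus is read off from the action of diagrams on tensor powers of a
  two-dimensional space, which is multiplicative up to the factor \<open>2\<close> per closed loop and faithful.
\<close>

section \<open>Orbits of two involutions\<close>

text \<open>\<open>compose\<close> is defined by \<open>THE\<close> on connected components, so
  before any algebra one must know that a component meeting the outer rows meets them in exactly two
  points. Each diagram is an involution, so a component of the stack is an orbit of a dihedral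
  group, and the claim becomes one about subgroups of the integers. Faithfulness of the tensor
  action concerns single diagrams: their operators can be linearly dependent, but two diagrams whose
  operators agree up to powers of 2 are equal, and so are the powers. Hence dimension 2 already
  determines the composite diagram and the number of loops, and the resulting identities between
  diagrams and exponents serve every parameter \<delta>. The Gram matrix is kept integral so that
  one alternative is decided once for all fields. A nonzero determinant survives modulo every prime
  above its absolute value, and so does a nonzero coordinate of an integral kernel vector. Each case
  therefore loses only finitely many primes.\<close>

definition dihedral_conn :: "('v \<Rightarrow> 'v) \<Rightarrow> ('v \<Rightarrow> 'v) \<Rightarrow> ('v \<times> 'v) set" where
  "dihedral_conn \<alpha> \<beta> = ({(v, \<alpha> v) | v. True} \<union> {(v, \<beta> v) | v. True})\<^sup>*"

lemma dihedral_conn_commute: "dihedral_conn \<alpha> \<beta> = dihedral_conn \<beta> \<alpha>"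
  by (simp add: dihedral_conn_def Un_commute)

lemma dihedral_conn_refl [simp]: "(x, x) \<in> dihedral_conn \<alpha> \<beta>"
  by (simp add: dihedral_conn_def)

lemma dihedral_conn_trans:
  "(x, y) \<in> dihedral_conn \<alpha> \<beta> \<Longrightarrow> (y, z) \<in> dihedral_conn \<alpha> \<beta> \<Longrightarrow> (x, z) \<in> dihedral_conn \<alpha> \<beta>"
  unfolding dihedral_conn_def by (rule rtrancl_trans)

lemma dihedral_conn_step:
  "(x, \<alpha> x) \<in> dihedral_conn \<alpha> \<beta>" "(x, \<beta> x) \<in> dihedral_conn \<alpha> \<beta>"
  unfolding dihedral_conn_def by (auto intro: r_into_rtrancl)

lemma dihedral_conn_invariant:
  assumes "(x, y) \<in> dihedral_conn \<alpha> \<beta>" and "P x"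
    and "\<And>v. P v \<Longrightarrow> P (\<alpha> v)" "\<And>v. P v \<Longrightarrow> P (\<beta> v)"
  shows "P y"
  using assms(1) unfolding dihedral_conn_def
  by (induction rule: rtrancl_induct) (use assms(2-4) in auto)

locale two_involutions =
  fixes \<alpha> \<beta> :: "'v \<Rightarrow> 'v"
  assumes inv_\<alpha> [simp]: "\<alpha> (\<alpha> v) = v" and inv_\<beta> [simp]: "\<beta> (\<beta> v) = v"
begin

text \<open>An involution undoes its own step, so reachability along forward edges is already
  symmetric.\<close>

lemma conn_sym:
  assumes "(x, y) \<in> dihedral_conn \<alpha> \<beta>"
  shows "(y, x) \<in> dihedral_conn \<alpha> \<beta>"
  using assms
proof (rule dihedral_conn_invariant[where P = "\<lambda>y. (y, x) \<in> dihedral_conn \<alpha> \<beta>"])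
  fix v assume v: "(v, x) \<in> dihedral_conn \<alpha> \<beta>"
  show "(\<alpha> v, x) \<in> dihedral_conn \<alpha> \<beta>"
    by (rule dihedral_conn_trans[OF _ v]) (metis dihedral_conn_step(1) inv_\<alpha>)
  show "(\<beta> v, x) \<in> dihedral_conn \<alpha> \<beta>"
    by (rule dihedral_conn_trans[OF _ v]) (metis dihedral_conn_step(2) inv_\<beta>)
qed simp

text \<open>The rotation \<open>\<beta> \<circ> \<alpha>\<close> generates an action of the integers
  on the orbit of \<open>x\<close>; its inverse is \<open>\<alpha> \<circ> \<beta>\<close>, which
  gives the negative steps.\<close>

definition walk :: "'v \<Rightarrow> int \<Rightarrow> 'v" where
  "walk x k = (if k \<ge> 0 then ((\<beta> \<circ> \<alpha>) ^^ nat k) x else ((\<alpha> \<circ> \<beta>) ^^ nat (- k)) x)"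

lemma walk_0 [simp]: "walk x 0 = x"
  by (simp add: walk_def)

lemma walk_Suc: "walk x (k + 1) = \<beta> (\<alpha> (walk x k))"
proof (cases "k \<ge> 0")
  case True
  then have "nat (k + 1) = Suc (nat k)" by simp
  with True show ?thesis by (simp add: walk_def)
next
  case False
  then have e: "nat (- k) = Suc (nat (- (k + 1)))" by simp
  have "walk x k = \<alpha> (\<beta> (((\<alpha> \<circ> \<beta>) ^^ nat (- (k + 1))) x))"
    using False unfolding walk_def e by simp
  moreover have "walk x (k + 1) = ((\<alpha> \<circ> \<beta>) ^^ nat (- (k + 1))) x"
    using False by (cases "k = -1") (auto simp: walk_def)
  ultimately show ?thesis by simp
qed

lemma walk_add: "walk x (k + l) = walk (walk x k) l"
proof (induction l rule: int_induct[where k = 0])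
  case (step1 i)
  then show ?case using walk_Suc[of x "k + i"] walk_Suc[of "walk x k" i] by (simp add: add.assoc)
next
  case (step2 i)
  have "\<beta> (\<alpha> (walk x (k + (i - 1)))) = \<beta> (\<alpha> (walk (walk x k) (i - 1)))"
    using step2 walk_Suc[of x "k + (i - 1)"] walk_Suc[of "walk x k" "i - 1"] by (simp add: add.assoc)
  then show ?case by (metis inv_\<alpha> inv_\<beta>)
qed simp

text \<open>Conjugation by \<alpha> inverts the rotation. As \<alpha> fixes the starting point, it
  acts on the walk as the reflection of the index about 0; \<beta>, the rotation after \<alpha>,
  then reflects about 1/2.\<close>

lemma \<alpha>_walk:
  assumes "\<alpha> x = x"
  shows "\<alpha> (walk x k) = walk x (- k)"
proof (induction k rule: int_induct[where k = 0])
  case base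
  then show ?case using assms by simp
next
  case (step1 i)
  have "\<beta> (\<alpha> (walk x (- (i + 1)))) = walk x (- i)"
    using walk_Suc[of x "- (i + 1)"] by simp
  then have "walk x (- (i + 1)) = \<alpha> (\<beta> (\<alpha> (walk x i)))"
    using step1 by (metis inv_\<alpha> inv_\<beta>)
  then show ?case using walk_Suc[of x i] by simp
next
  case (step2 i)
  have "walk x (- (i - 1)) = \<beta> (walk x i)"
    using walk_Suc[of x "- i"] step2 by (metis inv_\<alpha> minus_diff_eq uminus_add_conv_diff add.commute)
  moreover have "walk x i = \<beta> (\<alpha> (walk x (i - 1)))"
    using walk_Suc[of x "i - 1"] by simp
  ultimately show ?case by simp
qed

lemma \<beta>_walk:
  assumes "\<alpha> x = x"
  shows "\<beta> (walk x k) = walk x (1 - k)"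
  using walk_Suc[of x "- k"] \<alpha>_walk[OF assms, of "- k"] by (simp add: add.commute)

text \<open>Since \<alpha> and \<beta> act on the walk by reflecting its index, the walk is closed
  under both and exhausts the orbit.\<close>

lemma conn_iff_walk:
  assumes "\<alpha> x = x"
  shows "(x, y) \<in> dihedral_conn \<alpha> \<beta> \<longleftrightarrow> (\<exists>k. y = walk x k)"
proof
  assume "(x, y) \<in> dihedral_conn \<alpha> \<beta>"
  then show "\<exists>k. y = walk x k"
  proof (rule dihedral_conn_invariant)
    show "\<exists>k. x = walk x k" by (rule exI[of _ 0]) simp
  qed (use \<alpha>_walk[OF assms] \<beta>_walk[OF assms] in metis)+
next
  have "(x, walk x k) \<in> dihedral_conn \<alpha> \<beta>" for k
  proof (induction k rule: int_induct[where k = 0])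
    case (step1 i)
    then show ?case unfolding walk_Suc by (meson dihedral_conn_step dihedral_conn_trans)
  next
    case (step2 i)
    have "walk x (i - 1) = \<alpha> (\<beta> (walk x i))"
      using walk_Suc[of x "i - 1"] by simp
    then show ?case using step2 by (metis dihedral_conn_step dihedral_conn_trans)
  qed simp
  then show "\<exists>k. y = walk x k \<Longrightarrow> (x, y) \<in> dihedral_conn \<alpha> \<beta>" by auto
qed

lemma walk_eq_iff: "walk x i = walk x j \<longleftrightarrow> walk x (i - j) = x"
proof
  assume "walk x i = walk x j"
  then have "walk (walk x i) (- j) = walk (walk x j) (- j)" by simp
  then show "walk x (i - j) = x" by (simp flip: walk_add)
next
  assume "walk x (i - j) = x"
  then show "walk x i = walk x j" using walk_add[of x "i - j" j] by simp
qed

lemma walk_period_add: "walk x i = x \<Longrightarrow> walk x j = x \<Longrightarrow> walk x (i + j) = x"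
  by (simp add: walk_add)

lemma walk_period_diff: "walk x i = x \<Longrightarrow> walk x j = x \<Longrightarrow> walk x (i - j) = x"
  using walk_eq_iff[of x i j] by simp

lemma walk_period_mult:
  assumes "walk x i = x"
  shows "walk x (i * m) = x"
proof (induction m rule: int_induct[where k = 0])
  case (step1 m)
  then show ?case using walk_period_add[OF _ assms, of "i * m"] by (simp add: distrib_left)
next
  case (step2 m)
  then show ?case using walk_period_diff[OF _ assms, of "i * m"] by (simp add: right_diff_distrib)
qed simp

text \<open>The periods of a walk form a subgroup of the integers, and a quotient of the integers
  has at most one element of order two.\<close>

lemma walk_half_period_unique:
  assumes k: "walk x (2 * k) = x \<or> walk x (2 * k - 1) = x" "walk x k \<noteq> x"
    and l: "walk x (2 * l) = x \<or> walk x (2 * l - 1) = x" "walk x l \<noteq> x"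
  shows "walk x k = walk x l"
proof -
  \<comment> \<open>An odd period makes 2 invertible modulo the group of periods, so the half of any
    even period is a period: m = (2m)j - (2j - 1)m.\<close>
  have mixed: "walk x m = x" if "walk x (2 * j - 1) = x" "walk x (2 * m) = x" for j m
  proof -
    have "walk x ((2 * m) * j - (2 * j - 1) * m) = x"
      by (intro walk_period_diff walk_period_mult that)
    then show ?thesis by (simp add: algebra_simps)
  qed
  \<comment> \<open>If one of the two periods were odd and the other even, \<open>mixed\<close>
    would turn \<open>k\<close> or \<open>l\<close> itself into a period.\<close>
  consider (oo) "walk x (2 * k - 1) = x" "walk x (2 * l - 1) = x"
    | (ee) "walk x (2 * k) = x" "walk x (2 * l) = x"
    using k l mixed by blast
  then have "walk x (k - l) = x"
  proof cases
    case oo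
    have "walk x (2 * (k - l)) = x"
      using walk_period_diff[OF oo] by (simp add: algebra_simps)
    then show ?thesis using mixed oo by blast
  next
    case ee
    \<comment> \<open>Both 2k and 2l are periods, hence so is twice the gcd. The cofactors of
      \<open>k\<close> and \<open>l\<close> must then be odd, and their difference is even.\<close>
    obtain s t where st: "s * k + t * l = gcd k l" using bezout_int by blast
    have "walk x ((2 * k) * s + (2 * l) * t) = x"
      by (intro walk_period_add walk_period_mult ee)
    then have g: "walk x (2 * gcd k l) = x" by (simp add: st[symmetric] algebra_simps)
    obtain k' l' where k': "k = gcd k l * k'" and l': "l = gcd k l * l'"
      by (meson dvdE gcd_dvd1 gcd_dvd2)
    have ev: "walk x (gcd k l * j) = x" if "even j" for j
    proof -
      from that obtain i where "j = 2 * i" by blast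
      then show ?thesis using walk_period_mult[OF g, of i] by (simp add: mult_ac)
    qed
    have "odd k'" "odd l'" using ev k(2) l(2) k' l' by metis+
    then have "walk x (gcd k l * (k' - l')) = x" by (intro ev) simp
    then show ?thesis using k' l' by (metis right_diff_distrib)
  qed
  then show ?thesis using walk_eq_iff by simp
qed

text \<open>A finite walk is periodic; the witness is the point opposite to \<open>x\<close> on the
  cycle of least period n, with index n/2 for even n and (n + 1)/2 for odd n. The case n = 1, where
  the opposite point would be \<open>x\<close>, is what the second assumption excludes.\<close>

lemma walk_half_period_exists:
  assumes "finite (range (walk x))" and "walk x 1 \<noteq> x"
  shows "\<exists>k. (walk x (2 * k) = x \<or> walk x (2 * k - 1) = x) \<and> walk x k \<noteq> x"
proof -
  have "\<not> inj (walk x)"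
    using assms(1) finite_imageD infinite_UNIV_int by blast
  then obtain i j where ij: "walk x i = walk x j" "i > j"
    unfolding inj_def by (metis linorder_neqE_linordered_idom)
  define Q where "Q n \<longleftrightarrow> n > 0 \<and> walk x (int n) = x" for n
  have "Q (nat (i - j))" using ij walk_eq_iff[of x i j] by (simp add: Q_def)
  then have Qn: "Q (LEAST n. Q n)" by (rule LeastI)
  define n where "n = (LEAST n. Q n)"
  have n: "n > 0" "walk x (int n) = x" using Qn by (auto simp: Q_def n_def)
  have small: "walk x (int m) \<noteq> x" if "0 < m" "m < n" for m
    using not_less_Least[of m Q] that unfolding n_def Q_def by blast
  show ?thesis
  proof (cases "even n")
    case True
    then obtain m where m: "n = 2 * m" by blast
    then show ?thesis using n small[of m] by (intro exI[of _ "int m"]) auto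
  next
    case False
    then obtain m where m: "n = 2 * m + 1" by (metis oddE)
    moreover have "m > 0" using n m assms(2) by (cases m) auto
    ultimately show ?thesis using n small[of "m + 1"]
      by (intro exI[of _ "int (m + 1)"]) (auto simp: algebra_simps)
  qed
qed

text \<open>By the reflection formulas, \<open>walk x k\<close> is fixed by \<alpha> exactly when 2k
  is a period, and by \<beta> exactly when 2k - 1 is. The ends other than \<open>x\<close> are thus
  the nontrivial half periods, of which there is exactly one.\<close>

lemma unique_other_end:
  assumes "finite (dihedral_conn \<alpha> \<beta> `` {x})" and "\<alpha> x = x" and "\<beta> x \<noteq> x"
  shows "\<exists>!y. y \<noteq> x \<and> (\<alpha> y = y \<or> \<beta> y = y) \<and> (x, y) \<in> dihedral_conn \<alpha> \<beta>"
proof -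
  have ends: "\<alpha> (walk x k) = walk x k \<or> \<beta> (walk x k) = walk x k
      \<longleftrightarrow> walk x (2 * k) = x \<or> walk x (2 * k - 1) = x" for k
    using walk_eq_iff[of x k "- k"] walk_eq_iff[of x k "1 - k"]
    by (simp add: \<alpha>_walk[OF assms(2)] \<beta>_walk[OF assms(2)] algebra_simps) metis
  have "range (walk x) = dihedral_conn \<alpha> \<beta> `` {x}"
    using conn_iff_walk[OF assms(2)] by auto
  moreover have "walk x 1 \<noteq> x" using \<beta>_walk[OF assms(2), of 0] assms(3) by simp
  ultimately obtain k where k: "walk x (2 * k) = x \<or> walk x (2 * k - 1) = x" "walk x k \<noteq> x"
    using walk_half_period_exists assms(1) by metis
  show ?thesis
  proof (rule ex1I[of _ "walk x k"])
    show "walk x k \<noteq> x \<and> (\<alpha> (walk x k) = walk x k \<or> \<beta> (walk x k) = walk x k)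
        \<and> (x, walk x k) \<in> dihedral_conn \<alpha> \<beta>"
      using k ends conn_iff_walk[OF assms(2)] by blast
  next
    fix y assume y: "y \<noteq> x \<and> (\<alpha> y = y \<or> \<beta> y = y) \<and> (x, y) \<in> dihedral_conn \<alpha> \<beta>"
    then obtain l where l: "y = walk x l" using conn_iff_walk[OF assms(2)] by blast
    then show "y = walk x k" using walk_half_period_unique[OF _ _ k] ends y by blast
  qed
qed

end

section \<open>Concatenation of diagrams\<close>

lemma finite_pts [simp]: "finite (pts d)"
  by (simp add: pts_def)

lemma brauer_diagrams_closed: "m \<in> brauer_diagrams d \<Longrightarrow> p \<in> pts d \<Longrightarrow> m p \<in> pts d"
  by (simp add: brauer_diagrams_def)

lemma brauer_diagrams_neq: "m \<in> brauer_diagrams d \<Longrightarrow> p \<in> pts d \<Longrightarrow> m p \<noteq> p"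
  by (simp add: brauer_diagrams_def)

lemma brauer_diagrams_outside: "m \<in> brauer_diagrams d \<Longrightarrow> p \<notin> pts d \<Longrightarrow> m p = p"
  unfolding brauer_diagrams_def by blast

lemma brauer_diagrams_invol: "m \<in> brauer_diagrams d \<Longrightarrow> m (m p) = p"
  using brauer_diagrams_outside[of m d p] by (cases "p \<in> pts d") (auto simp: brauer_diagrams_def)

lemma finite_brauer_diagrams [simp]: "finite (brauer_diagrams d)"
proof (rule finite_subset)
  show "brauer_diagrams d \<subseteq> {m. m permutes pts d}"
  proof
    fix m assume m: "m \<in> brauer_diagrams d"
    have "\<exists>!x. m x = y" for y
      using brauer_diagrams_invol[OF m] by metis
    then show "m \<in> {m. m permutes pts d}"
      using m by (auto simp: permutes_def brauer_diagrams_outside)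
  qed
qed (simp add: finite_permutations)

text \<open>Extending the matching by the identity turns strand ends into fixed points: among the
  vertices, level 2 is fixed by \<open>act_upper\<close> and level 0 by \<open>act_lower\<close>, so
  the outer points are those fixed by one of the two.\<close>

definition act_upper :: "nat \<Rightarrow> diagram \<Rightarrow> nat \<times> nat \<Rightarrow> nat \<times> nat" where
  "act_upper d a v = (if fst v \<le> 1 \<and> snd v < d then lvl_a (a (fst v = 0, snd v)) else v)"

definition act_lower :: "nat \<Rightarrow> diagram \<Rightarrow> nat \<times> nat \<Rightarrow> nat \<times> nat" where
  "act_lower d b v = (if fst v \<in> {1, 2} \<and> snd v < d then lvl_b (b (fst v = 1, snd v)) else v)"

definition verts :: "nat \<Rightarrow> (nat \<times> nat) set" where
  "verts d = {..2} \<times> {..<d}"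

lemma finite_verts [simp]: "finite (verts d)"
  by (simp add: verts_def)

lemma unlvl_lvl_out [simp]: "unlvl (lvl_out p) = p"
  by (cases p) (auto simp: unlvl_def lvl_out_def)

lemma lvl_out_unlvl: "outer d v \<Longrightarrow> lvl_out (unlvl v) = v"
  by (cases v) (auto simp: unlvl_def lvl_out_def outer_def)

lemma outer_lvl_out [simp]: "outer d (lvl_out p) \<longleftrightarrow> p \<in> pts d"
  by (cases p) (auto simp: outer_def lvl_out_def pts_def)

lemma outer_imp_verts: "outer d v \<Longrightarrow> v \<in> verts d"
  by (cases v) (auto simp: outer_def verts_def)

lemma unlvl_in_pts: "outer d v \<Longrightarrow> unlvl v \<in> pts d"
  by (simp add: unlvl_def outer_def pts_def)

locale stack =
  fixes d :: nat and a b :: diagram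
  assumes a: "a \<in> brauer_diagrams d" and b: "b \<in> brauer_diagrams d"
begin

abbreviation "\<alpha> \<equiv> act_upper d a"
abbreviation "\<beta> \<equiv> act_lower d b"
abbreviation "conn \<equiv> stack_conn d a b"

lemma \<alpha>_lvl_a: "p \<in> pts d \<Longrightarrow> \<alpha> (lvl_a p) = lvl_a (a p)"
  by (cases p) (auto simp: act_upper_def lvl_a_def pts_def)

lemma \<beta>_lvl_b: "p \<in> pts d \<Longrightarrow> \<beta> (lvl_b p) = lvl_b (b p)"
  by (cases p) (auto simp: act_lower_def lvl_b_def pts_def)

lemma upper_lvl_a: "fst v \<le> 1 \<Longrightarrow> snd v < d \<Longrightarrow> \<exists>p\<in>pts d. v = lvl_a p"
  by (rule bexI[of _ "(fst v = 0, snd v)"]) (auto simp: lvl_a_def pts_def prod_eq_iff)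

lemma lower_lvl_b: "fst v \<in> {1, 2} \<Longrightarrow> snd v < d \<Longrightarrow> \<exists>p\<in>pts d. v = lvl_b p"
  by (rule bexI[of _ "(fst v = 1, snd v)"]) (auto simp: lvl_b_def pts_def prod_eq_iff)

lemma lvl_a_upper: "p \<in> pts d \<Longrightarrow> fst (lvl_a p) \<le> 1 \<and> snd (lvl_a p) < d"
  by (auto simp: lvl_a_def pts_def)

lemma lvl_b_lower: "p \<in> pts d \<Longrightarrow> fst (lvl_b p) \<in> {1, 2} \<and> snd (lvl_b p) < d"
  by (auto simp: lvl_b_def pts_def)

lemma lvl_a_inject [simp]: "lvl_a p = lvl_a q \<longleftrightarrow> p = q"
  by (cases p; cases q) (auto simp: lvl_a_def split: if_splits)

lemma lvl_b_inject [simp]: "lvl_b p = lvl_b q \<longleftrightarrow> p = q"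
  by (cases p; cases q) (auto simp: lvl_b_def split: if_splits)

lemma \<alpha>_outside: "\<not> (fst v \<le> 1 \<and> snd v < d) \<Longrightarrow> \<alpha> v = v"
  by (auto simp: act_upper_def)

lemma \<beta>_outside: "\<not> (fst v \<in> {1, 2} \<and> snd v < d) \<Longrightarrow> \<beta> v = v"
  by (auto simp: act_lower_def)

lemma \<alpha>_upper:
  assumes "fst v \<le> 1" "snd v < d"
  shows "fst (\<alpha> v) \<le> 1" "snd (\<alpha> v) < d" "\<alpha> v \<noteq> v" "\<alpha> (\<alpha> v) = v"
proof -
  obtain p where p: "p \<in> pts d" "v = lvl_a p" using upper_lvl_a assms by blast
  have ap: "a p \<in> pts d" using a p brauer_diagrams_closed by blast
  show "fst (\<alpha> v) \<le> 1" "snd (\<alpha> v) < d" "\<alpha> v \<noteq> v" "\<alpha> (\<alpha> v) = v"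
    using p ap lvl_a_upper[OF ap] brauer_diagrams_neq[OF a] brauer_diagrams_invol[OF a]
    by (auto simp: \<alpha>_lvl_a)
qed

lemma \<beta>_lower:
  assumes "fst v \<in> {1, 2}" "snd v < d"
  shows "fst (\<beta> v) \<in> {1, 2}" "snd (\<beta> v) < d" "\<beta> v \<noteq> v" "\<beta> (\<beta> v) = v"
proof -
  obtain p where p: "p \<in> pts d" "v = lvl_b p" using lower_lvl_b assms by blast
  have bp: "b p \<in> pts d" using b p brauer_diagrams_closed by blast
  show "fst (\<beta> v) \<in> {1, 2}" "snd (\<beta> v) < d" "\<beta> v \<noteq> v" "\<beta> (\<beta> v) = v"
    using p bp lvl_b_lower[OF bp] brauer_diagrams_neq[OF b] brauer_diagrams_invol[OF b]
    by (auto simp: \<beta>_lvl_b)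
qed

sublocale two_involutions \<alpha> \<beta>
proof
  show "\<alpha> (\<alpha> v) = v" for v
    by (cases "fst v \<le> 1 \<and> snd v < d") (auto simp: \<alpha>_upper \<alpha>_outside)
  show "\<beta> (\<beta> v) = v" for v
    by (cases "fst v \<in> {1, 2} \<and> snd v < d") (blast intro: \<beta>_lower, metis \<beta>_outside)
qed

text \<open>The two involutions contribute the strands of the diagrams in both directions, together
  with steps from fixed vertices to themselves, which the reflexive closure absorbs.\<close>

lemma stack_conn_eq: "conn = dihedral_conn \<alpha> \<beta>"
  unfolding stack_conn_def dihedral_conn_def
proof (rule rtrancl_subset[symmetric])
  have "stack_edges d a b \<subseteq> {(v, \<alpha> v) |v. True} \<union> {(v, \<beta> v) |v. True}"
    unfolding stack_edges_def using \<alpha>_lvl_a[symmetric] \<beta>_lvl_b[symmetric] by fastforce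
  moreover have "({(v, \<alpha> v) |v. True} \<union> {(v, \<beta> v) |v. True})\<inverse>
      \<subseteq> {(v, \<alpha> v) |v. True} \<union> {(v, \<beta> v) |v. True}"
    by force
  ultimately show "stack_edges d a b \<union> (stack_edges d a b)\<inverse>
      \<subseteq> {(v, \<alpha> v) |v. True} \<union> {(v, \<beta> v) |v. True}"
    by blast
next
  let ?E = "stack_edges d a b"
  have "(v, \<alpha> v) \<in> (?E \<union> ?E\<inverse>)\<^sup>*" for v
  proof (cases "fst v \<le> 1 \<and> snd v < d")
    case True
    then obtain p where "p \<in> pts d" "v = lvl_a p" using upper_lvl_a by blast
    then have "(v, \<alpha> v) \<in> ?E" using \<alpha>_lvl_a unfolding stack_edges_def by blast
    then show ?thesis by blast
  qed (simp add: \<alpha>_outside)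
  moreover have "(v, \<beta> v) \<in> (?E \<union> ?E\<inverse>)\<^sup>*" for v
  proof (cases "fst v \<in> {1, 2} \<and> snd v < d")
    case True
    then obtain p where "p \<in> pts d" "v = lvl_b p" using lower_lvl_b by blast
    then have "(v, \<beta> v) \<in> ?E" using \<beta>_lvl_b unfolding stack_edges_def by blast
    then show ?thesis by blast
  next
    case False
    then show ?thesis using \<beta>_outside[OF False] by simp
  qed
  ultimately show "{(v, \<alpha> v) |v. True} \<union> {(v, \<beta> v) |v. True} \<subseteq> (?E \<union> ?E\<inverse>)\<^sup>*"
    by auto
qed

lemma \<alpha>_fixes_iff: "v \<in> verts d \<Longrightarrow> \<alpha> v = v \<longleftrightarrow> fst v = 2"
  using \<alpha>_upper(3)[of v] \<alpha>_outside[of v] by (cases v) (fastforce simp: verts_def)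

lemma \<beta>_fixes_iff: "v \<in> verts d \<Longrightarrow> \<beta> v = v \<longleftrightarrow> fst v = 0"
proof -
  assume v: "v \<in> verts d"
  then have "fst v = 0 \<or> fst v \<in> {1, 2}" "snd v < d" by (auto simp: verts_def)
  then show ?thesis using \<beta>_lower(3)[of v] \<beta>_outside[of v] by auto
qed

lemma conn_refl [simp]: "(v, v) \<in> conn"
  by (simp add: stack_conn_def)

lemma conn_trans: "(x, y) \<in> conn \<Longrightarrow> (y, z) \<in> conn \<Longrightarrow> (x, z) \<in> conn"
  unfolding stack_conn_def by (rule rtrancl_trans)

lemma stack_conn_sym: "(x, y) \<in> conn \<Longrightarrow> (y, x) \<in> conn"
  unfolding stack_conn_eq by (rule conn_sym)

lemma conn_class_eq: "(x, y) \<in> conn \<Longrightarrow> conn `` {x} = conn `` {y}"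
  using conn_trans stack_conn_sym by blast

lemma \<alpha>_verts: "v \<in> verts d \<Longrightarrow> \<alpha> v \<in> verts d"
  using \<alpha>_upper(1,2)[of v] \<alpha>_outside[of v]
  by (cases "fst v \<le> 1 \<and> snd v < d") (force simp: verts_def mem_Times_iff)+

lemma \<beta>_verts: "v \<in> verts d \<Longrightarrow> \<beta> v \<in> verts d"
  using \<beta>_lower(1,2)[of v] \<beta>_outside[of v]
  by (cases "fst v \<in> {1, 2} \<and> snd v < d") (force simp: verts_def mem_Times_iff)+

lemma conn_verts: "(x, y) \<in> conn \<Longrightarrow> x \<in> verts d \<Longrightarrow> y \<in> verts d"
  unfolding stack_conn_eq by (erule dihedral_conn_invariant) (auto simp: \<alpha>_verts \<beta>_verts)

lemma conn_class_subset: "x \<in> verts d \<Longrightarrow> conn `` {x} \<subseteq> verts d"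
  using conn_verts by blast

lemma finite_conn_class: "x \<in> verts d \<Longrightarrow> finite (conn `` {x})"
  using conn_class_subset finite_verts finite_subset by metis

lemma outer_iff_fixed: "v \<in> verts d \<Longrightarrow> outer d v \<longleftrightarrow> \<alpha> v = v \<or> \<beta> v = v"
  by (subst \<alpha>_fixes_iff, assumption, subst \<beta>_fixes_iff, assumption)
     (auto simp: outer_def verts_def)

lemma unique_outer_partner:
  assumes "outer d x"
  shows "\<exists>!y. y \<noteq> x \<and> outer d y \<and> (x, y) \<in> conn"
proof -
  have x: "x \<in> verts d" using assms outer_imp_verts by blast
  have fin: "finite (dihedral_conn \<alpha> \<beta> `` {x})"
    using finite_conn_class[OF x] by (simp add: stack_conn_eq)
  have "\<exists>!y. y \<noteq> x \<and> (\<alpha> y = y \<or> \<beta> y = y) \<and> (x, y) \<in> dihedral_conn \<alpha> \<beta>"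
  proof (cases "\<alpha> x = x")
    case True
    then have "\<beta> x \<noteq> x" using x \<alpha>_fixes_iff \<beta>_fixes_iff by auto
    then show ?thesis using unique_other_end[OF fin True] by blast
  next
    case False
    then have "\<beta> x = x" using assms x outer_iff_fixed by blast
    \<comment> \<open>\<open>unique_other_end\<close> starts from a fixed point of the first
      involution. Vertices of the top row are fixed by \<beta>, so the roles are exchanged.\<close>
    interpret swap: two_involutions \<beta> \<alpha> by unfold_locales auto
    show ?thesis
      using swap.unique_other_end[of x] fin \<open>\<beta> x = x\<close> False
      by (simp add: dihedral_conn_commute[of \<beta> \<alpha>] disj_commute)
  qed
  moreover have "y \<noteq> x \<and> outer d y \<and> (x, y) \<in> conn
      \<longleftrightarrow> y \<noteq> x \<and> (\<alpha> y = y \<or> \<beta> y = y) \<and> (x, y) \<in> dihedral_conn \<alpha> \<beta>" for y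
    using conn_verts[OF _ x] outer_iff_fixed stack_conn_eq by metis
  ultimately show ?thesis by simp
qed

lemma compose_props:
  assumes "p \<in> pts d"
  shows "compose d a b p \<in> pts d" "compose d a b p \<noteq> p"
    "(lvl_out p, lvl_out (compose d a b p)) \<in> conn"
proof -
  define w where "w = (THE w. w \<noteq> lvl_out p \<and> outer d w \<and> (lvl_out p, w) \<in> conn)"
  have w: "w \<noteq> lvl_out p \<and> outer d w \<and> (lvl_out p, w) \<in> conn"
    unfolding w_def by (rule theI', rule unique_outer_partner) (simp add: assms)
  have c: "compose d a b p = unlvl w" using assms by (simp add: compose_def w_def)
  then show "compose d a b p \<in> pts d" using w unlvl_in_pts by simp
  have "lvl_out (compose d a b p) = w" using c w lvl_out_unlvl by metis
  then show "compose d a b p \<noteq> p" "(lvl_out p, lvl_out (compose d a b p)) \<in> conn"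
    using w by auto
qed

lemma compose_unique:
  assumes "p \<in> pts d" "q \<in> pts d" "q \<noteq> p" "(lvl_out p, lvl_out q) \<in> conn"
  shows "compose d a b p = q"
proof -
  have "lvl_out (compose d a b p) = lvl_out q"
    using unique_outer_partner[of "lvl_out p"] compose_props[OF assms(1)] assms
    by (metis outer_lvl_out unlvl_lvl_out)
  then show ?thesis by (metis unlvl_lvl_out)
qed

lemma compose_brauer: "compose d a b \<in> brauer_diagrams d"
  unfolding brauer_diagrams_def
proof (intro CollectI conjI ballI allI impI)
  fix p assume p: "p \<in> pts d"
  show "compose d a b p \<in> pts d" "compose d a b p \<noteq> p" using compose_props p by auto
  show "compose d a b (compose d a b p) = p"
    by (rule compose_unique)
      (use compose_props[OF p] p stack_conn_sym in \<open>auto dest: sym\<close>)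
qed (simp add: compose_def)

lemma outer_class:
  assumes "p \<in> pts d"
  shows "{w \<in> conn `` {lvl_out p}. outer d w} = {lvl_out p, lvl_out (compose d a b p)}"
proof -
  have "w = lvl_out p \<or> w = lvl_out (compose d a b p)" if "(lvl_out p, w) \<in> conn" "outer d w" for w
    using compose_unique[OF assms, of "unlvl w"] that lvl_out_unlvl unlvl_in_pts by metis
  then show ?thesis using compose_props[OF assms] assms by auto
qed

end

section \<open>Diagrams as operators on tensor powers\<close>

definition lab :: "nat set \<Rightarrow> nat set \<Rightarrow> bool \<times> nat \<Rightarrow> bool" where
  "lab f g p \<longleftrightarrow> snd p \<in> (if fst p then f else g)"

text \<open>A basis vector of the tensor power is coded by the set of positions that carry the
  second basis vector. The sets \<open>f\<close>, \<open>g\<close>, \<open>h\<close> label the top,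
  middle and bottom row, so that summing over \<open>g\<close> is matrix multiplication.\<close>

definition lab3 :: "nat set \<Rightarrow> nat set \<Rightarrow> nat set \<Rightarrow> nat \<times> nat \<Rightarrow> bool" where
  "lab3 f g h v \<longleftrightarrow> snd v \<in> (if fst v = 0 then f else if fst v = 1 then g else h)"

text \<open>\<open>compatible d m f g\<close> is the matrix entry at \<open>(f, g)\<close> of the diagram \<open>m\<close> acting on the
  \<open>d\<close>-th tensor power of a two-dimensional space with an orthonormal basis.\<close>

definition compatible :: "nat \<Rightarrow> diagram \<Rightarrow> nat set \<Rightarrow> nat set \<Rightarrow> bool" where
  "compatible d m f g \<longleftrightarrow> (\<forall>p\<in>pts d. lab f g (m p) = lab f g p)"

lemma lab3_lvl_a: "lab3 f g h (lvl_a p) = lab f g p"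
  by (simp add: lab3_def lab_def lvl_a_def)

lemma lab3_lvl_b: "lab3 f g h (lvl_b p) = lab g h p"
  by (simp add: lab3_def lab_def lvl_b_def)

lemma lab3_lvl_out: "lab3 f g h (lvl_out p) = lab f h p"
  by (simp add: lab3_def lab_def lvl_out_def)

context stack
begin

lemma compat_conn:
  assumes "compatible d a f g" "compatible d b g h" and "(x, y) \<in> conn"
  shows "lab3 f g h x = lab3 f g h y"
proof -
  have "lab3 f g h (\<alpha> v) = lab3 f g h v" for v
  proof (cases "fst v \<le> 1 \<and> snd v < d")
    case True
    then obtain p where "p \<in> pts d" "v = lvl_a p" using upper_lvl_a by blast
    then show ?thesis using assms(1) by (simp add: \<alpha>_lvl_a lab3_lvl_a compatible_def)
  qed (simp add: \<alpha>_outside)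
  moreover have "lab3 f g h (\<beta> v) = lab3 f g h v" for v
  proof (cases "fst v \<in> {1, 2} \<and> snd v < d")
    case True
    then obtain p where "p \<in> pts d" "v = lvl_b p" using lower_lvl_b by blast
    then show ?thesis using assms(2) by (simp add: \<beta>_lvl_b lab3_lvl_b compatible_def)
  next
    case False
    then show ?thesis using \<beta>_outside[OF False] by simp
  qed
  ultimately show ?thesis
    using dihedral_conn_invariant[of x y \<alpha> \<beta> "\<lambda>v. lab3 f g h x = lab3 f g h v"] assms(3)
    by (simp add: stack_conn_eq)
qed

lemma conn_compat:
  assumes "\<And>x y. x \<in> verts d \<Longrightarrow> (x, y) \<in> conn \<Longrightarrow> lab3 f g h x = lab3 f g h y"
  shows "compatible d a f g" "compatible d b g h"
proof -
  have *: "(x, \<alpha> x) \<in> conn" "(x, \<beta> x) \<in> conn" for x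
    by (auto simp: stack_conn_eq dihedral_conn_step)
  show "compatible d a f g"
    unfolding compatible_def
  proof
    fix p assume p: "p \<in> pts d"
    have "lvl_a p \<in> verts d" using p by (auto simp: lvl_a_def verts_def pts_def)
    then show "lab f g (a p) = lab f g p"
      using assms[OF _ *(1)] \<alpha>_lvl_a[OF p] lab3_lvl_a by metis
  qed
  show "compatible d b g h"
    unfolding compatible_def
  proof
    fix p assume p: "p \<in> pts d"
    have "lvl_b p \<in> verts d" using p by (auto simp: lvl_b_def verts_def pts_def)
    then show "lab g h (b p) = lab g h p"
      using assms[OF _ *(2)] \<beta>_lvl_b[OF p] lab3_lvl_b by metis
  qed
qed

lemma compat_compose:
  assumes "compatible d a f g" "compatible d b g h"
  shows "compatible d (compose d a b) f h"
  unfolding compatible_def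
  using compat_conn[OF assms compose_props(3)] by (simp add: lab3_lvl_out)

definition loop_classes :: "(nat \<times> nat) set set" where
  "loop_classes = {conn `` {v} | v. fst v = 1 \<and> snd v < d \<and> (\<forall>w \<in> conn `` {v}. \<not> outer d w)}"

lemma loops_eq: "loops d a b = card loop_classes"
  by (simp add: loops_def loop_classes_def)

lemma finite_loop_classes: "finite loop_classes"
proof -
  have "loop_classes \<subseteq> (\<lambda>v. conn `` {v}) ` verts d"
    by (force simp: loop_classes_def verts_def)
  then show ?thesis by (rule finite_subset) simp
qed

lemma class_in_loop_classes:
  assumes "v \<in> verts d"
  shows "conn `` {v} \<in> loop_classes \<longleftrightarrow> (\<forall>w \<in> conn `` {v}. \<not> outer d w)"
proof
  assume "conn `` {v} \<in> loop_classes"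
  then show "\<forall>w \<in> conn `` {v}. \<not> outer d w" by (auto simp: loop_classes_def)
next
  assume *: "\<forall>w \<in> conn `` {v}. \<not> outer d w"
  then have "\<not> outer d v" by simp
  then have "fst v = 1" "snd v < d" using assms by (auto simp: verts_def outer_def)
  then show "conn `` {v} \<in> loop_classes" using * unfolding loop_classes_def by blast
qed

text \<open>This rebuilds a labelling of the whole stack from its free data: \<open>S\<close> is the
  set of closed loops labelled \<open>True\<close>, and every other component inherits the label of
  an outer point. The empty middle row is a placeholder, since \<open>lab3 f {} h\<close> is
  evaluated at outer points only.\<close>

definition class_lab :: "nat set \<Rightarrow> nat set \<Rightarrow> (nat \<times> nat) set set \<Rightarrow> nat \<times> nat \<Rightarrow> bool" where
  "class_lab f h S v \<longleftrightarrow>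
    (if conn `` {v} \<in> loop_classes then conn `` {v} \<in> S
     else \<exists>w \<in> conn `` {v}. outer d w \<and> lab3 f {} h w)"

lemma class_lab_conn: "(x, y) \<in> conn \<Longrightarrow> class_lab f h S x = class_lab f h S y"
  unfolding class_lab_def using conn_class_eq by simp

text \<open>The component of \<open>v\<close> has just two outer points, and compatibility with the
  composite says that they carry the same label. The existential in \<open>class_lab\<close>
  therefore returns this common label.\<close>

lemma class_lab_outer:
  assumes "compatible d (compose d a b) f h" "outer d v"
  shows "class_lab f h S v = lab3 f {} h v"
proof -
  define p where "p = unlvl v"
  have p: "p \<in> pts d" "v = lvl_out p" using assms(2) unlvl_in_pts lvl_out_unlvl by (auto simp: p_def)
  have "conn `` {v} \<notin> loop_classes"
    using assms(2) class_in_loop_classes[of v] outer_imp_verts by auto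
  then have "class_lab f h S v \<longleftrightarrow> (\<exists>w \<in> {w \<in> conn `` {v}. outer d w}. lab3 f {} h w)"
    by (auto simp: class_lab_def)
  also have "\<dots> \<longleftrightarrow> lab3 f {} h v"
    using outer_class[OF p(1)] assms(1) p by (auto simp: lab3_lvl_out compatible_def)
  finally show ?thesis .
qed

text \<open>A compatible labelling is constant on components. On components that reach an outer row
  its value is forced by \<open>f\<close> and \<open>h\<close>; each closed loop may take either
  label. \<Phi> reads off the loops labelled \<open>True\<close>, and \<Psi> realises any such
  choice.\<close>

lemma card_middle_labels:
  assumes "f \<subseteq> {..<d}" "h \<subseteq> {..<d}" and c: "compatible d (compose d a b) f h"
  shows "card {g \<in> Pow {..<d}. compatible d a f g \<and> compatible d b g h} = 2 ^ loops d a b"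
proof -
  let ?M = "{g \<in> Pow {..<d}. compatible d a f g \<and> compatible d b g h}"
  define \<Phi> where "\<Phi> g = {C \<in> loop_classes. \<forall>v\<in>C. lab3 f g h v}" for g
  define \<Psi> where "\<Psi> S = {i. i < d \<and> class_lab f h S (1, i)}" for S
  have lab_\<Psi>: "lab3 f (\<Psi> S) h v = class_lab f h S v" if v: "v \<in> verts d" for S v
  proof (cases "fst v = 1")
    case True
    then have "v = (1, snd v)" by (simp add: prod_eq_iff)
    then show ?thesis using v True by (auto simp: lab3_def \<Psi>_def verts_def)
  next
    case False
    then have "outer d v" using v by (auto simp: outer_def verts_def)
    then show ?thesis using False class_lab_outer[OF c] by (simp add: lab3_def)
  qed
  have "bij_betw \<Phi> ?M (Pow loop_classes)"
  proof (rule bij_betw_byWitness[where f' = \<Psi>])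
    show "\<Phi> ` ?M \<subseteq> Pow loop_classes" by (auto simp: \<Phi>_def)
    have "compatible d a f (\<Psi> S)" "compatible d b (\<Psi> S) h" for S
      using conn_compat[of f "\<Psi> S" h] lab_\<Psi> conn_verts class_lab_conn by metis+
    then show "\<Psi> ` Pow loop_classes \<subseteq> ?M" by (auto simp: \<Psi>_def)
    show "\<forall>g\<in>?M. \<Psi> (\<Phi> g) = g"
    proof
      fix g assume g: "g \<in> ?M"
      have inv: "lab3 f g h x = lab3 f g h y" if "(x, y) \<in> conn" for x y
        using g compat_conn that by blast
      have "class_lab f h (\<Phi> g) (1, i) = (i \<in> g)" if i: "i < d" for i
      proof (cases "conn `` {(1, i)} \<in> loop_classes")
        case True
        have "lab3 f g h (1, i) \<longleftrightarrow> (\<forall>v\<in>conn `` {(1, i)}. lab3 f g h v)"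
          using inv[of "(1, i)"] conn_refl by blast
        then show ?thesis using True by (simp add: class_lab_def \<Phi>_def) (simp add: lab3_def)
      next
        case False
        then obtain w where w: "((1, i), w) \<in> conn" "outer d w"
          using class_in_loop_classes[of "(1, i)"] i by (auto simp: verts_def)
        have o: "lab3 f {} h w' = (i \<in> g)" if "((1, i), w') \<in> conn" "outer d w'" for w'
          using inv[OF that(1)] that(2) by (auto simp: lab3_def outer_def)
        show ?thesis unfolding class_lab_def using False w o by (metis Image_singleton_iff)
      qed
      then show "\<Psi> (\<Phi> g) = g" using g by (auto simp: \<Psi>_def)
    qed
    show "\<forall>S\<in>Pow loop_classes. \<Phi> (\<Psi> S) = S"
    proof
      fix S assume S: "S \<in> Pow loop_classes"
      have "(\<forall>v\<in>C. lab3 f (\<Psi> S) h v) \<longleftrightarrow> C \<in> S" if C: "C \<in> loop_classes" for C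
      proof -
        obtain v where v: "C = conn `` {v}" "fst v = 1" "snd v < d"
          using C by (auto simp: loop_classes_def)
        have vv: "v \<in> verts d" using v by (cases v) (auto simp: verts_def)
        have "lab3 f (\<Psi> S) h w \<longleftrightarrow> C \<in> S" if "w \<in> C" for w
        proof -
          have "conn `` {w} = C" using that v conn_class_eq by auto
          moreover have "w \<in> verts d" using that v conn_verts[OF _ vv] by auto
          ultimately show ?thesis using lab_\<Psi> C by (simp add: class_lab_def)
        qed
        moreover have "v \<in> C" using v by simp
        ultimately show ?thesis by blast
      qed
      then show "\<Phi> (\<Psi> S) = S" using S by (auto simp: \<Phi>_def)
    qed
  qed
  then have "card ?M = card (Pow loop_classes)" by (rule bij_betw_same_card)
  then show ?thesis using finite_loop_classes by (simp add: card_Pow loops_eq)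
qed

text \<open>Multiplicativity of the action up to powers of 2. If the outer labels do not fit the
  composite, no middle labelling exists and both sides vanish.\<close>

lemma sum_compat:
  assumes "f \<subseteq> {..<d}" "h \<subseteq> {..<d}"
  shows "(\<Sum>g\<in>Pow {..<d}. of_bool (compatible d a f g) * of_bool (compatible d b g h))
    = (2 ^ loops d a b * of_bool (compatible d (compose d a b) f h) :: nat)"
proof -
  let ?M = "{g \<in> Pow {..<d}. compatible d a f g \<and> compatible d b g h}"
  have "(\<Sum>g\<in>Pow {..<d}. of_bool (compatible d a f g) * of_bool (compatible d b g h)) = card ?M"
    by (simp add: of_bool_conj[symmetric] sum_of_bool_eq Int_def)
  also have "\<dots> = 2 ^ loops d a b * of_bool (compatible d (compose d a b) f h)"
  proof (cases "compatible d (compose d a b) f h")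
    case True
    then show ?thesis using card_middle_labels[OF assms True] by simp
  next
    case False
    then have "?M = {}" using compat_compose by blast
    with False show ?thesis by simp
  qed
  finally show ?thesis .
qed

text \<open>Along a component of the stacked diagram the signs cancel on the upper two levels and on the
  lower two levels, hence the signs on the top level and on the bottom level have the same sum.\<close>

lemma flip_compose:
  fixes e :: "nat \<times> nat \<Rightarrow> int"
  assumes e\<alpha>: "\<And>v. v \<in> verts d \<Longrightarrow> fst v \<noteq> 2 \<Longrightarrow> e (\<alpha> v) = - e v"
    and e\<beta>: "\<And>v. v \<in> verts d \<Longrightarrow> fst v \<noteq> 0 \<Longrightarrow> e (\<beta> v) = - e v"
    and p: "p \<in> pts d"
  shows "e (lvl_out (compose d a b p))
    = (if fst (compose d a b p) = fst p then - e (lvl_out p) else e (lvl_out p))"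
proof -
  define x where "x = lvl_out p"
  define y where "y = lvl_out (compose d a b p)"
  define C where "C = conn `` {x}"
  have x: "x \<in> verts d" using p outer_imp_verts by (simp add: x_def)
  have C: "C \<subseteq> verts d" "finite C"
    using conn_class_subset[OF x] finite_conn_class[OF x] by (auto simp: C_def)
  have CC: "\<alpha> v \<in> C" "\<beta> v \<in> C" if "v \<in> C" for v
    using that conn_trans dihedral_conn_step(1)[of v \<alpha> \<beta>, folded stack_conn_eq]
      dihedral_conn_step(2)[of v \<beta> \<alpha>, folded stack_conn_eq] unfolding C_def by blast+
  have levels: "fst v = 0 \<or> fst v = 1 \<or> fst v = 2" "snd v < d" if "v \<in> C" for v
  proof -
    have "v \<in> verts d" using C(1) that by blast
    then show "fst v = 0 \<or> fst v = 1 \<or> fst v = 2" "snd v < d" by (auto simp: verts_def)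
  qed
  define L where "L i = {v \<in> C. fst v = i}" for i
  have sum_L: "sum e (L i \<union> L j) = sum e (L i) + sum e (L j)" if "i \<noteq> j" for i j
    by (rule sum.union_disjoint) (use C(2) that in \<open>auto simp: L_def\<close>)
  \<comment> \<open>Reindexing by an involution that negates \<open>e\<close> shows that the sum
    equals its own negative.\<close>
  have sum_zero: "sum e B = 0"
    if "\<And>v. v \<in> B \<Longrightarrow> \<gamma> v \<in> B" "\<And>v. \<gamma> (\<gamma> v) = v" "\<And>v. v \<in> B \<Longrightarrow> e (\<gamma> v) = - e v" for B \<gamma>
  proof -
    have "sum e B = (\<Sum>v\<in>B. e (\<gamma> v))"
      by (rule sum.reindex_bij_witness[of _ \<gamma> \<gamma>]) (use that in auto)
    also have "\<dots> = - sum e B" using that by (simp add: sum_negf)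
    finally show ?thesis by simp
  qed
  have "sum e {v \<in> C. fst v \<noteq> 2} = 0"
  proof (rule sum_zero[of _ \<alpha>])
    fix v assume v: "v \<in> {v \<in> C. fst v \<noteq> 2}"
    then have "v \<in> verts d" using C by auto
    then have "\<alpha> (\<alpha> v) \<noteq> \<alpha> v" using v \<alpha>_fixes_iff by (metis (mono_tags) inv_\<alpha> mem_Collect_eq)
    then show "\<alpha> v \<in> {v \<in> C. fst v \<noteq> 2}"
      using v CC \<alpha>_fixes_iff[of "\<alpha> v"] \<alpha>_verts \<open>v \<in> verts d\<close> by auto
    show "e (\<alpha> v) = - e v" using e\<alpha> \<open>v \<in> verts d\<close> v by simp
  qed simp
  also have "{v \<in> C. fst v \<noteq> 2} = L 0 \<union> L 1" unfolding L_def using levels(1) by fastforce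
  finally have "sum e (L 0 \<union> L 1) = 0" .
  then have s01: "sum e (L 0) + sum e (L 1) = 0" by (simp add: sum_L)
  have "sum e {v \<in> C. fst v \<noteq> 0} = 0"
  proof (rule sum_zero[of _ \<beta>])
    fix v assume v: "v \<in> {v \<in> C. fst v \<noteq> 0}"
    then have "v \<in> verts d" using C by auto
    then have "\<beta> (\<beta> v) \<noteq> \<beta> v" using v \<beta>_fixes_iff by (metis (mono_tags) inv_\<beta> mem_Collect_eq)
    then show "\<beta> v \<in> {v \<in> C. fst v \<noteq> 0}"
      using v CC \<beta>_fixes_iff[of "\<beta> v"] \<beta>_verts \<open>v \<in> verts d\<close> by auto
    show "e (\<beta> v) = - e v" using e\<beta> \<open>v \<in> verts d\<close> v by simp
  qed simp
  also have "{v \<in> C. fst v \<noteq> 0} = L 1 \<union> L 2" unfolding L_def using levels(1) by fastforce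
  finally have "sum e (L 1 \<union> L 2) = 0" .
  then have s12: "sum e (L 1) + sum e (L 2) = 0" by (simp add: sum_L)
  have out: "{w \<in> C. outer d w} = {x, y}" unfolding C_def x_def y_def by (rule outer_class[OF p])
  have xy: "x \<noteq> y" using compose_props(2)[OF p] by (metis unlvl_lvl_out x_def y_def)
  \<comment> \<open>Only \<open>x\<close> and \<open>y\<close> contribute to the two outer levels.
    With equal sums there, the values of \<open>e\<close> add up to zero if both points lie in one
    row and coincide if they lie in different rows.\<close>
  have L: "L 0 = {v \<in> {x, y}. fst v = 0}" "L 2 = {v \<in> {x, y}. fst v = 2}"
    using levels by (auto simp: L_def out[symmetric] outer_def)
  have "fst x = (if fst p then 0 else 2)" "fst y = (if fst (compose d a b p) then 0 else 2)"
    by (auto simp: x_def y_def lvl_out_def)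
  then have "L 0 = (if fst p then {x} else {}) \<union> (if fst (compose d a b p) then {y} else {})"
    "L 2 = (if fst p then {} else {x}) \<union> (if fst (compose d a b p) then {} else {y})"
    unfolding L by (auto split: if_splits)
  then show ?thesis using s01 s12 xy by (auto simp: x_def[symmetric] y_def[symmetric] split: if_splits)
qed

end

section \<open>Associativity and unit laws of concatenation\<close>

lemma id_diagram_brauer: "id_diagram d \<in> brauer_diagrams d"
  by (auto simp: brauer_diagrams_def id_diagram_def pts_def)

lemma compose_brauer_diagrams:
  "a \<in> brauer_diagrams d \<Longrightarrow> b \<in> brauer_diagrams d \<Longrightarrow> compose d a b \<in> brauer_diagrams d"
  by (rule stack.compose_brauer) (rule stack.intro)

text \<open>The constant labelling has matrix entry 1 for every diagram, so this entry isolates the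
  scalar in a multiple of a diagram operator.\<close>

lemma compat_full:
  assumes "m \<in> brauer_diagrams d"
  shows "compatible d m {..<d} {..<d}"
proof -
  have "lab {..<d} {..<d} p" if "p \<in> pts d" for p
    using that by (auto simp: lab_def pts_def)
  then show ?thesis using brauer_diagrams_closed[OF assms] by (simp add: compatible_def)
qed

text \<open>The test labelling marks only the two ends of the strand of \<open>x\<close> at
  \<open>p\<close>. Compatibility of \<open>y\<close> with it confines \<open>y p\<close> to these
  two points, and \<open>y\<close> has no fixed point there.\<close>

lemma compat_determines:
  assumes x: "x \<in> brauer_diagrams d" and y: "y \<in> brauer_diagrams d"
    and eq: "\<And>f g. f \<subseteq> {..<d} \<Longrightarrow> g \<subseteq> {..<d} \<Longrightarrow> compatible d x f g \<Longrightarrow> compatible d y f g"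
  shows "x = y"
proof
  fix p
  show "x p = y p"
  proof (cases "p \<in> pts d")
    case True
    define f where "f = {i. (True, i) \<in> {p, x p}}"
    define g where "g = {i. (False, i) \<in> {p, x p}}"
    have lab: "lab f g q \<longleftrightarrow> q \<in> {p, x p}" for q
      by (cases q) (auto simp: lab_def f_def g_def)
    have "x p \<in> pts d" using x True brauer_diagrams_closed by blast
    then have "f \<subseteq> {..<d}" "g \<subseteq> {..<d}" using True by (auto simp: f_def g_def pts_def)
    moreover have "compatible d x f g"
      unfolding compatible_def lab using brauer_diagrams_invol[OF x] by (metis insert_iff singletonD)
    ultimately have "compatible d y f g" by (rule eq)
    then have "y p \<in> {p, x p}" using True lab unfolding compatible_def by blast
    then show ?thesis using brauer_diagrams_neq[OF y True] by auto
  next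
    case False
    then show ?thesis using x y brauer_diagrams_outside by metis
  qed
qed

lemma scaled_compat_determines:
  assumes x: "x \<in> brauer_diagrams d" and y: "y \<in> brauer_diagrams d"
    and eq: "\<And>f g. f \<subseteq> {..<d} \<Longrightarrow> g \<subseteq> {..<d}
      \<Longrightarrow> 2 ^ k * of_bool (compatible d x f g) = (2 ^ l * of_bool (compatible d y f g) :: nat)"
  shows "x = y" "k = l"
proof -
  show "k = l"
    using eq[of "{..<d}" "{..<d}"] compat_full[OF x] compat_full[OF y] by simp
  show "x = y"
  proof (rule compat_determines[OF x y])
    fix f g assume "f \<subseteq> {..<d}" "g \<subseteq> {..<d}" "compatible d x f g"
    then show "compatible d y f g" using eq[of f g] by (cases "compatible d y f g") auto
  qed
qed

text \<open>Both bracketings evaluate the same double sum over the two middle labellings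
  \<open>g\<close> and \<open>k\<close>. Comparing the results yields the composite diagram and the
  total number of loops at once, and the latter makes the powers of any parameter agree.\<close>

lemma compose_assoc_loops:
  assumes a: "a \<in> brauer_diagrams d" and b: "b \<in> brauer_diagrams d" and c: "c \<in> brauer_diagrams d"
  shows "compose d (compose d a b) c = compose d a (compose d b c)"
    and "loops d a b + loops d (compose d a b) c = loops d b c + loops d a (compose d b c)"
proof -
  have ab: "compose d a b \<in> brauer_diagrams d" and bc: "compose d b c \<in> brauer_diagrams d"
    using a b c compose_brauer_diagrams by blast+
  have "(2::nat) ^ (loops d a b + loops d (compose d a b) c)
        * of_bool (compatible d (compose d (compose d a b) c) f h)
      = 2 ^ (loops d b c + loops d a (compose d b c))
        * of_bool (compatible d (compose d a (compose d b c)) f h)"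
    if f: "f \<subseteq> {..<d}" and h: "h \<subseteq> {..<d}" for f h
  proof -
    let ?X = "Pow {..<d}"
    define A where "A f g = (of_bool (compatible d a f g) :: nat)" for f g
    define B where "B f g = (of_bool (compatible d b f g) :: nat)" for f g
    define C where "C f g = (of_bool (compatible d c f g) :: nat)" for f g
    have AB: "(\<Sum>g\<in>?X. A f g * B g k) = 2 ^ loops d a b * of_bool (compatible d (compose d a b) f k)"
      if "k \<in> ?X" for k
      unfolding A_def B_def using stack.sum_compat[OF stack.intro[OF a b] f, of k] that by simp
    have BC: "(\<Sum>k\<in>?X. B g k * C k h) = 2 ^ loops d b c * of_bool (compatible d (compose d b c) g h)"
      if "g \<in> ?X" for g
      unfolding B_def C_def using stack.sum_compat[OF stack.intro[OF b c] _ h, of g] that by simp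
    have "(2::nat) ^ (loops d a b + loops d (compose d a b) c)
        * of_bool (compatible d (compose d (compose d a b) c) f h)
      = 2 ^ loops d a b * (\<Sum>k\<in>?X. of_bool (compatible d (compose d a b) f k) * C k h)"
      using stack.sum_compat[OF stack.intro[OF ab c] f h] by (simp add: C_def power_add)
    also have "\<dots> = (\<Sum>k\<in>?X. (\<Sum>g\<in>?X. A f g * B g k) * C k h)"
      by (simp add: AB sum_distrib_left mult.assoc del: sum_mult_of_bool_eq sum_of_bool_mult_eq)
    also have "\<dots> = (\<Sum>k\<in>?X. \<Sum>g\<in>?X. A f g * (B g k * C k h))"
      by (simp add: sum_distrib_right mult.assoc)
    also have "\<dots> = (\<Sum>g\<in>?X. A f g * (\<Sum>k\<in>?X. B g k * C k h))"
      by (subst sum.swap) (simp add: sum_distrib_left)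
    also have "\<dots> = 2 ^ loops d b c * (\<Sum>g\<in>?X. A f g * of_bool (compatible d (compose d b c) g h))"
      by (simp add: BC sum_distrib_left mult_ac del: sum_mult_of_bool_eq sum_of_bool_mult_eq)
    also have "\<dots> = 2 ^ (loops d b c + loops d a (compose d b c))
        * of_bool (compatible d (compose d a (compose d b c)) f h)"
      using stack.sum_compat[OF stack.intro[OF a bc] f h] by (simp add: A_def power_add)
    finally show ?thesis .
  qed
  note * = scaled_compat_determines[OF compose_brauer_diagrams[OF ab c]
      compose_brauer_diagrams[OF a bc] this]
  show "compose d (compose d a b) c = compose d a (compose d b c)" by (rule *(1))
  show "loops d a b + loops d (compose d a b) c = loops d b c + loops d a (compose d b c)"
    by (rule *(2))
qed

lemma compat_id:
  assumes "f \<subseteq> {..<d}" "g \<subseteq> {..<d}"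
  shows "compatible d (id_diagram d) f g \<longleftrightarrow> f = g"
  using assms by (auto simp: compatible_def lab_def id_diagram_def pts_def)

text \<open>The identity diagram has the unit matrix, so the sum over middle labellings keeps a
  single term; \<open>scaled_compat_determines\<close> then gives both the unit law and the absence
  of loops.\<close>

lemma compose_id:
  assumes a: "a \<in> brauer_diagrams d"
  shows "compose d (id_diagram d) a = a" "loops d (id_diagram d) a = 0"
    "compose d a (id_diagram d) = a" "loops d a (id_diagram d) = 0"
proof -
  have "2 ^ loops d (id_diagram d) a * of_bool (compatible d (compose d (id_diagram d) a) f h)
      = (2 ^ 0 * of_bool (compatible d a f h) :: nat)"
    if "f \<subseteq> {..<d}" "h \<subseteq> {..<d}" for f h
  proof -
    have "(\<Sum>g\<in>Pow {..<d}. of_bool (compatible d (id_diagram d) f g) * of_bool (compatible d a g h))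
      = (\<Sum>g\<in>Pow {..<d}. if g = f then of_bool (compatible d a f h) else (0::nat))"
      by (rule sum.cong) (use that in \<open>auto simp: compat_id\<close>)
    then show ?thesis
      using stack.sum_compat[OF stack.intro[OF id_diagram_brauer a] that] that by simp
  qed
  note * = scaled_compat_determines[OF compose_brauer_diagrams[OF id_diagram_brauer a] a this]
  show "compose d (id_diagram d) a = a" by (rule *(1))
  show "loops d (id_diagram d) a = 0" by (rule *(2))
  have "2 ^ loops d a (id_diagram d) * of_bool (compatible d (compose d a (id_diagram d)) f h)
      = (2 ^ 0 * of_bool (compatible d a f h) :: nat)"
    if "f \<subseteq> {..<d}" "h \<subseteq> {..<d}" for f h
  proof -
    have "(\<Sum>g\<in>Pow {..<d}. of_bool (compatible d a f g) * of_bool (compatible d (id_diagram d) g h))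
      = (\<Sum>g\<in>Pow {..<d}. if g = h then of_bool (compatible d a f h) else (0::nat))"
      by (rule sum.cong) (use that in \<open>auto simp: compat_id\<close>)
    then show ?thesis
      using stack.sum_compat[OF stack.intro[OF a id_diagram_brauer] that] that by simp
  qed
  note * = scaled_compat_determines[OF compose_brauer_diagrams[OF a id_diagram_brauer] a this]
  show "compose d a (id_diagram d) = a" by (rule *(1))
  show "loops d a (id_diagram d) = 0" by (rule *(2))
qed

section \<open>Closure of walled diagrams under concatenation\<close>

text \<open>Orient strands downwards left of the wall and upwards right of it: the sign is \<open>1\<close> at sources and
  \<open>-1\<close> at targets.\<close>

definition wall_sign :: "nat \<Rightarrow> bool \<times> nat \<Rightarrow> int" where
  "wall_sign r p = (if fst p = (snd p < r) then 1 else - 1)"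

text \<open>With strands oriented, each one joins a source to a target. This single condition covers
  both arcs crossing the wall and vertical strands keeping their side.\<close>

lemma walled_iff_wall_sign:
  "m \<in> walled_brauer_diagrams r s \<longleftrightarrow>
    m \<in> brauer_diagrams (r + s) \<and> (\<forall>p\<in>pts (r + s). wall_sign r (m p) = - wall_sign r p)"
proof -
  have "(if fst (m p) = fst p then (snd (m p) < r) \<noteq> (snd p < r)
        else (snd (m p) < r) = (snd p < r)) \<longleftrightarrow> wall_sign r (m p) = - wall_sign r p" for p
    by (auto simp: wall_sign_def)
  then show ?thesis by (simp add: walled_brauer_diagrams_def)
qed

lemma compose_walled:
  assumes a: "a \<in> walled_brauer_diagrams r s" and b: "b \<in> walled_brauer_diagrams r s"
  shows "compose (r + s) a b \<in> walled_brauer_diagrams r s"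
proof -
  let ?d = "r + s"
  have wa: "wall_sign r (a p) = - wall_sign r p" and wb: "wall_sign r (b p) = - wall_sign r p"
    if "p \<in> pts ?d" for p
    using a b that unfolding walled_iff_wall_sign by blast+
  interpret stack ?d a b
    using a b unfolding walled_iff_wall_sign by (blast intro: stack.intro)
  \<comment> \<open>The middle row is the bottom of \<open>a\<close> and the top of
    \<open>b\<close>, where \<open>wall_sign\<close> takes opposite values. Negating the signs of
    \<open>a\<close> makes \<open>e\<close> well defined on the stack; the negation in the top row
    accounts for the case distinction in \<open>flip_compose\<close>.\<close>
  define e where "e v = (if (snd v < r) = (fst v = (1::nat)) then 1 else - 1 :: int)" for v :: "nat \<times> nat"
  have ea: "e (lvl_a p) = - wall_sign r p" and eb: "e (lvl_b p) = wall_sign r p" for p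
    by (auto simp: e_def wall_sign_def lvl_a_def lvl_b_def)
  have eo: "e (lvl_out p) = (if fst p then - wall_sign r p else wall_sign r p)" for p
    by (auto simp: e_def wall_sign_def lvl_out_def)
  have e\<alpha>: "e (\<alpha> v) = - e v" if v: "v \<in> verts ?d" "fst v \<noteq> 2" for v
  proof -
    have "fst v \<le> 1" "snd v < ?d" using v by (auto simp: verts_def)
    then obtain p where p: "p \<in> pts ?d" "v = lvl_a p" using upper_lvl_a by blast
    then show ?thesis using wa ea by (simp add: \<alpha>_lvl_a)
  qed
  have e\<beta>: "e (\<beta> v) = - e v" if v: "v \<in> verts ?d" "fst v \<noteq> 0" for v
  proof -
    have "fst v \<in> {1, 2}" "snd v < ?d" using v by (auto simp: verts_def)
    then obtain p where p: "p \<in> pts ?d" "v = lvl_b p" using lower_lvl_b by blast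
    then show ?thesis using wb eb by (simp add: \<beta>_lvl_b)
  qed
  show ?thesis
    unfolding walled_iff_wall_sign
  proof (intro conjI ballI compose_brauer)
    fix p assume p: "p \<in> pts ?d"
    show "wall_sign r (compose ?d a b p) = - wall_sign r p"
      using flip_compose[of e, OF e\<alpha> e\<beta> p] by (auto simp: eo split: if_splits)
  qed
qed

lemma id_diagram_walled: "id_diagram (r + s) \<in> walled_brauer_diagrams r s"
  by (auto simp: walled_iff_wall_sign id_diagram_brauer) (auto simp: wall_sign_def id_diagram_def pts_def)

section \<open>Integral trace forms\<close>

text \<open>The matrix \<open>G\<close> either has nonzero determinant \<open>N\<close>, with the
  adjugate as \<open>H\<close>, or it has a kernel vector. The adjugate replaces the inverse so that
  all data stay integral and can be mapped into any field; the coordinate \<open>c\<close> later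
  certifies that the kernel vector remains nonzero there.\<close>

lemma int_matrix_dichotomy:
  fixes G :: "'b \<Rightarrow> 'b \<Rightarrow> int"
  assumes "finite D"
  obtains (invertible) H N where "N \<noteq> 0"
      "\<And>a b. a \<in> D \<Longrightarrow> b \<in> D \<Longrightarrow> (\<Sum>c\<in>D. G a c * H c b) = N * of_bool (a = b)"
      "\<And>a b. a \<in> D \<Longrightarrow> b \<in> D \<Longrightarrow> (\<Sum>c\<in>D. H a c * G c b) = N * of_bool (a = b)"
  | (singular) v c where "c \<in> D" "v c \<noteq> 0" "\<And>a. a \<in> D \<Longrightarrow> (\<Sum>b\<in>D. G a b * v b) = 0"
proof -
  define n where "n = card D"
  obtain e where e: "bij_betw e {0..<n} D"
    using ex_bij_betw_nat_finite[OF assms] n_def by blast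
  define ix where "ix = inv_into {0..<n} e"
  have ix: "ix x < n" "e (ix x) = x" if "x \<in> D" for x
    using that e bij_betwE[OF bij_betw_inv_into[OF e]] bij_betw_inv_into_right[OF e]
    by (auto simp: ix_def)
  have ix_e: "ix (e i) = i" if "i < n" for i
    using bij_betw_inv_into_left[OF e] that by (simp add: ix_def)
  have eD: "e i \<in> D" if "i < n" for i using bij_betwE[OF e] that by simp
  have sum_e: "(\<Sum>c\<in>D. F c) = (\<Sum>i = 0..<n. F (e i))" for F :: "'b \<Rightarrow> int"
    by (rule sum.reindex_bij_betw[OF e, symmetric])
  have ix_eq: "ix a = ix b \<longleftrightarrow> a = b" if "a \<in> D" "b \<in> D" for a b
    using ix that by metis
  define M where "M = mat n n (\<lambda>(i, j). G (e i) (e j))"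
  have M: "M \<in> carrier_mat n n" by (simp add: M_def)
  show thesis
  proof (cases "det M = 0")
    case False
    note adj = adj_mat[OF M]
    define H where "H a b = adj_mat M $$ (ix a, ix b)" for a b
    have "(\<Sum>c\<in>D. G a c * H c b) = det M * of_bool (a = b)" if ab: "a \<in> D" "b \<in> D" for a b
    proof -
      have "(M * adj_mat M) $$ (ix a, ix b) = (\<Sum>i = 0..<n. G a (e i) * adj_mat M $$ (i, ix b))"
        using adj(1) ix[OF ab(1)] ix[OF ab(2)] M by (simp add: scalar_prod_def M_def)
      also have "\<dots> = (\<Sum>c\<in>D. G a c * H c b)"
        unfolding sum_e by (rule sum.cong) (auto simp: H_def ix_e)
      finally show ?thesis
        unfolding adj(2) using ix[OF ab(1)] ix[OF ab(2)] ix_eq[OF ab] by (auto simp: of_bool_def)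
    qed
    moreover have "(\<Sum>c\<in>D. H a c * G c b) = det M * of_bool (a = b)" if ab: "a \<in> D" "b \<in> D" for a b
    proof -
      have "(adj_mat M * M) $$ (ix a, ix b) = (\<Sum>i = 0..<n. adj_mat M $$ (ix a, i) * G (e i) b)"
        using adj(1) ix[OF ab(1)] ix[OF ab(2)] M by (simp add: scalar_prod_def M_def)
      also have "\<dots> = (\<Sum>c\<in>D. H a c * G c b)"
        unfolding sum_e by (rule sum.cong) (auto simp: H_def ix_e)
      finally show ?thesis
        unfolding adj(3) using ix[OF ab(1)] ix[OF ab(2)] ix_eq[OF ab] by (auto simp: of_bool_def)
    qed
    ultimately show ?thesis using invertible[OF False] by blast
  next
    case True
    then obtain v where v: "v \<in> carrier_vec n" "v \<noteq> 0\<^sub>v n" "M *\<^sub>v v = 0\<^sub>v n"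
      using det_0_iff_vec_prod_zero[OF M] by blast
    obtain i where i: "i < n" "v $ i \<noteq> 0" using v(1,2) by (metis carrier_vecD eq_vecI index_zero_vec)
    have "(\<Sum>b\<in>D. G a b * v $ ix b) = 0" if a: "a \<in> D" for a
    proof -
      have "(M *\<^sub>v v) $ ix a = (\<Sum>j = 0..<n. G a (e j) * v $ j)"
        using v(1) ix[OF a] M by (simp add: scalar_prod_def M_def)
      also have "\<dots> = (\<Sum>b\<in>D. G a b * v $ ix b)"
        unfolding sum_e by (rule sum.cong) (auto simp: ix_e)
      finally show ?thesis unfolding v(3) using ix[OF a] by simp
    qed
    then show ?thesis using singular[of "e i" "\<lambda>b. v $ ix b"] i eD ix_e by simp
  qed
qed

text \<open>\<open>s a b c\<close> is the coefficient of the basis element \<open>c\<close> in the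
  product of \<open>a\<close> and \<open>b\<close>, and the basis element \<open>u\<close> is the
  unit.\<close>

locale structure_constants =
  fixes D :: "'b set" and s :: "'b \<Rightarrow> 'b \<Rightarrow> 'b \<Rightarrow> int" and u :: 'b
  assumes finite_D: "finite D" and u_in: "u \<in> D"
    and s_assoc: "\<lbrakk>a \<in> D; b \<in> D; c \<in> D; z \<in> D\<rbrakk>
      \<Longrightarrow> (\<Sum>x\<in>D. s a b x * s x c z) = (\<Sum>x\<in>D. s b c x * s a x z)"
    and s_unit_left: "\<lbrakk>a \<in> D; b \<in> D\<rbrakk> \<Longrightarrow> s u a b = of_bool (a = b)"
    and s_unit_right: "\<lbrakk>a \<in> D; b \<in> D\<rbrakk> \<Longrightarrow> s a u b = of_bool (a = b)"
begin

text \<open>The trace of left multiplication by \<open>a\<close> on the algebra itself.\<close>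

definition reg_trace :: "'b \<Rightarrow> int" where
  "reg_trace a = (\<Sum>b\<in>D. s a b b)"

definition trace_form :: "'b \<Rightarrow> 'b \<Rightarrow> int" where
  "trace_form a b = (\<Sum>c\<in>D. s a b c * reg_trace c)"

lemma sum_of_bool_left: "a \<in> D \<Longrightarrow> (\<Sum>x\<in>D. of_bool (a = x) * F x) = (F a :: int)"
  using finite_D by (simp add: sum.delta' of_bool_def if_distrib[of "\<lambda>t. t * _"] cong: if_cong)

lemma sum_of_bool_right: "a \<in> D \<Longrightarrow> (\<Sum>x\<in>D. F x * of_bool (x = a)) = (F a :: int)"
  using finite_D by (simp add: sum.delta of_bool_def if_distrib[of "\<lambda>t. _ * t"] cong: if_cong)

lemma trace_form_unit: "a \<in> D \<Longrightarrow> trace_form a u = reg_trace a"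
  by (simp add: trace_form_def s_unit_right sum_of_bool_left)

text \<open>Both sides are the linear extension of \<open>reg_trace\<close> evaluated at the triple
  product of \<open>a\<close>, \<open>b\<close>, \<open>c\<close>, bracketed in two ways.\<close>

lemma trace_form_assoc:
  assumes "a \<in> D" "b \<in> D" "c \<in> D"
  shows "(\<Sum>x\<in>D. s a b x * trace_form x c) = (\<Sum>x\<in>D. s b c x * trace_form a x)"
proof -
  have "(\<Sum>x\<in>D. s a b x * trace_form x c) = (\<Sum>z\<in>D. (\<Sum>x\<in>D. s a b x * s x c z) * reg_trace z)"
    unfolding trace_form_def sum_distrib_left sum_distrib_right
    by (subst sum.swap) (simp add: mult.assoc)
  also have "\<dots> = (\<Sum>z\<in>D. (\<Sum>x\<in>D. s b c x * s a x z) * reg_trace z)"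
    using assms by (simp add: s_assoc)
  also have "\<dots> = (\<Sum>x\<in>D. s b c x * trace_form a x)"
    unfolding trace_form_def sum_distrib_left sum_distrib_right
    by (subst sum.swap) (simp add: mult.assoc)
  finally show ?thesis .
qed

text \<open>Left multiplication by a product is the composite of the left multiplications, so the
  form is the trace of a product of two matrices. Symmetry of the form is then the cyclicity of the
  trace.\<close>

lemma trace_form_eq:
  assumes "a \<in> D" "b \<in> D"
  shows "trace_form a b = (\<Sum>y\<in>D. \<Sum>x\<in>D. s b y x * s a x y)"
proof -
  have "trace_form a b = (\<Sum>y\<in>D. \<Sum>c\<in>D. s a b c * s c y y)"
    unfolding trace_form_def reg_trace_def sum_distrib_left by (rule sum.swap)
  also have "\<dots> = (\<Sum>y\<in>D. \<Sum>x\<in>D. s b y x * s a x y)"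
    using assms by (simp add: s_assoc)
  finally show ?thesis .
qed

lemma trace_form_sym:
  assumes "a \<in> D" "b \<in> D"
  shows "trace_form a b = trace_form b a"
  unfolding trace_form_eq[OF assms] trace_form_eq[OF assms(2,1)]
  by (subst sum.swap) (simp add: mult.commute)

text \<open>\<open>H\<close> is \<open>N\<close> times the inverse Gram matrix: the combination of
  the \<open>a\<close> with coefficients \<open>H a c\<close> is dual, up to the factor
  \<open>N\<close>, to the basis element \<open>c\<close>. The sum of \<open>H a c\<close> times the
  tensor of \<open>a\<close> and \<open>c\<close> is thus \<open>N\<close> times the Casimir
  element. Keeping \<open>N\<close> as a factor leaves identities between integers.\<close>

context
  fixes H :: "'b \<Rightarrow> 'b \<Rightarrow> int" and N :: int
  assumes N: "N \<noteq> 0"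
    and GH: "\<And>a b. a \<in> D \<Longrightarrow> b \<in> D \<Longrightarrow> (\<Sum>c\<in>D. trace_form a c * H c b) = N * of_bool (a = b)"
    and HG: "\<And>a b. a \<in> D \<Longrightarrow> b \<in> D \<Longrightarrow> (\<Sum>c\<in>D. H a c * trace_form c b) = N * of_bool (a = b)"
begin

text \<open>Multiplying the Casimir tensor by \<open>y\<close> on the left of its first factor or on
  the right of its second gives the same result; the identity compares the coefficients at
  \<open>z\<close> and \<open>w\<close>.\<close>

lemma casimir_invariant:
  assumes y: "y \<in> D" and z: "z \<in> D" and w: "w \<in> D"
  shows "(\<Sum>a\<in>D. s y a z * H a w) = (\<Sum>c\<in>D. H z c * s c y w)"
proof -
  \<comment> \<open>The trace form of \<open>t y\<close> against \<open>p\<close>, sandwiched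
    between two copies of \<open>H\<close>. Contracting the right copy gives one side times
    \<open>N\<close>; moving \<open>y\<close> over to \<open>p\<close> by associativity and
    contracting the left copy gives the other.\<close>
  let ?T = "\<Sum>t\<in>D. \<Sum>p\<in>D. H z t * (\<Sum>x\<in>D. s t y x * trace_form x p) * H p w"
  have "?T = (\<Sum>t\<in>D. \<Sum>p\<in>D. \<Sum>x\<in>D. H z t * s t y x * (trace_form x p * H p w))"
    by (simp add: sum_distrib_left sum_distrib_right mult_ac)
  also have "\<dots> = (\<Sum>t\<in>D. \<Sum>x\<in>D. H z t * s t y x * (\<Sum>p\<in>D. trace_form x p * H p w))"
    unfolding sum_distrib_left by (rule sum.cong[OF refl]) (rule sum.swap)
  also have "\<dots> = (\<Sum>t\<in>D. \<Sum>x\<in>D. (N * (H z t * s t y x)) * of_bool (x = w))"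
    by (intro sum.cong refl) (subst GH, auto simp: w)
  also have "\<dots> = N * (\<Sum>c\<in>D. H z c * s c y w)"
    by (simp only: sum_of_bool_right[OF w] sum_distrib_left)
  finally have 1: "?T = N * (\<Sum>c\<in>D. H z c * s c y w)" .
  have "?T = (\<Sum>t\<in>D. \<Sum>p\<in>D. H z t * (\<Sum>x\<in>D. s y p x * trace_form t x) * H p w)"
    using y by (simp add: trace_form_assoc)
  also have "\<dots> = (\<Sum>t\<in>D. \<Sum>p\<in>D. \<Sum>x\<in>D. (H z t * trace_form t x) * (s y p x * H p w))"
    by (simp add: sum_distrib_left sum_distrib_right mult_ac)
  also have "\<dots> = (\<Sum>p\<in>D. \<Sum>t\<in>D. \<Sum>x\<in>D. (H z t * trace_form t x) * (s y p x * H p w))"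
    by (rule sum.swap)
  also have "\<dots> = (\<Sum>p\<in>D. \<Sum>x\<in>D. (\<Sum>t\<in>D. H z t * trace_form t x) * (s y p x * H p w))"
    unfolding sum_distrib_right by (rule sum.cong[OF refl]) (rule sum.swap)
  also have "\<dots> = (\<Sum>p\<in>D. \<Sum>x\<in>D. of_bool (z = x) * (N * (s y p x * H p w)))"
    using z by (simp add: HG mult_ac)
  also have "\<dots> = N * (\<Sum>a\<in>D. s y a z * H a w)"
    by (simp only: sum_of_bool_left[OF z] sum_distrib_left)
  finally show ?thesis using 1 N by simp
qed

lemma trace_form_nondegenerate:
  assumes "\<And>x. x \<in> D \<Longrightarrow> (\<Sum>z\<in>D. trace_form x z * f z) = 0" and w: "w \<in> D"
  shows "f w = 0"
proof -
  have "0 = (\<Sum>x\<in>D. H w x * (\<Sum>z\<in>D. trace_form x z * f z))"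
    using assms by simp
  also have "\<dots> = (\<Sum>z\<in>D. (\<Sum>x\<in>D. H w x * trace_form x z) * f z)"
    unfolding sum_distrib_left sum_distrib_right by (subst sum.swap) (simp add: mult.assoc)
  also have "\<dots> = (\<Sum>z\<in>D. of_bool (w = z) * (N * f z))"
    using w by (simp add: HG mult_ac)
  also have "\<dots> = N * f w" by (rule sum_of_bool_left[OF w])
  finally show ?thesis using N by simp
qed

text \<open>Pairing \<open>\<Sum>\<^sub>a\<^sub>,\<^sub>c H a c \<cdot> ac\<close> with \<open>x\<close> computes the trace of left multiplication by \<open>x\<close> in a
  pair of dual bases.\<close>

lemma casimir_product:
  assumes z: "z \<in> D"
  shows "(\<Sum>a\<in>D. \<Sum>c\<in>D. H a c * s a c z) = N * of_bool (z = u)"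
proof -
  \<comment> \<open>The trace form is nondegenerate, so it is enough that the difference of the two
    sides pairs to zero with every basis element.\<close>
  define f where "f z = (\<Sum>a\<in>D. \<Sum>c\<in>D. H a c * s a c z) - N * of_bool (z = u)" for z
  have "(\<Sum>z\<in>D. trace_form x z * f z) = 0" if x: "x \<in> D" for x
  proof -
    have "(\<Sum>z\<in>D. trace_form x z * (\<Sum>a\<in>D. \<Sum>c\<in>D. H a c * s a c z))
        = (\<Sum>a\<in>D. \<Sum>c\<in>D. H a c * (\<Sum>z\<in>D. s a c z * trace_form x z))"
    proof -
      have "(\<Sum>z\<in>D. trace_form x z * (\<Sum>a\<in>D. \<Sum>c\<in>D. H a c * s a c z))
          = (\<Sum>z\<in>D. \<Sum>a\<in>D. \<Sum>c\<in>D. H a c * (s a c z * trace_form x z))"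
        by (simp add: sum_distrib_left mult_ac)
      also have "\<dots> = (\<Sum>a\<in>D. \<Sum>z\<in>D. \<Sum>c\<in>D. H a c * (s a c z * trace_form x z))"
        by (rule sum.swap)
      also have "\<dots> = (\<Sum>a\<in>D. \<Sum>c\<in>D. H a c * (\<Sum>z\<in>D. s a c z * trace_form x z))"
        unfolding sum_distrib_left by (rule sum.cong[OF refl]) (rule sum.swap)
      finally show ?thesis .
    qed
    also have "\<dots> = (\<Sum>a\<in>D. \<Sum>c\<in>D. H a c * (\<Sum>z\<in>D. s x a z * trace_form z c))"
      using x by (simp add: trace_form_assoc)
    also have "\<dots> = (\<Sum>a\<in>D. \<Sum>c\<in>D. \<Sum>z\<in>D. s x a z * (H a c * trace_form c z))"
      by (simp add: sum_distrib_left mult_ac trace_form_sym)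
    also have "\<dots> = (\<Sum>a\<in>D. \<Sum>z\<in>D. s x a z * (\<Sum>c\<in>D. H a c * trace_form c z))"
      unfolding sum_distrib_left by (rule sum.cong[OF refl]) (rule sum.swap)
    also have "\<dots> = (\<Sum>a\<in>D. \<Sum>z\<in>D. of_bool (a = z) * (N * s x a z))"
      by (simp add: HG mult_ac)
    also have "\<dots> = N * reg_trace x"
      unfolding reg_trace_def sum_distrib_left by (rule sum.cong[OF refl]) (rule sum_of_bool_left)
    finally have "(\<Sum>z\<in>D. trace_form x z * (\<Sum>a\<in>D. \<Sum>c\<in>D. H a c * s a c z)) = N * reg_trace x" .
    moreover have "(\<Sum>z\<in>D. (trace_form x z * N) * of_bool (z = u)) = N * reg_trace x"
      unfolding sum_of_bool_right[OF u_in] trace_form_unit[OF x] by (rule mult.commute)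
    ultimately show ?thesis
      by (simp add: f_def right_diff_distrib sum_subtractf mult.assoc)
  qed
  then have "f z = 0" using z by (rule trace_form_nondegenerate)
  then show ?thesis by (simp add: f_def)
qed

end

end

section \<open>Semisimplicity and the trace form\<close>

lemma (in ring) left_idealI:
  assumes "I \<subseteq> carrier R" "\<zero> \<in> I" "\<And>x y. x \<in> I \<Longrightarrow> y \<in> I \<Longrightarrow> x \<oplus> y \<in> I"
    and "\<And>a x. a \<in> carrier R \<Longrightarrow> x \<in> I \<Longrightarrow> a \<otimes> x \<in> I"
  shows "left_ideal I R"
proof -
  have "\<ominus> x \<in> I" if "x \<in> I" for x
  proof -
    have "\<ominus> x = (\<ominus> \<one>) \<otimes> x" using that assms(1) by (auto simp: l_minus)
    then show ?thesis using assms(4)[of "\<ominus> \<one>" x] that by simp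
  qed
  then show ?thesis using assms by (auto simp: left_ideal_def)
qed

text \<open>The complement of \<open>I\<close> is the left annihilator of its right unit
  \<open>e\<close>, and \<open>x\<close> splits into \<open>x e\<close> and
  \<open>x - x e\<close>.\<close>

lemma (in ring) left_ideal_right_unit_imp_semisimple:
  assumes "\<And>I. left_ideal I R \<Longrightarrow> \<exists>e\<in>I. \<forall>y\<in>I. y \<otimes> e = y"
  shows "semisimple R"
  unfolding semisimple_def
proof (intro allI impI)
  fix I assume I: "left_ideal I R"
  then obtain e where e: "e \<in> I" "\<And>y. y \<in> I \<Longrightarrow> y \<otimes> e = y" using assms by blast
  have IR: "I \<subseteq> carrier R" using I by (simp add: left_ideal_def)
  then have eR: "e \<in> carrier R" using e by blast
  define J where "J = {x \<in> carrier R. x \<otimes> e = \<zero>}"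
  have "left_ideal J R"
    by (rule left_idealI) (use eR in \<open>auto simp: J_def l_distr m_assoc\<close>)
  moreover have "I \<inter> J = {\<zero>}"
    using e I eR by (auto simp: J_def left_ideal_def)
  moreover have "\<exists>i\<in>I. \<exists>j\<in>J. x = i \<oplus> j" if x: "x \<in> carrier R" for x
  proof (intro bexI)
    show "x = x \<otimes> e \<oplus> (x \<ominus> x \<otimes> e)"
      using x eR by (simp add: minus_eq a_lcomm r_neg)
    show "x \<otimes> e \<in> I" using I x e by (simp add: left_ideal_def)
    show "x \<ominus> x \<otimes> e \<in> J"
      using x eR e by (simp add: J_def minus_eq l_distr l_minus m_assoc r_neg)
  qed
  ultimately show "\<exists>J. left_ideal J R \<and> I \<inter> J = {\<zero>} \<and> (\<forall>x\<in>carrier R. \<exists>i\<in>I. \<exists>j\<in>J. x = i \<oplus> j)"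
    by blast
qed

text \<open>The right unit is the component \<open>e\<close> of 1 in \<open>I\<close>. For
  \<open>y\<close> in \<open>I\<close> the remainder \<open>y f = y - y e\<close> lies both in
  \<open>I\<close> and in the complement, hence is zero.\<close>

lemma (in ring) semisimple_imp_left_ideal_right_unit:
  assumes "semisimple R" "left_ideal I R"
  shows "\<exists>e\<in>I. \<forall>y\<in>I. y \<otimes> e = y"
proof -
  obtain J where J: "left_ideal J R" "I \<inter> J = {\<zero>}" "\<forall>x\<in>carrier R. \<exists>i\<in>I. \<exists>j\<in>J. x = i \<oplus> j"
    using assms(1)[unfolded semisimple_def, rule_format, OF assms(2)] by (elim exE conjE)
  obtain e f where ef: "e \<in> I" "f \<in> J" "\<one> = e \<oplus> f" using J(3) one_closed by blast
  have sub: "I \<subseteq> carrier R" "J \<subseteq> carrier R" using assms(2) J(1) by (auto simp: left_ideal_def)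
  have eR: "e \<in> carrier R" "f \<in> carrier R" using ef sub by auto
  have "y \<otimes> e = y" if y: "y \<in> I" for y
  proof -
    have yR: "y \<in> carrier R" using y sub by blast
    have y_eq: "y = y \<otimes> e \<oplus> y \<otimes> f" using ef yR eR by (metis r_distr r_one)
    have "y \<otimes> e \<in> I" "y \<otimes> f \<in> J" using ef assms(2) J(1) yR by (auto simp: left_ideal_def)
    moreover have "y \<otimes> f = \<ominus> (y \<otimes> e) \<oplus> y"
      using y_eq yR eR by (metis m_closed r_neg1)
    ultimately have "y \<otimes> f \<in> I" using assms(2) y by (auto simp: left_ideal_def)
    then have "y \<otimes> f = \<zero>" using \<open>y \<otimes> f \<in> J\<close> J(2) by blast
    then show ?thesis using y_eq yR eR by simp
  qed
  then show ?thesis using ef by blast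
qed

section \<open>Finite sums in abelian monoids and rings, and the image of the integers\<close>

context abelian_monoid
begin

lemma finsum_closedI: "(\<And>i. i \<in> B \<Longrightarrow> f i \<in> carrier G) \<Longrightarrow> finsum G f B \<in> carrier G"
  by (rule finsum_closed) auto

lemma finsum_congI:
  "(\<And>i. i \<in> B \<Longrightarrow> g i \<in> carrier G) \<Longrightarrow> (\<And>i. i \<in> B \<Longrightarrow> f i = g i) \<Longrightarrow> finsum G f B = finsum G g B"
  by (rule finsum_cong') auto

lemma finsum_eq_zeroI: "(\<And>i. i \<in> B \<Longrightarrow> f i = \<zero>) \<Longrightarrow> finsum G f B = \<zero>"
  by (rule add.finprod_one_eqI)

lemma finsum_addI:
  "(\<And>i. i \<in> B \<Longrightarrow> f i \<in> carrier G) \<Longrightarrow> (\<And>i. i \<in> B \<Longrightarrow> g i \<in> carrier G)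
    \<Longrightarrow> finsum G (\<lambda>i. f i \<oplus> g i) B = finsum G f B \<oplus> finsum G g B"
  by (rule finsum_addf) auto

lemma finsum_insertI:
  "finite B \<Longrightarrow> x \<notin> B \<Longrightarrow> (\<And>i. i \<in> insert x B \<Longrightarrow> f i \<in> carrier G)
    \<Longrightarrow> finsum G f (insert x B) = f x \<oplus> finsum G f B"
  by (rule finsum_insert) auto

lemma finsum_only:
  assumes "finite B" "x \<in> B" "f x \<in> carrier G" "\<And>i. i \<in> B \<Longrightarrow> i \<noteq> x \<Longrightarrow> f i = \<zero>"
  shows "finsum G f B = f x"
proof -
  have "finsum G f B = finsum G f (insert x (B - {x}))" using assms(2) by (simp add: insert_absorb)
  also have "\<dots> = f x \<oplus> finsum G f (B - {x})"
    using assms by (intro finsum_insertI) (auto, metis zero_closed)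
  also have "finsum G f (B - {x}) = \<zero>" using assms by (intro finsum_eq_zeroI) auto
  finally show ?thesis using assms by simp
qed

lemma finsum_swap:
  assumes "finite B" "finite Y" "\<And>i j. i \<in> B \<Longrightarrow> j \<in> Y \<Longrightarrow> f i j \<in> carrier G"
  shows "finsum G (\<lambda>i. finsum G (f i) Y) B = finsum G (\<lambda>j. finsum G (\<lambda>i. f i j) B) Y"
  using assms(1,3)
proof (induction B rule: finite_induct)
  case empty
  then show ?case by (simp add: finsum_eq_zeroI)
next
  case (insert x B)
  have "finsum G (\<lambda>i. finsum G (f i) Y) (insert x B)
      = finsum G (f x) Y \<oplus> finsum G (\<lambda>j. finsum G (\<lambda>i. f i j) B) Y"
    using insert by (subst finsum_insertI) (auto intro: finsum_closedI)
  also have "\<dots> = finsum G (\<lambda>j. f x j \<oplus> finsum G (\<lambda>i. f i j) B) Y"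
    using insert by (intro finsum_addI[symmetric] finsum_closedI) auto
  also have "\<dots> = finsum G (\<lambda>j. finsum G (\<lambda>i. f i j) (insert x B)) Y"
    using insert by (intro finsum_congI finsum_insertI[symmetric] finsum_closedI) auto
  finally show ?case .
qed

end

context ring
begin

lemma finsum_ldistrI:
  "finite B \<Longrightarrow> a \<in> carrier R \<Longrightarrow> (\<And>i. i \<in> B \<Longrightarrow> f i \<in> carrier R)
    \<Longrightarrow> finsum R f B \<otimes> a = finsum R (\<lambda>i. f i \<otimes> a) B"
  by (rule finsum_ldistr) auto

lemma finsum_rdistrI:
  "finite B \<Longrightarrow> a \<in> carrier R \<Longrightarrow> (\<And>i. i \<in> B \<Longrightarrow> f i \<in> carrier R)
    \<Longrightarrow> a \<otimes> finsum R f B = finsum R (\<lambda>i. a \<otimes> f i) B"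
  by (rule finsum_rdistr) auto

text \<open>The canonical homomorphism from the integers, in the form in which
  \<open>diagram_alg\<close> inserts the parameter. Through it the integral identities become
  identities in the field.\<close>

abbreviation of_int_ring :: "int \<Rightarrow> 'a" ("\<iota>") where
  "\<iota> k \<equiv> add_pow R k \<one>"

lemma of_int_ring_closed: "\<iota> k \<in> carrier R"
  by simp

lemma of_int_ring_0: "\<iota> 0 = \<zero>"
  by (simp add: add_pow_int_ge)

lemma of_int_ring_1: "\<iota> 1 = \<one>"
  by (simp add: add_pow_int_ge)

lemma of_int_ring_of_nat: "\<iota> (int n) = add_pow R n \<one>"
  by (simp add: add_pow_int_ge)

lemma of_int_ring_add: "\<iota> (i + j) = \<iota> i \<oplus> \<iota> j"
  using add.int_pow_mult[of \<one> i j] by simp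

lemma of_int_ring_mult: "\<iota> (i * j) = \<iota> i \<otimes> \<iota> j"
proof -
  have "\<iota> i \<otimes> \<iota> j = add_pow R i (\<one> \<otimes> \<iota> j)"
    by (rule add_pow_ldistr_int) auto
  also have "\<dots> = \<iota> (i * j)"
    using add.int_pow_pow[of \<one> i j] by (metis l_one mult.commute of_int_ring_closed one_closed)
  finally show ?thesis ..
qed

lemma of_int_ring_power: "\<iota> (k ^ n) = \<iota> k [^] n"
proof (induction n)
  case 0
  show ?case unfolding power_0 of_int_ring_1 by simp
next
  case (Suc n)
  show ?case unfolding power_Suc2 of_int_ring_mult Suc by simp
qed

lemma of_int_ring_sum: "\<iota> (\<Sum>i\<in>B. f i) = finsum R (\<lambda>i. \<iota> (f i)) B"
proof (induction B rule: infinite_finite_induct)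
  case (insert x B)
  then show ?case by (simp add: of_int_ring_add finsum_insertI)
qed (auto simp: of_int_ring_0)

end

text \<open>An algebra over a field with basis \<open>D\<close> whose structure constants are the
  images of the integers \<open>s\<close>. Describing \<open>A\<close> by its operations, with the
  product prescribed on the carrier only, lets \<open>diagram_alg\<close> be used directly.\<close>

locale scalar_extension = structure_constants D s u + field R
  for D :: "'b set" and s :: "'b \<Rightarrow> 'b \<Rightarrow> 'b \<Rightarrow> int" and u :: 'b
    and R :: "('a, 'm) ring_scheme" (structure) +
  fixes A :: "('b \<Rightarrow> 'a, 'n) ring_scheme"
  assumes carrier_A: "carrier A = {f. (\<forall>x\<in>D. f x \<in> carrier R) \<and> (\<forall>x. x \<notin> D \<longrightarrow> f x = \<zero>)}"
    and mult_A: "\<lbrakk>f \<in> carrier A; g \<in> carrier A\<rbrakk> \<Longrightarrow> f \<otimes>\<^bsub>A\<^esub> g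
      = (\<lambda>c. if c \<in> D then \<Oplus>a\<in>D. \<Oplus>b\<in>D. (f a \<otimes> g b) \<otimes> \<iota> (s a b c) else \<zero>)"
    and one_A: "\<one>\<^bsub>A\<^esub> = (\<lambda>c. if c = u then \<one> else \<zero>)"
    and zero_A: "\<zero>\<^bsub>A\<^esub> = (\<lambda>c. \<zero>)"
    and add_A: "f \<oplus>\<^bsub>A\<^esub> g = (\<lambda>c. if c \<in> D then f c \<oplus> g c else \<zero>)"
begin

lemma coord_closed [simp]: "f \<in> carrier A \<Longrightarrow> f x \<in> carrier R"
  unfolding carrier_A by (cases "x \<in> D") auto

lemma vecI: "(\<And>x. x \<in> D \<Longrightarrow> f x \<in> carrier R) \<Longrightarrow> (\<And>x. x \<notin> D \<Longrightarrow> f x = \<zero>) \<Longrightarrow> f \<in> carrier A"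
  unfolding carrier_A by blast

lemma coord_outside: "f \<in> carrier A \<Longrightarrow> x \<notin> D \<Longrightarrow> f x = \<zero>"
  unfolding carrier_A by blast

lemma vec_eqI:
  assumes "f \<in> carrier A" "g \<in> carrier A" "\<And>x. x \<in> D \<Longrightarrow> f x = g x"
  shows "f = g"
proof
  fix x
  show "f x = g x"
    using assms(3) coord_outside[OF assms(1)] coord_outside[OF assms(2)] by (cases "x \<in> D") metis+
qed

lemma mult_coord:
  "\<lbrakk>f \<in> carrier A; g \<in> carrier A; c \<in> D\<rbrakk>
    \<Longrightarrow> (f \<otimes>\<^bsub>A\<^esub> g) c = (\<Oplus>a\<in>D. \<Oplus>b\<in>D. (f a \<otimes> g b) \<otimes> \<iota> (s a b c))"
  by (simp add: mult_A)

lemma add_coord [simp]: "c \<in> D \<Longrightarrow> (f \<oplus>\<^bsub>A\<^esub> g) c = f c \<oplus> g c"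
  by (simp add: add_A)

lemma mult_closed: "f \<in> carrier A \<Longrightarrow> g \<in> carrier A \<Longrightarrow> f \<otimes>\<^bsub>A\<^esub> g \<in> carrier A"
  by (rule vecI) (auto simp: mult_A intro!: finsum_closedI)

lemma add_closed: "f \<in> carrier A \<Longrightarrow> g \<in> carrier A \<Longrightarrow> f \<oplus>\<^bsub>A\<^esub> g \<in> carrier A"
  by (rule vecI) (auto simp: add_A)

lemma zero_closed_A: "\<zero>\<^bsub>A\<^esub> \<in> carrier A"
  by (rule vecI) (auto simp: zero_A)

text \<open>The ring record of \<open>A\<close> has no scalar multiplication; multiplying by this
  multiple of the unit element takes its place.\<close>

definition scal :: "'a \<Rightarrow> 'b \<Rightarrow> 'a" where
  "scal r = (\<lambda>c. if c = u then r else \<zero>)"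

definition unitv :: "'b \<Rightarrow> 'b \<Rightarrow> 'a" where
  "unitv b = (\<lambda>c. if c = b then \<one> else \<zero>)"

lemma scal_closed: "r \<in> carrier R \<Longrightarrow> scal r \<in> carrier A"
  by (rule vecI) (use u_in in \<open>auto simp: scal_def\<close>)

lemma unitv_closed: "b \<in> D \<Longrightarrow> unitv b \<in> carrier A"
  by (rule vecI) (auto simp: unitv_def)

lemma one_eq_scal: "\<one>\<^bsub>A\<^esub> = scal \<one>"
  by (simp add: one_A scal_def)

lemma finsum_ldistr2:
  assumes "k \<in> carrier R" "\<And>a b. a \<in> D \<Longrightarrow> b \<in> D \<Longrightarrow> F a b \<in> carrier R"
  shows "(\<Oplus>a\<in>D. \<Oplus>b\<in>D. F a b) \<otimes> k = (\<Oplus>a\<in>D. \<Oplus>b\<in>D. F a b \<otimes> k)"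
proof -
  have "(\<Oplus>a\<in>D. \<Oplus>b\<in>D. F a b) \<otimes> k = (\<Oplus>a\<in>D. (\<Oplus>b\<in>D. F a b) \<otimes> k)"
    using assms finite_D by (intro finsum_ldistrI finsum_closedI) auto
  also have "\<dots> = (\<Oplus>a\<in>D. \<Oplus>b\<in>D. F a b \<otimes> k)"
    using assms finite_D by (intro finsum_congI finsum_ldistrI finsum_closedI) auto
  finally show ?thesis .
qed

lemma finsum_rotate3:
  assumes "\<And>a b c. a \<in> D \<Longrightarrow> b \<in> D \<Longrightarrow> c \<in> D \<Longrightarrow> F a b c \<in> carrier R"
  shows "(\<Oplus>x\<in>D. \<Oplus>a\<in>D. \<Oplus>b\<in>D. F x a b) = (\<Oplus>a\<in>D. \<Oplus>b\<in>D. \<Oplus>x\<in>D. F x a b)"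
proof -
  have "(\<Oplus>x\<in>D. \<Oplus>a\<in>D. \<Oplus>b\<in>D. F x a b) = (\<Oplus>a\<in>D. \<Oplus>x\<in>D. \<Oplus>b\<in>D. F x a b)"
    using assms finite_D by (intro finsum_swap finsum_closedI) auto
  also have "\<dots> = (\<Oplus>a\<in>D. \<Oplus>b\<in>D. \<Oplus>x\<in>D. F x a b)"
    using assms finite_D by (intro finsum_congI finsum_swap finsum_closedI) auto
  finally show ?thesis .
qed

text \<open>All structure constants are collected into one integer under \<iota>. The other
  bracketing is brought to the same shape, so that associativity reduces to \<open>s_assoc\<close>,
  term by term.\<close>

lemma mult_left_triple:
  assumes f: "f \<in> carrier A" and g: "g \<in> carrier A" and h: "h \<in> carrier A" and z: "z \<in> D"
  shows "((f \<otimes>\<^bsub>A\<^esub> g) \<otimes>\<^bsub>A\<^esub> h) z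
    = (\<Oplus>a\<in>D. \<Oplus>b\<in>D. \<Oplus>c\<in>D. (f a \<otimes> g b \<otimes> h c) \<otimes> \<iota> (\<Sum>x\<in>D. s a b x * s x c z))"
proof -
  have "((f \<otimes>\<^bsub>A\<^esub> g) \<otimes>\<^bsub>A\<^esub> h) z = (\<Oplus>x\<in>D. \<Oplus>c\<in>D. ((f \<otimes>\<^bsub>A\<^esub> g) x \<otimes> h c) \<otimes> \<iota> (s x c z))"
    using assms by (intro mult_coord mult_closed)
  also have "\<dots> = (\<Oplus>x\<in>D. \<Oplus>c\<in>D. \<Oplus>a\<in>D. \<Oplus>b\<in>D. (f a \<otimes> g b \<otimes> h c) \<otimes> (\<iota> (s a b x) \<otimes> \<iota> (s x c z)))"
  proof (intro finsum_congI finsum_closedI)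
    fix x c assume xc: "x \<in> D" "c \<in> D"
    have "((f \<otimes>\<^bsub>A\<^esub> g) x \<otimes> h c) \<otimes> \<iota> (s x c z) = (f \<otimes>\<^bsub>A\<^esub> g) x \<otimes> (h c \<otimes> \<iota> (s x c z))"
      using assms by (simp add: m_assoc mult_closed)
    also have "\<dots> = (\<Oplus>a\<in>D. \<Oplus>b\<in>D. ((f a \<otimes> g b) \<otimes> \<iota> (s a b x)) \<otimes> (h c \<otimes> \<iota> (s x c z)))"
      unfolding mult_coord[OF f g xc(1)] using assms by (intro finsum_ldistr2) auto
    also have "\<dots> = (\<Oplus>a\<in>D. \<Oplus>b\<in>D. (f a \<otimes> g b \<otimes> h c) \<otimes> (\<iota> (s a b x) \<otimes> \<iota> (s x c z)))"
      using assms by (intro finsum_congI finsum_closedI) (auto simp: m_ac)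
    finally show "((f \<otimes>\<^bsub>A\<^esub> g) x \<otimes> h c) \<otimes> \<iota> (s x c z)
      = (\<Oplus>a\<in>D. \<Oplus>b\<in>D. (f a \<otimes> g b \<otimes> h c) \<otimes> (\<iota> (s a b x) \<otimes> \<iota> (s x c z)))" .
  qed (use assms in auto)
  also have "\<dots> = (\<Oplus>x\<in>D. \<Oplus>a\<in>D. \<Oplus>b\<in>D. \<Oplus>c\<in>D. (f a \<otimes> g b \<otimes> h c) \<otimes> (\<iota> (s a b x) \<otimes> \<iota> (s x c z)))"
    using assms by (intro finsum_congI finsum_rotate3 finsum_closedI) auto
  also have "\<dots> = (\<Oplus>a\<in>D. \<Oplus>b\<in>D. \<Oplus>x\<in>D. \<Oplus>c\<in>D. (f a \<otimes> g b \<otimes> h c) \<otimes> (\<iota> (s a b x) \<otimes> \<iota> (s x c z)))"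
    using assms by (intro finsum_rotate3 finsum_closedI) auto
  also have "\<dots> = (\<Oplus>a\<in>D. \<Oplus>b\<in>D. \<Oplus>c\<in>D. \<Oplus>x\<in>D. (f a \<otimes> g b \<otimes> h c) \<otimes> (\<iota> (s a b x) \<otimes> \<iota> (s x c z)))"
    using assms finite_D by (intro finsum_congI finsum_swap finsum_closedI) auto
  also have "\<dots> = (\<Oplus>a\<in>D. \<Oplus>b\<in>D. \<Oplus>c\<in>D. (f a \<otimes> g b \<otimes> h c) \<otimes> \<iota> (\<Sum>x\<in>D. s a b x * s x c z))"
    unfolding of_int_ring_sum of_int_ring_mult
    using assms finite_D by (intro finsum_congI finsum_rdistrI[symmetric] finsum_closedI m_closed) auto
  finally show ?thesis .
qed

lemma mult_right_triple:
  assumes f: "f \<in> carrier A" and g: "g \<in> carrier A" and h: "h \<in> carrier A" and z: "z \<in> D"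
  shows "(f \<otimes>\<^bsub>A\<^esub> (g \<otimes>\<^bsub>A\<^esub> h)) z
    = (\<Oplus>a\<in>D. \<Oplus>b\<in>D. \<Oplus>c\<in>D. (f a \<otimes> g b \<otimes> h c) \<otimes> \<iota> (\<Sum>x\<in>D. s b c x * s a x z))"
proof -
  have "(f \<otimes>\<^bsub>A\<^esub> (g \<otimes>\<^bsub>A\<^esub> h)) z = (\<Oplus>a\<in>D. \<Oplus>x\<in>D. (f a \<otimes> (g \<otimes>\<^bsub>A\<^esub> h) x) \<otimes> \<iota> (s a x z))"
    using assms by (intro mult_coord mult_closed)
  also have "\<dots> = (\<Oplus>a\<in>D. \<Oplus>x\<in>D. \<Oplus>b\<in>D. \<Oplus>c\<in>D. (f a \<otimes> g b \<otimes> h c) \<otimes> (\<iota> (s b c x) \<otimes> \<iota> (s a x z)))"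
  proof (intro finsum_congI finsum_closedI)
    fix a x assume ax: "a \<in> D" "x \<in> D"
    have "(f a \<otimes> (g \<otimes>\<^bsub>A\<^esub> h) x) \<otimes> \<iota> (s a x z) = (g \<otimes>\<^bsub>A\<^esub> h) x \<otimes> (f a \<otimes> \<iota> (s a x z))"
      using assms by (simp add: m_ac mult_closed)
    also have "\<dots> = (\<Oplus>b\<in>D. \<Oplus>c\<in>D. ((g b \<otimes> h c) \<otimes> \<iota> (s b c x)) \<otimes> (f a \<otimes> \<iota> (s a x z)))"
      unfolding mult_coord[OF g h ax(2)] using assms by (intro finsum_ldistr2) auto
    also have "\<dots> = (\<Oplus>b\<in>D. \<Oplus>c\<in>D. (f a \<otimes> g b \<otimes> h c) \<otimes> (\<iota> (s b c x) \<otimes> \<iota> (s a x z)))"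
      using assms by (intro finsum_congI finsum_closedI) (auto simp: m_ac)
    finally show "(f a \<otimes> (g \<otimes>\<^bsub>A\<^esub> h) x) \<otimes> \<iota> (s a x z)
      = (\<Oplus>b\<in>D. \<Oplus>c\<in>D. (f a \<otimes> g b \<otimes> h c) \<otimes> (\<iota> (s b c x) \<otimes> \<iota> (s a x z)))" .
  qed (use assms in auto)
  also have "\<dots> = (\<Oplus>a\<in>D. \<Oplus>b\<in>D. \<Oplus>c\<in>D. \<Oplus>x\<in>D. (f a \<otimes> g b \<otimes> h c) \<otimes> (\<iota> (s b c x) \<otimes> \<iota> (s a x z)))"
    using assms by (intro finsum_congI finsum_rotate3 finsum_closedI) auto
  also have "\<dots> = (\<Oplus>a\<in>D. \<Oplus>b\<in>D. \<Oplus>c\<in>D. (f a \<otimes> g b \<otimes> h c) \<otimes> \<iota> (\<Sum>x\<in>D. s b c x * s a x z))"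
    unfolding of_int_ring_sum of_int_ring_mult
    using assms finite_D by (intro finsum_congI finsum_rdistrI[symmetric] finsum_closedI m_closed) auto
  finally show ?thesis .
qed

lemma mult_assoc_coord:
  assumes "f \<in> carrier A" "g \<in> carrier A" "h \<in> carrier A" and z: "z \<in> D"
  shows "((f \<otimes>\<^bsub>A\<^esub> g) \<otimes>\<^bsub>A\<^esub> h) z = (f \<otimes>\<^bsub>A\<^esub> (g \<otimes>\<^bsub>A\<^esub> h)) z"
proof (subst mult_left_triple[OF assms], subst mult_right_triple[OF assms],
    intro finsum_congI finsum_closedI)
  fix a b c assume abc: "a \<in> D" "b \<in> D" "c \<in> D"
  show "(f a \<otimes> g b \<otimes> h c) \<otimes> \<iota> (\<Sum>x\<in>D. s a b x * s x c z)
      = (f a \<otimes> g b \<otimes> h c) \<otimes> \<iota> (\<Sum>x\<in>D. s b c x * s a x z)"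
    by (subst s_assoc[OF abc z]) (rule refl)
qed (use assms in auto)

lemma mult_assoc_A:
  assumes "f \<in> carrier A" "g \<in> carrier A" "h \<in> carrier A"
  shows "(f \<otimes>\<^bsub>A\<^esub> g) \<otimes>\<^bsub>A\<^esub> h = f \<otimes>\<^bsub>A\<^esub> (g \<otimes>\<^bsub>A\<^esub> h)"
proof (rule vec_eqI)
  show "(f \<otimes>\<^bsub>A\<^esub> g) \<otimes>\<^bsub>A\<^esub> h \<in> carrier A" "f \<otimes>\<^bsub>A\<^esub> (g \<otimes>\<^bsub>A\<^esub> h) \<in> carrier A"
    using assms by (simp_all add: mult_closed)
qed (rule mult_assoc_coord[OF assms])

lemma scal_mult_coord:
  assumes r: "r \<in> carrier R" and f: "f \<in> carrier A" and z: "z \<in> D"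
  shows "(scal r \<otimes>\<^bsub>A\<^esub> f) z = r \<otimes> f z"
proof -
  have "(scal r \<otimes>\<^bsub>A\<^esub> f) z = (\<Oplus>a\<in>D. \<Oplus>b\<in>D. (scal r a \<otimes> f b) \<otimes> \<iota> (s a b z))"
    using assms by (intro mult_coord scal_closed)
  also have "\<dots> = (\<Oplus>b\<in>D. (scal r u \<otimes> f b) \<otimes> \<iota> (s u b z))"
    using assms finite_D u_in
    by (intro finsum_only finsum_closedI finsum_eq_zeroI) (auto simp: scal_def)
  also have "\<dots> = (scal r u \<otimes> f z) \<otimes> \<iota> (s u z z)"
    using assms finite_D u_in
    by (intro finsum_only) (auto simp: scal_def s_unit_left of_int_ring_0)
  also have "\<dots> = r \<otimes> f z" using assms by (simp add: scal_def s_unit_left of_int_ring_1)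
  finally show ?thesis .
qed

lemma mult_scal_coord:
  assumes r: "r \<in> carrier R" and f: "f \<in> carrier A" and z: "z \<in> D"
  shows "(f \<otimes>\<^bsub>A\<^esub> scal r) z = f z \<otimes> r"
proof -
  have "(f \<otimes>\<^bsub>A\<^esub> scal r) z = (\<Oplus>a\<in>D. \<Oplus>b\<in>D. (f a \<otimes> scal r b) \<otimes> \<iota> (s a b z))"
    using assms by (intro mult_coord scal_closed)
  also have "\<dots> = (\<Oplus>a\<in>D. (f a \<otimes> scal r u) \<otimes> \<iota> (s a u z))"
    using assms finite_D u_in
    by (intro finsum_congI finsum_only) (auto simp: scal_def)
  also have "\<dots> = (f z \<otimes> scal r u) \<otimes> \<iota> (s z u z)"
    using assms finite_D u_in
    by (intro finsum_only) (auto simp: scal_def s_unit_right of_int_ring_0)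
  also have "\<dots> = f z \<otimes> r" using assms by (simp add: scal_def s_unit_right of_int_ring_1)
  finally show ?thesis .
qed

lemma unitv_mult_coord:
  assumes b: "b \<in> D" and f: "f \<in> carrier A" and z: "z \<in> D"
  shows "(unitv b \<otimes>\<^bsub>A\<^esub> f) z = (\<Oplus>a\<in>D. f a \<otimes> \<iota> (s b a z))"
proof -
  have "(unitv b \<otimes>\<^bsub>A\<^esub> f) z = (\<Oplus>x\<in>D. \<Oplus>a\<in>D. (unitv b x \<otimes> f a) \<otimes> \<iota> (s x a z))"
    using assms by (intro mult_coord unitv_closed)
  also have "\<dots> = (\<Oplus>a\<in>D. (unitv b b \<otimes> f a) \<otimes> \<iota> (s b a z))"
    using assms finite_D
    by (intro finsum_only finsum_closedI finsum_eq_zeroI) (auto simp: unitv_def)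
  also have "\<dots> = (\<Oplus>a\<in>D. f a \<otimes> \<iota> (s b a z))"
    using assms by (intro finsum_congI) (auto simp: unitv_def)
  finally show ?thesis .
qed

lemma mult_unitv_coord:
  assumes b: "b \<in> D" and f: "f \<in> carrier A" and z: "z \<in> D"
  shows "(f \<otimes>\<^bsub>A\<^esub> unitv b) z = (\<Oplus>a\<in>D. f a \<otimes> \<iota> (s a b z))"
proof -
  have "(f \<otimes>\<^bsub>A\<^esub> unitv b) z = (\<Oplus>a\<in>D. \<Oplus>x\<in>D. (f a \<otimes> unitv b x) \<otimes> \<iota> (s a x z))"
    using assms by (intro mult_coord unitv_closed)
  also have "\<dots> = (\<Oplus>a\<in>D. (f a \<otimes> unitv b b) \<otimes> \<iota> (s a b z))"
    using assms finite_D by (intro finsum_congI finsum_only) (auto simp: unitv_def)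
  also have "\<dots> = (\<Oplus>a\<in>D. f a \<otimes> \<iota> (s a b z))"
    using assms by (intro finsum_congI) (auto simp: unitv_def)
  finally show ?thesis .
qed

lemma mult_distrib_left:
  assumes "f \<in> carrier A" "g \<in> carrier A" "h \<in> carrier A"
  shows "(f \<oplus>\<^bsub>A\<^esub> g) \<otimes>\<^bsub>A\<^esub> h = f \<otimes>\<^bsub>A\<^esub> h \<oplus>\<^bsub>A\<^esub> g \<otimes>\<^bsub>A\<^esub> h"
proof (rule vec_eqI)
  fix z assume z: "z \<in> D"
  have "((f \<oplus>\<^bsub>A\<^esub> g) \<otimes>\<^bsub>A\<^esub> h) z
      = (\<Oplus>a\<in>D. \<Oplus>b\<in>D. ((f a \<otimes> h b) \<otimes> \<iota> (s a b z)) \<oplus> ((g a \<otimes> h b) \<otimes> \<iota> (s a b z)))"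
    unfolding mult_coord[OF add_closed[OF assms(1,2)] assms(3) z]
    using assms by (intro finsum_congI finsum_closedI) (auto simp: l_distr)
  also have "\<dots> = (\<Oplus>a\<in>D. (\<Oplus>b\<in>D. (f a \<otimes> h b) \<otimes> \<iota> (s a b z)) \<oplus> (\<Oplus>b\<in>D. (g a \<otimes> h b) \<otimes> \<iota> (s a b z)))"
    using assms by (intro finsum_congI finsum_addI finsum_closedI a_closed) auto
  also have "\<dots> = (f \<otimes>\<^bsub>A\<^esub> h) z \<oplus> (g \<otimes>\<^bsub>A\<^esub> h) z"
    unfolding mult_coord[OF assms(1,3) z] mult_coord[OF assms(2,3) z]
    using assms by (intro finsum_addI finsum_closedI) auto
  finally show "((f \<oplus>\<^bsub>A\<^esub> g) \<otimes>\<^bsub>A\<^esub> h) z = (f \<otimes>\<^bsub>A\<^esub> h \<oplus>\<^bsub>A\<^esub> g \<otimes>\<^bsub>A\<^esub> h) z" using z by simp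
qed (use assms in \<open>auto intro: mult_closed add_closed\<close>)

lemma mult_distrib_right:
  assumes "f \<in> carrier A" "g \<in> carrier A" "h \<in> carrier A"
  shows "h \<otimes>\<^bsub>A\<^esub> (f \<oplus>\<^bsub>A\<^esub> g) = h \<otimes>\<^bsub>A\<^esub> f \<oplus>\<^bsub>A\<^esub> h \<otimes>\<^bsub>A\<^esub> g"
proof (rule vec_eqI)
  fix z assume z: "z \<in> D"
  have "(h \<otimes>\<^bsub>A\<^esub> (f \<oplus>\<^bsub>A\<^esub> g)) z
      = (\<Oplus>a\<in>D. \<Oplus>b\<in>D. ((h a \<otimes> f b) \<otimes> \<iota> (s a b z)) \<oplus> ((h a \<otimes> g b) \<otimes> \<iota> (s a b z)))"
    unfolding mult_coord[OF assms(3) add_closed[OF assms(1,2)] z]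
    using assms by (intro finsum_congI finsum_closedI) (auto simp: l_distr r_distr)
  also have "\<dots> = (\<Oplus>a\<in>D. (\<Oplus>b\<in>D. (h a \<otimes> f b) \<otimes> \<iota> (s a b z)) \<oplus> (\<Oplus>b\<in>D. (h a \<otimes> g b) \<otimes> \<iota> (s a b z)))"
    using assms by (intro finsum_congI finsum_addI finsum_closedI a_closed) auto
  also have "\<dots> = (h \<otimes>\<^bsub>A\<^esub> f) z \<oplus> (h \<otimes>\<^bsub>A\<^esub> g) z"
    unfolding mult_coord[OF assms(3,1) z] mult_coord[OF assms(3,2) z]
    using assms by (intro finsum_addI finsum_closedI) auto
  finally show "(h \<otimes>\<^bsub>A\<^esub> (f \<oplus>\<^bsub>A\<^esub> g)) z = (h \<otimes>\<^bsub>A\<^esub> f \<oplus>\<^bsub>A\<^esub> h \<otimes>\<^bsub>A\<^esub> g) z" using z by simp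
qed (use assms in \<open>auto intro: mult_closed add_closed\<close>)

lemma ring_A: "ring A"
proof (rule ringI)
  show "abelian_group A"
  proof (rule abelian_groupI)
    show "f \<oplus>\<^bsub>A\<^esub> g \<in> carrier A" if "f \<in> carrier A" "g \<in> carrier A" for f g
      using that by (rule add_closed)
    show "\<exists>g\<in>carrier A. g \<oplus>\<^bsub>A\<^esub> f = \<zero>\<^bsub>A\<^esub>" if f: "f \<in> carrier A" for f
    proof
      show c: "(\<lambda>c. if c \<in> D then \<ominus> f c else \<zero>) \<in> carrier A" using f by (intro vecI) auto
      show "(\<lambda>c. if c \<in> D then \<ominus> f c else \<zero>) \<oplus>\<^bsub>A\<^esub> f = \<zero>\<^bsub>A\<^esub>"
        using f by (auto simp: add_A zero_A l_neg)
    qed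
    show "\<zero>\<^bsub>A\<^esub> \<oplus>\<^bsub>A\<^esub> f = f" if "f \<in> carrier A" for f
      using that by (intro vec_eqI add_closed zero_closed_A) (auto simp: zero_A)
  qed (auto simp: add_A a_ac zero_closed_A)
  show "monoid A"
  proof (rule monoidI)
    show "\<one>\<^bsub>A\<^esub> \<in> carrier A" unfolding one_eq_scal by (simp add: scal_closed)
    show "\<one>\<^bsub>A\<^esub> \<otimes>\<^bsub>A\<^esub> f = f" "f \<otimes>\<^bsub>A\<^esub> \<one>\<^bsub>A\<^esub> = f" if "f \<in> carrier A" for f
      unfolding one_eq_scal using that
      by (auto intro!: vec_eqI mult_closed scal_closed simp: scal_mult_coord mult_scal_coord)
  qed (auto simp: mult_closed mult_assoc_A)
qed (auto simp: mult_distrib_left mult_distrib_right)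

sublocale alg: ring A
  by (rule ring_A)

lemma finsum_A_coord:
  assumes "finite B" "\<And>i. i \<in> B \<Longrightarrow> F i \<in> carrier A" "c \<in> D"
  shows "(finsum A F B) c = (\<Oplus>i\<in>B. F i c)"
  using assms(1,2)
proof (induction B rule: finite_induct)
  case empty
  then show ?case by (simp add: zero_A)
next
  case (insert x B)
  then show ?case using assms(3) by (simp add: alg.finsum_insertI finsum_insertI)
qed

lemma scal_central:
  assumes "r \<in> carrier R" "f \<in> carrier A"
  shows "scal r \<otimes>\<^bsub>A\<^esub> f = f \<otimes>\<^bsub>A\<^esub> scal r"
proof (rule vec_eqI)
  show "scal r \<otimes>\<^bsub>A\<^esub> f \<in> carrier A" "f \<otimes>\<^bsub>A\<^esub> scal r \<in> carrier A"
    using assms by (auto intro!: mult_closed scal_closed)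
  show "(scal r \<otimes>\<^bsub>A\<^esub> f) z = (f \<otimes>\<^bsub>A\<^esub> scal r) z" if "z \<in> D" for z
    unfolding scal_mult_coord[OF assms that] mult_scal_coord[OF assms that]
    using assms by (intro m_comm) auto
qed

section \<open>Subspaces, projections and traces of idempotents\<close>

definition subspace :: "('b \<Rightarrow> 'a) set \<Rightarrow> bool" where
  "subspace W \<longleftrightarrow> W \<subseteq> carrier A \<and> \<zero>\<^bsub>A\<^esub> \<in> W \<and> (\<forall>x\<in>W. \<forall>y\<in>W. x \<oplus>\<^bsub>A\<^esub> y \<in> W)
    \<and> (\<forall>r\<in>carrier R. \<forall>x\<in>W. scal r \<otimes>\<^bsub>A\<^esub> x \<in> W)"

lemma left_ideal_subspace: "left_ideal I A \<Longrightarrow> subspace I"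
  unfolding subspace_def left_ideal_def using scal_closed by blast

lemma subspace_finsum:
  assumes W: "subspace W" and "finite B" "\<And>i. i \<in> B \<Longrightarrow> F i \<in> W"
  shows "finsum A F B \<in> W"
  using assms(2,3)
proof (induction B rule: finite_induct)
  case empty
  then show ?case using W by (simp add: subspace_def)
next
  case (insert x B)
  have "F i \<in> carrier A" if "i \<in> insert x B" for i
    using that insert.prems W unfolding subspace_def by blast
  then have "finsum A F (insert x B) = F x \<oplus>\<^bsub>A\<^esub> finsum A F B"
    using insert.hyps by (intro alg.finsum_insertI) auto
  moreover have "F x \<in> W" "finsum A F B \<in> W" using insert by auto
  ultimately show ?case using W unfolding subspace_def by metis
qed

text \<open>A maximal set \<open>B\<close> of coordinates on whose span \<open>W\<close> is trivial gives a complement of \<open>W\<close>; the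
  rows of \<open>P\<close> outside \<open>B\<close> are the elements of \<open>W\<close> congruent to unit vectors modulo this span.\<close>

lemma projection_matrix:
  assumes W: "subspace W"
  obtains P n where "\<And>c. c \<in> D \<Longrightarrow> P c \<in> W"
    and "\<And>x y. x \<in> W \<Longrightarrow> y \<in> D \<Longrightarrow> x y = (\<Oplus>c\<in>D. x c \<otimes> P c y)"
    and "(\<Oplus>c\<in>D. P c c) = \<iota> (int n)" and "n \<le> card D" and "n = 0 \<Longrightarrow> W = {\<zero>\<^bsub>A\<^esub>}"
proof -
  have WA: "x \<in> carrier A" if "x \<in> W" for x using W that unfolding subspace_def by blast
  have W0: "\<zero>\<^bsub>A\<^esub> \<in> W" using W by (simp add: subspace_def)
  define good where "good B \<longleftrightarrow> B \<subseteq> D \<and> (\<forall>v\<in>W. (\<forall>y\<in>D - B. v y = \<zero>) \<longrightarrow> v = \<zero>\<^bsub>A\<^esub>)" for B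
  have "good {}"
    unfolding good_def using WA by (auto intro!: vec_eqI simp: zero_closed_A) (simp add: zero_A)
  moreover have "finite {B. good B}"
    by (rule finite_subset[of _ "Pow D"]) (auto simp: good_def finite_D)
  ultimately obtain B where B: "good B" and max: "\<And>B'. good B' \<Longrightarrow> B \<subseteq> B' \<Longrightarrow> B = B'"
    using finite_has_maximal[of "{B. good B}"] by blast
  have "\<exists>w\<in>W. w x = \<one> \<and> (\<forall>y\<in>D - B. y \<noteq> x \<longrightarrow> w y = \<zero>)" if x: "x \<in> D - B" for x
  proof -
    \<comment> \<open>By maximality some nonzero \<open>v\<close> in \<open>W\<close> is supported
      on \<open>B\<close> and \<open>x\<close>. Its coordinate at \<open>x\<close> cannot vanish, as
      \<open>B\<close> is good, so \<open>v\<close> can be scaled to have coordinate 1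
      there.\<close>
    have "\<not> good (insert x B)" using max[of "insert x B"] x by blast
    then obtain v where v: "v \<in> W" "v \<noteq> \<zero>\<^bsub>A\<^esub>" "\<And>y. y \<in> D - insert x B \<Longrightarrow> v y = \<zero>"
      using B x unfolding good_def by blast
    have vx: "v x \<noteq> \<zero>" using B v unfolding good_def by (metis DiffE DiffI insertE)
    have vU: "v x \<in> Units R" using vx v WA by (simp add: field_Units)
    then have i: "inv (v x) \<in> carrier R" by simp
    show ?thesis
    proof (intro bexI conjI ballI impI)
      show "scal (inv (v x)) \<otimes>\<^bsub>A\<^esub> v \<in> W" using W v(1) i by (simp add: subspace_def)
      show "(scal (inv (v x)) \<otimes>\<^bsub>A\<^esub> v) x = \<one>"
        using x v(1) WA i vU by (simp add: scal_mult_coord)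
      show "(scal (inv (v x)) \<otimes>\<^bsub>A\<^esub> v) y = \<zero>" if "y \<in> D - B" "y \<noteq> x" for y
        using that v(1,3) WA i by (simp add: scal_mult_coord)
    qed
  qed
  then obtain w where w: "\<And>x. x \<in> D - B \<Longrightarrow> w x \<in> W" "\<And>x. x \<in> D - B \<Longrightarrow> w x x = \<one>"
    "\<And>x y. x \<in> D - B \<Longrightarrow> y \<in> D - B \<Longrightarrow> y \<noteq> x \<Longrightarrow> w x y = \<zero>"
    by metis
  \<comment> \<open>Rows indexed by \<open>B\<close> are zero: a vector of \<open>W\<close> is
    recovered from its coordinates outside \<open>B\<close> alone.\<close>
  define P where "P c = (if c \<in> D - B then w c else \<zero>\<^bsub>A\<^esub>)" for c
  have PW: "P c \<in> W" if "c \<in> D" for c using w(1) W0 by (simp add: P_def)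
  then have PA: "P c \<in> carrier A" if "c \<in> D" for c using WA that by blast
  have proj: "x y = (\<Oplus>c\<in>D. x c \<otimes> P c y)" if x: "x \<in> W" and y: "y \<in> D" for x y
  proof -
    have xA: "x \<in> carrier A" using x WA by blast
    define x' where "x' = finsum A (\<lambda>c. scal (x c) \<otimes>\<^bsub>A\<^esub> P c) D"
    have tW: "scal (x c) \<otimes>\<^bsub>A\<^esub> P c \<in> W" if "c \<in> D" for c
      using W PW that xA by (simp add: subspace_def)
    have x'W: "x' \<in> W" unfolding x'_def using W finite_D tW by (rule subspace_finsum)
    have x'_coord: "x' z = (\<Oplus>c\<in>D. x c \<otimes> P c z)" if z: "z \<in> D" for z
      unfolding x'_def using finite_D tW WA z PA xA
      by (subst finsum_A_coord) (auto intro!: finsum_congI simp: scal_mult_coord)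
    \<comment> \<open>The difference between \<open>x\<close> and its candidate expansion lies in
      \<open>W\<close> and vanishes outside \<open>B\<close>, so it is zero because \<open>B\<close>
      is good.\<close>
    define \<Delta> where "\<Delta> = scal (\<ominus> \<one>) \<otimes>\<^bsub>A\<^esub> x \<oplus>\<^bsub>A\<^esub> x'"
    have "\<Delta> \<in> W" unfolding \<Delta>_def using W x x'W by (simp add: subspace_def)
    have \<Delta>_coord: "\<Delta> z = \<ominus> x z \<oplus> x' z" if "z \<in> D" for z
      unfolding \<Delta>_def using that xA by (simp add: scal_mult_coord l_minus)
    have "\<Delta> z = \<zero>" if z: "z \<in> D - B" for z
    proof -
      have "x' z = x z \<otimes> P z z"
        unfolding x'_coord[OF DiffD1[OF z]] using z xA PA finite_D w(2,3)
        by (intro finsum_only) (auto simp: P_def zero_A)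
      also have "\<dots> = x z" using z w(2) xA by (simp add: P_def)
      finally show ?thesis using \<Delta>_coord z xA by (simp add: l_neg)
    qed
    then have "\<Delta> = \<zero>\<^bsub>A\<^esub>" using B \<open>\<Delta> \<in> W\<close> unfolding good_def by blast
    then have "\<ominus> x y \<oplus> x' y = \<zero>" using \<Delta>_coord[OF y] by (simp add: zero_A)
    then have "x' y = x y"
      using xA x'W WA by (metis a_comm a_inv_closed coord_closed minus_equality minus_minus)
    then show ?thesis using x'_coord[OF y] by simp
  qed
  \<comment> \<open>The diagonal entries are 1 outside \<open>B\<close> and 0 on \<open>B\<close>;
    the trace thus counts the coordinates outside \<open>B\<close>, which is the dimension of
    \<open>W\<close>.\<close>
  have "(\<Oplus>c\<in>D. P c c) = (\<Oplus>c\<in>D. \<iota> (of_bool (c \<in> D - B)))"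
  proof (rule finsum_congI)
    fix c assume "c \<in> D"
    then show "P c c = \<iota> (of_bool (c \<in> D - B))"
      using w(2) by (simp add: P_def zero_A of_int_ring_0 of_int_ring_1)
  qed simp
  also have "\<dots> = \<iota> (\<Sum>c\<in>D. of_bool (c \<in> D - B))" by (rule of_int_ring_sum[symmetric])
  also have "(\<Sum>c\<in>D. of_bool (c \<in> D - B)) = int (card (D - B))"
    using finite_D by (simp add: sum_of_bool_eq Int_def set_diff_eq)
  finally have tr: "(\<Oplus>c\<in>D. P c c) = \<iota> (int (card (D - B)))" .
  have "W = {\<zero>\<^bsub>A\<^esub>}" if "card (D - B) = 0"
  proof -
    have "D - B = {}" using that finite_D by simp
    then show ?thesis using B W0 unfolding good_def by blast
  qed
  then show thesis
    using that[OF PW proj tr] finite_D by (simp add: card_mono)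
qed

lemma mult_coord_columns:
  assumes f: "f \<in> carrier A" and g: "g \<in> carrier A" and z: "z \<in> D"
  shows "(f \<otimes>\<^bsub>A\<^esub> g) z = (\<Oplus>b\<in>D. (f \<otimes>\<^bsub>A\<^esub> unitv b) z \<otimes> g b)"
proof -
  have "(f \<otimes>\<^bsub>A\<^esub> g) z = (\<Oplus>a\<in>D. \<Oplus>b\<in>D. (f a \<otimes> g b) \<otimes> \<iota> (s a b z))"
    by (rule mult_coord[OF assms])
  also have "\<dots> = (\<Oplus>b\<in>D. \<Oplus>a\<in>D. (f a \<otimes> g b) \<otimes> \<iota> (s a b z))"
    using assms finite_D by (intro finsum_swap) auto
  also have "\<dots> = (\<Oplus>b\<in>D. (f \<otimes>\<^bsub>A\<^esub> unitv b) z \<otimes> g b)"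
  proof (rule finsum_congI)
    fix b assume b: "b \<in> D"
    show "(f \<otimes>\<^bsub>A\<^esub> unitv b) z \<otimes> g b \<in> carrier R" using assms b by (simp add: unitv_closed)
    have "(f \<otimes>\<^bsub>A\<^esub> unitv b) z \<otimes> g b = (\<Oplus>a\<in>D. (f a \<otimes> \<iota> (s a b z)) \<otimes> g b)"
      unfolding mult_unitv_coord[OF b f z] using assms finite_D by (intro finsum_ldistrI) auto
    also have "\<dots> = (\<Oplus>a\<in>D. (f a \<otimes> g b) \<otimes> \<iota> (s a b z))"
      using assms by (intro finsum_congI) (auto simp: m_ac)
    finally show "(\<Oplus>a\<in>D. (f a \<otimes> g b) \<otimes> \<iota> (s a b z)) = (f \<otimes>\<^bsub>A\<^esub> unitv b) z \<otimes> g b" ..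
  qed
  finally show ?thesis .
qed

text \<open>Left multiplication by \<open>e\<close> and the matrix \<open>P\<close> project onto the
  same space \<open>W\<close>, the vectors fixed by \<open>e\<close>. Expanding the columns of the
  former through \<open>P\<close> and exchanging the sums replaces its trace by that of
  \<open>P\<close>. The bound on \<open>n\<close> is what a large positive characteristic is
  compared with.\<close>

lemma trace_idempotent:
  assumes e: "e \<in> carrier A" and idem: "e \<otimes>\<^bsub>A\<^esub> e = e"
  obtains n where "(\<Oplus>a\<in>D. e a \<otimes> \<iota> (reg_trace a)) = \<iota> (int n)" "n \<le> card D"
    "n = 0 \<Longrightarrow> e = \<zero>\<^bsub>A\<^esub>"
proof -
  define W where "W = {x \<in> carrier A. e \<otimes>\<^bsub>A\<^esub> x = x}"
  have eW: "e \<otimes>\<^bsub>A\<^esub> x \<in> W" if "x \<in> carrier A" for x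
    using that e idem by (simp add: W_def alg.m_assoc[symmetric])
  have "subspace W"
    unfolding subspace_def
  proof (intro conjI ballI)
    fix r x assume r: "r \<in> carrier R" and x: "x \<in> W"
    have "e \<otimes>\<^bsub>A\<^esub> (scal r \<otimes>\<^bsub>A\<^esub> x) = scal r \<otimes>\<^bsub>A\<^esub> (e \<otimes>\<^bsub>A\<^esub> x)"
      using x e scal_central[OF r e] scal_closed[OF r] alg.m_assoc[of e "scal r" x]
        alg.m_assoc[of "scal r" e x] by (simp add: W_def)
    then show "scal r \<otimes>\<^bsub>A\<^esub> x \<in> W" using x scal_closed[OF r] by (simp add: W_def)
  qed (use e in \<open>auto simp: W_def alg.r_distr\<close>)
  then obtain P n where P: "\<And>c. c \<in> D \<Longrightarrow> P c \<in> W"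
      "\<And>x y. x \<in> W \<Longrightarrow> y \<in> D \<Longrightarrow> x y = (\<Oplus>c\<in>D. x c \<otimes> P c y)"
    and n: "(\<Oplus>c\<in>D. P c c) = \<iota> (int n)" "n \<le> card D" "n = 0 \<Longrightarrow> W = {\<zero>\<^bsub>A\<^esub>}"
    using projection_matrix by blast
  have PA: "P c \<in> carrier A" "e \<otimes>\<^bsub>A\<^esub> P c = P c" if "c \<in> D" for c using P(1)[OF that] by (auto simp: W_def)
  have eu: "e \<otimes>\<^bsub>A\<^esub> unitv b \<in> carrier A" if "b \<in> D" for b
    using e unitv_closed[OF that] by simp
  have "(\<Oplus>a\<in>D. e a \<otimes> \<iota> (reg_trace a)) = (\<Oplus>a\<in>D. \<Oplus>b\<in>D. e a \<otimes> \<iota> (s a b b))"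
    unfolding reg_trace_def of_int_ring_sum
    using e finite_D by (intro finsum_congI finsum_rdistrI finsum_closedI) auto
  also have "\<dots> = (\<Oplus>b\<in>D. \<Oplus>a\<in>D. e a \<otimes> \<iota> (s a b b))"
    using e finite_D by (intro finsum_swap) auto
  also have "\<dots> = (\<Oplus>b\<in>D. (e \<otimes>\<^bsub>A\<^esub> unitv b) b)"
    using e eu by (intro finsum_congI mult_unitv_coord[symmetric]) auto
  also have "\<dots> = (\<Oplus>b\<in>D. \<Oplus>c\<in>D. (e \<otimes>\<^bsub>A\<^esub> unitv b) c \<otimes> P c b)"
    using eu PA eW unitv_closed by (intro finsum_congI P(2) finsum_closedI) auto
  also have "\<dots> = (\<Oplus>c\<in>D. \<Oplus>b\<in>D. (e \<otimes>\<^bsub>A\<^esub> unitv b) c \<otimes> P c b)"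
    using eu PA finite_D by (intro finsum_swap) auto
  also have "\<dots> = (\<Oplus>c\<in>D. P c c)"
  proof (rule finsum_congI)
    fix c assume c: "c \<in> D"
    show "P c c \<in> carrier R" using PA(1)[OF c] by simp
    show "(\<Oplus>b\<in>D. (e \<otimes>\<^bsub>A\<^esub> unitv b) c \<otimes> P c b) = P c c"
      using mult_coord_columns[OF e PA(1)[OF c] c] PA(2)[OF c] by simp
  qed
  finally have "(\<Oplus>a\<in>D. e a \<otimes> \<iota> (reg_trace a)) = \<iota> (int n)" using n(1) by simp
  moreover have "e = \<zero>\<^bsub>A\<^esub>" if "n = 0"
    using n(3)[OF that] e idem by (auto simp: W_def)
  ultimately show thesis using that n(2) by blast
qed

text \<open>The assumption on \<open>c\<close> keeps the image of the integral kernel vector nonzero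
  in the field; \<open>char\<close> says that no positive rank up to the dimension is zero in the
  field.\<close>

lemma singular_imp_not_semisimple:
  assumes v: "c \<in> D" "\<iota> (v c) \<noteq> \<zero>" "\<And>a. a \<in> D \<Longrightarrow> (\<Sum>b\<in>D. trace_form a b * v b) = 0"
    and char: "\<And>n. 0 < n \<Longrightarrow> n \<le> card D \<Longrightarrow> \<iota> (int n) \<noteq> \<zero>"
  shows "\<not> semisimple A"
proof
  assume ss: "semisimple A"
  define I where "I = {x \<in> carrier A. \<forall>b\<in>D. (\<Oplus>a\<in>D. x a \<otimes> \<iota> (trace_form a b)) = \<zero>}"
  have IA: "x \<in> carrier A" if "x \<in> I" for x using that by (simp add: I_def)
  \<comment> \<open>The radical is a left ideal because the form is symmetric and associative:
    pairing \<open>y x\<close> with \<open>b\<close> equals pairing \<open>x\<close> with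
    \<open>b y\<close>, which is zero.\<close>
  have mult_I: "y \<otimes>\<^bsub>A\<^esub> x \<in> I" if y: "y \<in> carrier A" and x: "x \<in> I" for x y
  proof -
    have xA: "x \<in> carrier A" using x by (rule IA)
    have "(\<Oplus>z\<in>D. (y \<otimes>\<^bsub>A\<^esub> x) z \<otimes> \<iota> (trace_form z b)) = \<zero>" if b: "b \<in> D" for b
    proof -
      have "(\<Oplus>z\<in>D. (y \<otimes>\<^bsub>A\<^esub> x) z \<otimes> \<iota> (trace_form z b))
          = (\<Oplus>z\<in>D. \<Oplus>p\<in>D. \<Oplus>q\<in>D. ((y p \<otimes> x q) \<otimes> \<iota> (s p q z)) \<otimes> \<iota> (trace_form z b))"
      proof (intro finsum_congI finsum_closedI)
        fix z assume z: "z \<in> D"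
        show "(y \<otimes>\<^bsub>A\<^esub> x) z \<otimes> \<iota> (trace_form z b)
          = (\<Oplus>p\<in>D. \<Oplus>q\<in>D. ((y p \<otimes> x q) \<otimes> \<iota> (s p q z)) \<otimes> \<iota> (trace_form z b))"
          unfolding mult_coord[OF y xA z] using y xA by (intro finsum_ldistr2) auto
      qed (use y xA in auto)
      also have "\<dots> = (\<Oplus>p\<in>D. \<Oplus>q\<in>D. \<Oplus>z\<in>D. ((y p \<otimes> x q) \<otimes> \<iota> (s p q z)) \<otimes> \<iota> (trace_form z b))"
        using y xA by (intro finsum_rotate3) auto
      also have "\<dots> = (\<Oplus>p\<in>D. \<Oplus>q\<in>D. (y p \<otimes> x q) \<otimes> \<iota> (\<Sum>z\<in>D. s p q z * trace_form z b))"
      proof (intro finsum_congI finsum_closedI)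
        fix p q assume "p \<in> D" "q \<in> D"
        have "(y p \<otimes> x q) \<otimes> \<iota> (\<Sum>z\<in>D. s p q z * trace_form z b)
          = (\<Oplus>z\<in>D. (y p \<otimes> x q) \<otimes> \<iota> (s p q z * trace_form z b))"
          unfolding of_int_ring_sum using y xA finite_D by (intro finsum_rdistrI) auto
        also have "\<dots> = (\<Oplus>z\<in>D. ((y p \<otimes> x q) \<otimes> \<iota> (s p q z)) \<otimes> \<iota> (trace_form z b))"
          using y xA by (intro finsum_congI) (auto simp: of_int_ring_mult m_assoc)
        finally show "(\<Oplus>z\<in>D. ((y p \<otimes> x q) \<otimes> \<iota> (s p q z)) \<otimes> \<iota> (trace_form z b))
          = (y p \<otimes> x q) \<otimes> \<iota> (\<Sum>z\<in>D. s p q z * trace_form z b)" ..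
      qed (use y xA in auto)
      also have "\<dots> = (\<Oplus>p\<in>D. \<Oplus>q\<in>D. \<Oplus>w\<in>D. (y p \<otimes> \<iota> (s b p w)) \<otimes> (x q \<otimes> \<iota> (trace_form q w)))"
      proof (intro finsum_congI finsum_closedI)
        fix p q assume pq: "p \<in> D" "q \<in> D"
        have "(\<Sum>z\<in>D. s p q z * trace_form z b) = (\<Sum>z\<in>D. s p q z * trace_form b z)"
          using b by (intro sum.cong refl) (simp add: trace_form_sym)
        also have "\<dots> = (\<Sum>w\<in>D. s b p w * trace_form w q)"
          using trace_form_assoc[OF b pq] by simp
        also have "\<dots> = (\<Sum>w\<in>D. s b p w * trace_form q w)"
          using pq by (intro sum.cong refl) (simp add: trace_form_sym)
        finally have "(y p \<otimes> x q) \<otimes> \<iota> (\<Sum>z\<in>D. s p q z * trace_form z b)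
          = (\<Oplus>w\<in>D. (y p \<otimes> x q) \<otimes> \<iota> (s b p w * trace_form q w))"
          by (simp only: of_int_ring_sum) (use y xA finite_D in \<open>intro finsum_rdistrI, auto\<close>)
        also have "\<dots> = (\<Oplus>w\<in>D. (y p \<otimes> \<iota> (s b p w)) \<otimes> (x q \<otimes> \<iota> (trace_form q w)))"
          using y xA by (intro finsum_congI) (auto simp: of_int_ring_mult m_ac)
        finally show "(y p \<otimes> x q) \<otimes> \<iota> (\<Sum>z\<in>D. s p q z * trace_form z b)
          = (\<Oplus>w\<in>D. (y p \<otimes> \<iota> (s b p w)) \<otimes> (x q \<otimes> \<iota> (trace_form q w)))" .
      qed (use y xA in auto)
      also have "\<dots> = (\<Oplus>p\<in>D. \<Oplus>w\<in>D. \<Oplus>q\<in>D. (y p \<otimes> \<iota> (s b p w)) \<otimes> (x q \<otimes> \<iota> (trace_form q w)))"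
        using y xA finite_D by (intro finsum_congI finsum_swap finsum_closedI) auto
      also have "\<dots> = \<zero>"
      proof (rule finsum_eq_zeroI, rule finsum_eq_zeroI)
        fix p w assume "p \<in> D" and w: "w \<in> D"
        have "(\<Oplus>q\<in>D. (y p \<otimes> \<iota> (s b p w)) \<otimes> (x q \<otimes> \<iota> (trace_form q w)))
          = (y p \<otimes> \<iota> (s b p w)) \<otimes> (\<Oplus>q\<in>D. x q \<otimes> \<iota> (trace_form q w))"
          using y xA finite_D by (intro finsum_rdistrI[symmetric]) auto
        also have "(\<Oplus>q\<in>D. x q \<otimes> \<iota> (trace_form q w)) = \<zero>" using x w by (simp add: I_def)
        finally show "(\<Oplus>q\<in>D. (y p \<otimes> \<iota> (s b p w)) \<otimes> (x q \<otimes> \<iota> (trace_form q w))) = \<zero>"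
          using y by simp
      qed
      finally show ?thesis .
    qed
    then show ?thesis using y xA by (simp add: I_def)
  qed
  have add_I: "x \<oplus>\<^bsub>A\<^esub> y \<in> I" if x: "x \<in> I" and y: "y \<in> I" for x y
  proof -
    have "(\<Oplus>a\<in>D. (x \<oplus>\<^bsub>A\<^esub> y) a \<otimes> \<iota> (trace_form a b)) = \<zero>" if b: "b \<in> D" for b
    proof -
      have "(\<Oplus>a\<in>D. (x \<oplus>\<^bsub>A\<^esub> y) a \<otimes> \<iota> (trace_form a b))
        = (\<Oplus>a\<in>D. (x a \<otimes> \<iota> (trace_form a b)) \<oplus> (y a \<otimes> \<iota> (trace_form a b)))"
        using IA[OF x] IA[OF y] by (intro finsum_congI) (auto simp: l_distr)
      also have "\<dots> = (\<Oplus>a\<in>D. x a \<otimes> \<iota> (trace_form a b)) \<oplus> (\<Oplus>a\<in>D. y a \<otimes> \<iota> (trace_form a b))"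
        using IA[OF x] IA[OF y] by (intro finsum_addI) auto
      finally show ?thesis using x y b by (simp add: I_def)
    qed
    then show ?thesis using IA[OF x] IA[OF y] by (simp add: I_def)
  qed
  have zero_I: "\<zero>\<^bsub>A\<^esub> \<in> I"
    unfolding I_def by (auto intro!: finsum_eq_zeroI simp: zero_A[symmetric]) (simp add: zero_A)
  have "left_ideal I A"
    by (rule alg.left_idealI) (use IA add_I mult_I zero_I in auto)
  then obtain e where e: "e \<in> I" "\<And>y. y \<in> I \<Longrightarrow> y \<otimes>\<^bsub>A\<^esub> e = y"
    using alg.semisimple_imp_left_ideal_right_unit[OF ss] by metis
  have eA: "e \<in> carrier A" using e IA by blast
  obtain n where n: "(\<Oplus>a\<in>D. e a \<otimes> \<iota> (reg_trace a)) = \<iota> (int n)" "n \<le> card D"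
    "n = 0 \<Longrightarrow> e = \<zero>\<^bsub>A\<^esub>"
    using trace_idempotent[OF eA e(2)[OF e(1)]] by blast
  \<comment> \<open>The trace of left multiplication by \<open>e\<close> is the pairing of
    \<open>e\<close> with the unit, hence zero for \<open>e\<close> in the radical.\<close>
  have "(\<Oplus>a\<in>D. e a \<otimes> \<iota> (reg_trace a)) = (\<Oplus>a\<in>D. e a \<otimes> \<iota> (trace_form a u))"
    using eA by (intro finsum_congI) (auto simp: trace_form_unit)
  also have "\<dots> = \<zero>" using e(1) u_in by (simp add: I_def)
  finally have "\<iota> (int n) = \<zero>" using n(1) by simp
  then have "n = 0" using char n(2) by blast
  then have e0: "e = \<zero>\<^bsub>A\<^esub>" by (rule n(3))
  \<comment> \<open>The image of the integral kernel vector lies in the radical, whose right unit is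
    now zero; so this image would be zero, contrary to its coordinate at \<open>c\<close>.\<close>
  define x where "x = (\<lambda>a. if a \<in> D then \<iota> (v a) else \<zero>)"
  have xA: "x \<in> carrier A" by (rule vecI) (auto simp: x_def)
  have "x \<in> I"
  proof -
    have "(\<Oplus>a\<in>D. x a \<otimes> \<iota> (trace_form a b)) = \<zero>" if b: "b \<in> D" for b
    proof -
      have "(\<Oplus>a\<in>D. x a \<otimes> \<iota> (trace_form a b)) = (\<Oplus>a\<in>D. \<iota> (trace_form b a * v a))"
        using b by (intro finsum_congI) (auto simp: x_def of_int_ring_mult trace_form_sym m_comm)
      also have "\<dots> = \<iota> (\<Sum>a\<in>D. trace_form b a * v a)" by (rule of_int_ring_sum[symmetric])
      finally show ?thesis using v(3)[OF b] by (simp add: of_int_ring_0)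
    qed
    then show ?thesis using xA by (simp add: I_def)
  qed
  then have "x = \<zero>\<^bsub>A\<^esub>" using e(2)[of x] e0 xA by simp
  then have "x c = \<zero>" by (simp add: zero_A)
  then show False using v(1,2) by (simp add: x_def)
qed

text \<open>Let \<open>P\<close> define a linear projection onto \<open>I\<close>, and let
  \<open>g c\<close> be dual to the basis element \<open>c\<close>. The averaged projection sends
  \<open>x\<close> to the sum over \<open>c\<close> of \<open>g c\<close> times the projection of
  \<open>c x\<close>. It commutes with left multiplication and is the identity on \<open>I\<close>;
  its value at 1 is \<open>e\<close>, so \<open>y e\<close> is its value at \<open>y\<close>, that
  is \<open>y\<close> for \<open>y\<close> in \<open>I\<close>.\<close>

lemma invertible_imp_semisimple:
  assumes N: "\<iota> N \<noteq> \<zero>"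
    and GH: "\<And>a b. a \<in> D \<Longrightarrow> b \<in> D \<Longrightarrow> (\<Sum>c\<in>D. trace_form a c * H c b) = N * of_bool (a = b)"
    and HG: "\<And>a b. a \<in> D \<Longrightarrow> b \<in> D \<Longrightarrow> (\<Sum>c\<in>D. H a c * trace_form c b) = N * of_bool (a = b)"
  shows "semisimple A"
proof (rule alg.left_ideal_right_unit_imp_semisimple)
  fix I assume I: "left_ideal I A"
  have N0: "N \<noteq> 0" using N of_int_ring_0 by metis
  have invariant: "(\<Sum>a\<in>D. s y a z * H a w) = (\<Sum>c\<in>D. H z c * s c y w)"
    if "y \<in> D" "z \<in> D" "w \<in> D" for y z w
    by (rule casimir_invariant[where N = N]) (fact N0 that | erule (1) GH | erule (1) HG)+
  have product: "(\<Sum>a\<in>D. \<Sum>c\<in>D. H a c * s a c z) = N * of_bool (z = u)" if "z \<in> D" for z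
    by (rule casimir_product[where N = N]) (fact N0 that | erule (1) GH | erule (1) HG)+
  have IA: "x \<in> carrier A" if "x \<in> I" for x using I that by (auto simp: left_ideal_def)
  have multI: "y \<otimes>\<^bsub>A\<^esub> x \<in> I" if "y \<in> carrier A" "x \<in> I" for x y
    using I that by (auto simp: left_ideal_def)
  have sub: "subspace I" using I by (rule left_ideal_subspace)
  obtain P where P: "\<And>c. c \<in> D \<Longrightarrow> P c \<in> I"
      "\<And>x y. x \<in> I \<Longrightarrow> y \<in> D \<Longrightarrow> x y = (\<Oplus>c\<in>D. x c \<otimes> P c y)"
    using projection_matrix[OF sub] by metis
  have PA: "P c \<in> carrier A" if "c \<in> D" for c using P(1) IA that by blast
  define k where "k = inv (\<iota> N)"
  have U: "\<iota> N \<in> Units R" using N by (simp add: field_Units)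
  have k: "k \<in> carrier R" "k \<otimes> \<iota> N = \<one>" using U by (auto simp: k_def)
  define g where "g c = (\<lambda>a. if a \<in> D then k \<otimes> \<iota> (H a c) else \<zero>)" for c
  have gA: "g c \<in> carrier A" for c by (rule vecI) (use k in \<open>auto simp: g_def\<close>)
  define e where "e = finsum A (\<lambda>c. g c \<otimes>\<^bsub>A\<^esub> P c) D"
  have eI: "e \<in> I" unfolding e_def using sub finite_D by (rule subspace_finsum) (use P(1) gA multI in auto)
  \<comment> \<open>Invariance of the Casimir element, expressed on the dual basis: the factor
    \<open>y\<close> to the left of \<open>g w\<close> is traded for the
    \<open>w\<close>-coordinates of the products \<open>c y\<close>.\<close>
  have slide: "y \<otimes>\<^bsub>A\<^esub> g w = finsum A (\<lambda>c. scal ((unitv c \<otimes>\<^bsub>A\<^esub> y) w) \<otimes>\<^bsub>A\<^esub> g c) D"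
    if y: "y \<in> carrier A" and w: "w \<in> D" for y w
  proof (rule vec_eqI)
    have uy: "unitv c \<otimes>\<^bsub>A\<^esub> y \<in> carrier A" if "c \<in> D" for c using y unitv_closed[OF that] by simp
    have tA: "scal ((unitv c \<otimes>\<^bsub>A\<^esub> y) w) \<otimes>\<^bsub>A\<^esub> g c \<in> carrier A" if "c \<in> D" for c
      using gA scal_closed[OF coord_closed[OF uy[OF that]]] by simp
    show "y \<otimes>\<^bsub>A\<^esub> g w \<in> carrier A" using y gA by simp
    show "finsum A (\<lambda>c. scal ((unitv c \<otimes>\<^bsub>A\<^esub> y) w) \<otimes>\<^bsub>A\<^esub> g c) D \<in> carrier A"
      using tA by (rule alg.finsum_closedI)
    fix z assume z: "z \<in> D"
    have "(y \<otimes>\<^bsub>A\<^esub> g w) z = (\<Oplus>a\<in>D. \<Oplus>b\<in>D. (y a \<otimes> g w b) \<otimes> \<iota> (s a b z))"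
      by (rule mult_coord[OF y gA z])
    also have "\<dots> = (\<Oplus>a\<in>D. (y a \<otimes> k) \<otimes> \<iota> (\<Sum>b\<in>D. s a b z * H b w))"
    proof (rule finsum_congI)
      fix a assume a: "a \<in> D"
      have "(y a \<otimes> k) \<otimes> \<iota> (\<Sum>b\<in>D. s a b z * H b w) = (\<Oplus>b\<in>D. (y a \<otimes> k) \<otimes> \<iota> (s a b z * H b w))"
        unfolding of_int_ring_sum using y k finite_D by (intro finsum_rdistrI) auto
      also have "\<dots> = (\<Oplus>b\<in>D. (y a \<otimes> g w b) \<otimes> \<iota> (s a b z))"
        using y k by (intro finsum_congI) (auto simp: g_def of_int_ring_mult m_ac)
      finally show "(\<Oplus>b\<in>D. (y a \<otimes> g w b) \<otimes> \<iota> (s a b z))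
        = (y a \<otimes> k) \<otimes> \<iota> (\<Sum>b\<in>D. s a b z * H b w)" ..
    qed (use y k in auto)
    also have "\<dots> = (\<Oplus>a\<in>D. (y a \<otimes> k) \<otimes> \<iota> (\<Sum>c\<in>D. H z c * s c a w))"
    proof (rule finsum_congI)
      fix a assume a: "a \<in> D"
      show "(y a \<otimes> k) \<otimes> \<iota> (\<Sum>b\<in>D. s a b z * H b w) = (y a \<otimes> k) \<otimes> \<iota> (\<Sum>c\<in>D. H z c * s c a w)"
        by (subst invariant[OF a z w]) (rule refl)
    qed (use y k in auto)
    also have "\<dots> = (\<Oplus>a\<in>D. \<Oplus>c\<in>D. (y a \<otimes> \<iota> (s c a w)) \<otimes> (k \<otimes> \<iota> (H z c)))"
    proof (rule finsum_congI)
      fix a assume a: "a \<in> D"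
      have "(y a \<otimes> k) \<otimes> \<iota> (\<Sum>c\<in>D. H z c * s c a w) = (\<Oplus>c\<in>D. (y a \<otimes> k) \<otimes> \<iota> (H z c * s c a w))"
        unfolding of_int_ring_sum using y k finite_D by (intro finsum_rdistrI) auto
      also have "\<dots> = (\<Oplus>c\<in>D. (y a \<otimes> \<iota> (s c a w)) \<otimes> (k \<otimes> \<iota> (H z c)))"
        using y k by (intro finsum_congI) (auto simp: of_int_ring_mult m_ac)
      finally show "(y a \<otimes> k) \<otimes> \<iota> (\<Sum>c\<in>D. H z c * s c a w)
        = (\<Oplus>c\<in>D. (y a \<otimes> \<iota> (s c a w)) \<otimes> (k \<otimes> \<iota> (H z c)))" .
    qed (use y k in \<open>auto intro!: finsum_closedI\<close>)
    also have "\<dots> = (\<Oplus>c\<in>D. \<Oplus>a\<in>D. (y a \<otimes> \<iota> (s c a w)) \<otimes> (k \<otimes> \<iota> (H z c)))"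
      using y k finite_D by (intro finsum_swap) auto
    also have "\<dots> = (\<Oplus>c\<in>D. (scal ((unitv c \<otimes>\<^bsub>A\<^esub> y) w) \<otimes>\<^bsub>A\<^esub> g c) z)"
    proof (rule finsum_congI)
      fix c assume c: "c \<in> D"
      show "(scal ((unitv c \<otimes>\<^bsub>A\<^esub> y) w) \<otimes>\<^bsub>A\<^esub> g c) z \<in> carrier R" using tA[OF c] by simp
      have "(scal ((unitv c \<otimes>\<^bsub>A\<^esub> y) w) \<otimes>\<^bsub>A\<^esub> g c) z = (unitv c \<otimes>\<^bsub>A\<^esub> y) w \<otimes> g c z"
        using uy[OF c] gA z by (intro scal_mult_coord) auto
      also have "\<dots> = (\<Oplus>a\<in>D. (y a \<otimes> \<iota> (s c a w)) \<otimes> (k \<otimes> \<iota> (H z c)))"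
        unfolding unitv_mult_coord[OF c y w] g_def using y k z finite_D
        by simp (intro finsum_ldistrI, auto)
      finally show "(\<Oplus>a\<in>D. (y a \<otimes> \<iota> (s c a w)) \<otimes> (k \<otimes> \<iota> (H z c)))
        = (scal ((unitv c \<otimes>\<^bsub>A\<^esub> y) w) \<otimes>\<^bsub>A\<^esub> g c) z" ..
    qed
    also have "\<dots> = (finsum A (\<lambda>c. scal ((unitv c \<otimes>\<^bsub>A\<^esub> y) w) \<otimes>\<^bsub>A\<^esub> g c) D) z"
      using finite_D tA z by (rule finsum_A_coord[symmetric])
    finally show "(y \<otimes>\<^bsub>A\<^esub> g w) z
      = (finsum A (\<lambda>c. scal ((unitv c \<otimes>\<^bsub>A\<^esub> y) w) \<otimes>\<^bsub>A\<^esub> g c) D) z" .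
  qed
  have unit: "finsum A (\<lambda>c. g c \<otimes>\<^bsub>A\<^esub> unitv c) D = \<one>\<^bsub>A\<^esub>"
  proof (rule vec_eqI)
    have tA: "g c \<otimes>\<^bsub>A\<^esub> unitv c \<in> carrier A" if "c \<in> D" for c using gA unitv_closed[OF that] by simp
    show "finsum A (\<lambda>c. g c \<otimes>\<^bsub>A\<^esub> unitv c) D \<in> carrier A" using tA by (rule alg.finsum_closedI)
    fix z assume z: "z \<in> D"
    have "(finsum A (\<lambda>c. g c \<otimes>\<^bsub>A\<^esub> unitv c) D) z = (\<Oplus>c\<in>D. (g c \<otimes>\<^bsub>A\<^esub> unitv c) z)"
      using finite_D tA z by (rule finsum_A_coord)
    also have "\<dots> = (\<Oplus>c\<in>D. k \<otimes> \<iota> (\<Sum>a\<in>D. H a c * s a c z))"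
    proof (rule finsum_congI)
      fix c assume c: "c \<in> D"
      have "k \<otimes> \<iota> (\<Sum>a\<in>D. H a c * s a c z) = (\<Oplus>a\<in>D. k \<otimes> \<iota> (H a c * s a c z))"
        unfolding of_int_ring_sum using k finite_D by (intro finsum_rdistrI) auto
      also have "\<dots> = (\<Oplus>a\<in>D. g c a \<otimes> \<iota> (s a c z))"
        using k by (intro finsum_congI) (auto simp: g_def of_int_ring_mult m_assoc)
      also have "\<dots> = (g c \<otimes>\<^bsub>A\<^esub> unitv c) z" by (rule mult_unitv_coord[OF c gA z, symmetric])
      finally show "(g c \<otimes>\<^bsub>A\<^esub> unitv c) z = k \<otimes> \<iota> (\<Sum>a\<in>D. H a c * s a c z)" ..
    qed (use k in auto)
    also have "\<dots> = k \<otimes> (\<Oplus>c\<in>D. \<iota> (\<Sum>a\<in>D. H a c * s a c z))"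
      using k finite_D by (intro finsum_rdistrI[symmetric]) auto
    also have "\<dots> = k \<otimes> \<iota> (\<Sum>c\<in>D. \<Sum>a\<in>D. H a c * s a c z)"
      by (simp only: of_int_ring_sum)
    also have "(\<Sum>c\<in>D. \<Sum>a\<in>D. H a c * s a c z) = N * of_bool (z = u)"
      by (subst sum.swap) (rule product[OF z])
    also have "k \<otimes> \<iota> (N * of_bool (z = u)) = \<one>\<^bsub>A\<^esub> z"
      using k by (simp add: one_A of_int_ring_0)
    finally show "(finsum A (\<lambda>c. g c \<otimes>\<^bsub>A\<^esub> unitv c) D) z = \<one>\<^bsub>A\<^esub> z" .
  qed simp
  have "y \<otimes>\<^bsub>A\<^esub> e = y" if yI: "y \<in> I" for y
  proof -
    have y: "y \<in> carrier A" using yI IA by blast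
    define t where "t c w = scal ((unitv c \<otimes>\<^bsub>A\<^esub> y) w)" for c w
    have uyI: "unitv c \<otimes>\<^bsub>A\<^esub> y \<in> I" if "c \<in> D" for c using multI unitv_closed that yI by blast
    have tA: "t c w \<in> carrier A" if "c \<in> D" for c w
      unfolding t_def using IA[OF uyI[OF that]] by (intro scal_closed) simp
    have "y \<otimes>\<^bsub>A\<^esub> e = finsum A (\<lambda>w. y \<otimes>\<^bsub>A\<^esub> (g w \<otimes>\<^bsub>A\<^esub> P w)) D"
      unfolding e_def using finite_D y gA PA by (intro alg.finsum_rdistrI) auto
    also have "\<dots> = finsum A (\<lambda>w. finsum A (\<lambda>c. g c \<otimes>\<^bsub>A\<^esub> (t c w \<otimes>\<^bsub>A\<^esub> P w)) D) D"
    proof (rule alg.finsum_congI)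
      fix w assume w: "w \<in> D"
      show "finsum A (\<lambda>c. g c \<otimes>\<^bsub>A\<^esub> (t c w \<otimes>\<^bsub>A\<^esub> P w)) D \<in> carrier A"
        using gA tA PA[OF w] by (intro alg.finsum_closedI) auto
      have "y \<otimes>\<^bsub>A\<^esub> (g w \<otimes>\<^bsub>A\<^esub> P w) = finsum A (\<lambda>c. t c w \<otimes>\<^bsub>A\<^esub> g c) D \<otimes>\<^bsub>A\<^esub> P w"
        using y gA PA[OF w] slide[OF y w] by (simp add: alg.m_assoc[symmetric] t_def)
      also have "\<dots> = finsum A (\<lambda>c. (t c w \<otimes>\<^bsub>A\<^esub> g c) \<otimes>\<^bsub>A\<^esub> P w) D"
        using finite_D gA tA PA[OF w] by (intro alg.finsum_ldistrI) auto
      also have "\<dots> = finsum A (\<lambda>c. g c \<otimes>\<^bsub>A\<^esub> (t c w \<otimes>\<^bsub>A\<^esub> P w)) D"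
      proof (rule alg.finsum_congI)
        fix c assume c: "c \<in> D"
        show "g c \<otimes>\<^bsub>A\<^esub> (t c w \<otimes>\<^bsub>A\<^esub> P w) \<in> carrier A" using gA tA[OF c] PA[OF w] by simp
        have "t c w \<otimes>\<^bsub>A\<^esub> g c = g c \<otimes>\<^bsub>A\<^esub> t c w"
          unfolding t_def using gA IA[OF uyI[OF c]] by (intro scal_central) auto
        then show "(t c w \<otimes>\<^bsub>A\<^esub> g c) \<otimes>\<^bsub>A\<^esub> P w = g c \<otimes>\<^bsub>A\<^esub> (t c w \<otimes>\<^bsub>A\<^esub> P w)"
          using gA tA[OF c] PA[OF w] by (simp add: alg.m_assoc)
      qed
      finally show "y \<otimes>\<^bsub>A\<^esub> (g w \<otimes>\<^bsub>A\<^esub> P w) = finsum A (\<lambda>c. g c \<otimes>\<^bsub>A\<^esub> (t c w \<otimes>\<^bsub>A\<^esub> P w)) D" .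
    qed
    also have "\<dots> = finsum A (\<lambda>c. finsum A (\<lambda>w. g c \<otimes>\<^bsub>A\<^esub> (t c w \<otimes>\<^bsub>A\<^esub> P w)) D) D"
      using finite_D gA tA PA by (intro alg.finsum_swap) auto
    also have "\<dots> = finsum A (\<lambda>c. (g c \<otimes>\<^bsub>A\<^esub> unitv c) \<otimes>\<^bsub>A\<^esub> y) D"
    proof (rule alg.finsum_congI)
      fix c assume c: "c \<in> D"
      have uyA: "unitv c \<otimes>\<^bsub>A\<^esub> y \<in> carrier A" using uyI[OF c] by (rule IA)
      show "(g c \<otimes>\<^bsub>A\<^esub> unitv c) \<otimes>\<^bsub>A\<^esub> y \<in> carrier A" using gA unitv_closed[OF c] y by simp
      \<comment> \<open>The product of the basis element \<open>c\<close> with \<open>y\<close>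
        stays in the left ideal \<open>I\<close>, so \<open>P\<close> reproduces it.\<close>
      have "finsum A (\<lambda>w. t c w \<otimes>\<^bsub>A\<^esub> P w) D = unitv c \<otimes>\<^bsub>A\<^esub> y"
      proof (rule vec_eqI)
        show "finsum A (\<lambda>w. t c w \<otimes>\<^bsub>A\<^esub> P w) D \<in> carrier A"
          using tA[OF c] PA by (intro alg.finsum_closedI) auto
        fix z assume z: "z \<in> D"
        have "(finsum A (\<lambda>w. t c w \<otimes>\<^bsub>A\<^esub> P w) D) z = (\<Oplus>w\<in>D. (t c w \<otimes>\<^bsub>A\<^esub> P w) z)"
          using finite_D tA[OF c] PA z by (intro finsum_A_coord) auto
        also have "\<dots> = (\<Oplus>w\<in>D. (unitv c \<otimes>\<^bsub>A\<^esub> y) w \<otimes> P w z)"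
          unfolding t_def using uyA PA z by (intro finsum_congI scal_mult_coord) auto
        also have "\<dots> = (unitv c \<otimes>\<^bsub>A\<^esub> y) z" by (rule P(2)[OF uyI[OF c] z, symmetric])
        finally show "(finsum A (\<lambda>w. t c w \<otimes>\<^bsub>A\<^esub> P w) D) z = (unitv c \<otimes>\<^bsub>A\<^esub> y) z" .
      qed (rule uyA)
      moreover have "finsum A (\<lambda>w. g c \<otimes>\<^bsub>A\<^esub> (t c w \<otimes>\<^bsub>A\<^esub> P w)) D
          = g c \<otimes>\<^bsub>A\<^esub> finsum A (\<lambda>w. t c w \<otimes>\<^bsub>A\<^esub> P w) D"
        using finite_D gA tA[OF c] PA by (intro alg.finsum_rdistrI[symmetric]) auto
      ultimately show "finsum A (\<lambda>w. g c \<otimes>\<^bsub>A\<^esub> (t c w \<otimes>\<^bsub>A\<^esub> P w)) D = (g c \<otimes>\<^bsub>A\<^esub> unitv c) \<otimes>\<^bsub>A\<^esub> y"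
        using gA unitv_closed[OF c] y by (simp add: alg.m_assoc)
    qed
    also have "\<dots> = finsum A (\<lambda>c. g c \<otimes>\<^bsub>A\<^esub> unitv c) D \<otimes>\<^bsub>A\<^esub> y"
      using finite_D gA unitv_closed y by (intro alg.finsum_ldistrI[symmetric]) auto
    also have "\<dots> = y" using unit y by simp
    finally show ?thesis .
  qed
  then show "\<exists>e\<in>I. \<forall>y\<in>I. y \<otimes>\<^bsub>A\<^esub> e = y" using eI by blast
qed

end

section \<open>Diagram algebras\<close>

text \<open>Multiplying by the sign passes from \<open>k\<close> to its absolute value, so that
  information about natural multiples of 1 also covers negative integers.\<close>

lemma (in ring) of_int_ring_nonzero:
  assumes "add_pow R (nat \<bar>k\<bar>) \<one> \<noteq> \<zero>"
  shows "\<iota> k \<noteq> \<zero>"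
proof
  assume "\<iota> k = \<zero>"
  then have "\<iota> (k * sgn k) = \<zero>" by (simp add: of_int_ring_mult)
  moreover have "k * sgn k = int (nat \<bar>k\<bar>)" using abs_sgn[of k] by simp
  ultimately have "\<iota> (int (nat \<bar>k\<bar>)) = \<zero>" by (simp only:)
  then show False using assms by (simp only: of_int_ring_of_nat)
qed

lemma (in abelian_monoid) finsum_Times:
  assumes "finite S" "finite T" "\<And>a b. a \<in> S \<Longrightarrow> b \<in> T \<Longrightarrow> F a b \<in> carrier G"
  shows "finsum G (\<lambda>(a, b). F a b) (S \<times> T) = finsum G (\<lambda>a. finsum G (F a) T) S"
proof -
  have "S \<times> T = (\<Union>a\<in>S. Pair a ` T)" by auto
  then have "finsum G (\<lambda>(a, b). F a b) (S \<times> T) = finsum G (\<lambda>a. finsum G (\<lambda>(a, b). F a b) (Pair a ` T)) S"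
    using assms by (simp only:) (rule add.finprod_UN_disjoint, auto simp: pairwise_def disjnt_def)
  also have "\<dots> = finsum G (\<lambda>a. finsum G (F a) T) S"
  proof (rule finsum_congI)
    fix a assume a: "a \<in> S"
    show "finsum G (F a) T \<in> carrier G" using assms a by (intro finsum_closedI) auto
    have "finsum G (\<lambda>(a, b). F a b) (Pair a ` T) = finsum G (\<lambda>b. case (a, b) of (a, b) \<Rightarrow> F a b) T"
      using assms a by (intro finsum_reindex) (auto intro: inj_onI)
    then show "finsum G (\<lambda>(a, b). F a b) (Pair a ` T) = finsum G (F a) T" by simp
  qed
  finally show ?thesis .
qed

text \<open>The common ground of the walled and the full diagrams, on which both halves of the
  result are instances of one statement.\<close>

locale diagram_monoid =
  fixes d :: nat and D :: "diagram set"
  assumes D_brauer: "D \<subseteq> brauer_diagrams d" and id_in: "id_diagram d \<in> D"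
    and compose_in: "a \<in> D \<Longrightarrow> b \<in> D \<Longrightarrow> compose d a b \<in> D"
begin

lemma finite_D: "finite D"
  using D_brauer by (rule finite_subset) simp

definition sconst :: "int \<Rightarrow> diagram \<Rightarrow> diagram \<Rightarrow> diagram \<Rightarrow> int" where
  "sconst \<delta> a b c = (if compose d a b = c then \<delta> ^ loops d a b else 0)"

text \<open>A product of two diagrams is a multiple of a single diagram, so each sum collapses to
  one term. The composites and the exponents of \<delta> then agree by
  \<open>compose_assoc_loops\<close>.\<close>

lemma structure_constants_sconst: "structure_constants D (sconst \<delta>) (id_diagram d)"
proof
  fix a b c z assume abc: "a \<in> D" "b \<in> D" "c \<in> D" "z \<in> D"
  then have br: "a \<in> brauer_diagrams d" "b \<in> brauer_diagrams d" "c \<in> brauer_diagrams d"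
    using D_brauer by auto
  have "(\<Sum>x\<in>D. sconst \<delta> a b x * sconst \<delta> x c z)
      = (\<Sum>x\<in>D. if compose d a b = x then \<delta> ^ loops d a b * sconst \<delta> x c z else 0)"
    by (rule sum.cong) (auto simp: sconst_def)
  also have "\<dots> = \<delta> ^ loops d a b * sconst \<delta> (compose d a b) c z"
    using finite_D compose_in abc by simp
  also have "\<dots> = \<delta> ^ loops d b c * sconst \<delta> a (compose d b c) z"
    using compose_assoc_loops[OF br] by (simp add: sconst_def flip: power_add)
  also have "\<dots> = (\<Sum>x\<in>D. if compose d b c = x then \<delta> ^ loops d b c * sconst \<delta> a x z else 0)"
    using finite_D compose_in abc by simp
  also have "\<dots> = (\<Sum>x\<in>D. sconst \<delta> b c x * sconst \<delta> a x z)"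
    by (rule sum.cong) (auto simp: sconst_def)
  finally show "(\<Sum>x\<in>D. sconst \<delta> a b x * sconst \<delta> x c z) = (\<Sum>x\<in>D. sconst \<delta> b c x * sconst \<delta> a x z)" .
next
  fix a b assume "a \<in> D" "b \<in> D"
  then have "a \<in> brauer_diagrams d" using D_brauer by auto
  then show "sconst \<delta> (id_diagram d) a b = of_bool (a = b)" "sconst \<delta> a (id_diagram d) b = of_bool (a = b)"
    by (auto simp: sconst_def compose_id)
qed (auto simp: finite_D id_in)

lemma scalar_extension_diagram_alg:
  assumes "field R"
  shows "scalar_extension D (sconst \<delta>) (id_diagram d) R (diagram_alg R \<delta> d D)"
proof -
  interpret field R by fact
  interpret structure_constants D "sconst \<delta>" "id_diagram d" by (rule structure_constants_sconst)
  show ?thesis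
  proof
    fix f g assume "f \<in> carrier (diagram_alg R \<delta> d D)" "g \<in> carrier (diagram_alg R \<delta> d D)"
    then have fg: "f x \<in> carrier R" "g x \<in> carrier R" if "x \<in> D" for x
      using that by (auto simp: diagram_alg_def)
    have "finsum R (\<lambda>(a, b). (f a \<otimes>\<^bsub>R\<^esub> g b) \<otimes>\<^bsub>R\<^esub> (\<iota> \<delta> [^]\<^bsub>R\<^esub> loops d a b))
          {(a, b). a \<in> D \<and> b \<in> D \<and> compose d a b = c}
        = (\<Oplus>\<^bsub>R\<^esub>a\<in>D. \<Oplus>\<^bsub>R\<^esub>b\<in>D. (f a \<otimes>\<^bsub>R\<^esub> g b) \<otimes>\<^bsub>R\<^esub> \<iota> (sconst \<delta> a b c))" if c: "c \<in> D" for c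
    proof -
      \<comment> \<open>Pairs whose composite is not \<open>c\<close> have structure constant zero,
        so the sum may run over all pairs and then be written as an iterated sum.\<close>
      have "finsum R (\<lambda>(a, b). (f a \<otimes>\<^bsub>R\<^esub> g b) \<otimes>\<^bsub>R\<^esub> (\<iota> \<delta> [^]\<^bsub>R\<^esub> loops d a b))
            {(a, b). a \<in> D \<and> b \<in> D \<and> compose d a b = c}
          = finsum R (\<lambda>(a, b). (f a \<otimes>\<^bsub>R\<^esub> g b) \<otimes>\<^bsub>R\<^esub> \<iota> (sconst \<delta> a b c)) (D \<times> D)"
        using finite_D fg
        by (intro add.finprod_mono_neutral_cong_left)
          (auto simp: sconst_def of_int_ring_power of_int_ring_0 split: if_split_asm)
      also have "\<dots> = (\<Oplus>\<^bsub>R\<^esub>a\<in>D. \<Oplus>\<^bsub>R\<^esub>b\<in>D. (f a \<otimes>\<^bsub>R\<^esub> g b) \<otimes>\<^bsub>R\<^esub> \<iota> (sconst \<delta> a b c))"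
        using finite_D fg by (intro finsum_Times) auto
      finally show ?thesis .
    qed
    then show "f \<otimes>\<^bsub>diagram_alg R \<delta> d D\<^esub> g = (\<lambda>c. if c \<in> D then
        \<Oplus>\<^bsub>R\<^esub>a\<in>D. \<Oplus>\<^bsub>R\<^esub>b\<in>D. (f a \<otimes>\<^bsub>R\<^esub> g b) \<otimes>\<^bsub>R\<^esub> \<iota> (sconst \<delta> a b c) else \<zero>\<^bsub>R\<^esub>)"
      by (auto simp: diagram_alg_def fun_eq_iff)
  qed (simp_all add: diagram_alg_def)
qed

end

lemma residue_ring_add_pow:
  assumes "Factorial_Ring.prime (p :: nat)"
  shows "add_pow (residue_ring (int p)) (n :: nat) \<one>\<^bsub>residue_ring (int p)\<^esub> = int n mod int p"
proof -
  interpret residues_prime p "residue_ring (int p)"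
    using assms by unfold_locales auto
  show ?thesis
  proof (induction n)
    case 0
    show ?case by (simp add: res_zero_eq)
  next
    case (Suc n)
    have "add_pow (residue_ring (int p)) (Suc n) \<one>\<^bsub>residue_ring (int p)\<^esub>
        = add_pow (residue_ring (int p)) n \<one>\<^bsub>residue_ring (int p)\<^esub>
          \<oplus>\<^bsub>residue_ring (int p)\<^esub> \<one>\<^bsub>residue_ring (int p)\<^esub>"
      by simp
    also have "\<dots> = (int n mod int p + 1) mod int p"
      unfolding Suc by (simp add: res_add_eq res_one_eq)
    also have "\<dots> = int (Suc n) mod int p" by (simp add: mod_add_right_eq add.commute)
    finally show ?case .
  qed
qed

context diagram_monoid
begin

text \<open>A sharper alternative holds: either the algebra is semisimple over \<open>K\<close> and
  over all but finitely many prime fields, or it is not semisimple over \<open>K\<close> and is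
  semisimple over only finitely many of them.\<close>

theorem semisimple_iff_infinitely_many_primes:
  assumes K: "field K" and char: "\<forall>n::nat. n > 0 \<longrightarrow> [n] \<cdot>\<^bsub>K\<^esub> \<one>\<^bsub>K\<^esub> \<noteq> \<zero>\<^bsub>K\<^esub>"
  shows "semisimple (diagram_alg K \<delta> d D) \<longleftrightarrow>
    infinite {p :: nat. Factorial_Ring.prime p \<and> semisimple (diagram_alg (residue_ring (int p)) \<delta> d D)}"
proof -
  interpret structure_constants D "sconst \<delta>" "id_diagram d" by (rule structure_constants_sconst)
  interpret K: scalar_extension D "sconst \<delta>" "id_diagram d" K "diagram_alg K \<delta> d D"
    by (rule scalar_extension_diagram_alg[OF K])
  have K_nonzero: "add_pow K k \<one>\<^bsub>K\<^esub> \<noteq> \<zero>\<^bsub>K\<^esub>" if "k \<noteq> 0" for k :: int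
    by (rule K.of_int_ring_nonzero) (use char that in simp)
  have Fp: "scalar_extension D (sconst \<delta>) (id_diagram d) (residue_ring (int p))
      (diagram_alg (residue_ring (int p)) \<delta> d D)" if p: "Factorial_Ring.prime p" for p :: nat
  proof -
    interpret residues_prime p "residue_ring (int p)"
      using p by unfold_locales auto
    show ?thesis by (rule scalar_extension_diagram_alg) (rule is_field)
  qed
  have Fp_nonzero: "add_pow (residue_ring (int p)) k \<one>\<^bsub>residue_ring (int p)\<^esub> \<noteq> \<zero>\<^bsub>residue_ring (int p)\<^esub>"
    if p: "Factorial_Ring.prime p" and k: "k \<noteq> 0" "nat \<bar>k\<bar> < p" for p :: nat and k :: int
  proof -
    interpret residues_prime p "residue_ring (int p)"
      using p by unfold_locales auto
    show ?thesis
    proof (rule of_int_ring_nonzero)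
      have "int (nat \<bar>k\<bar>) mod int p = \<bar>k\<bar>" using k by simp
      then show "add_pow (residue_ring (int p)) (nat \<bar>k\<bar>) \<one>\<^bsub>residue_ring (int p)\<^esub> \<noteq> \<zero>\<^bsub>residue_ring (int p)\<^esub>"
        unfolding residue_ring_add_pow[OF p] using k by (simp add: res_zero_eq)
    qed
  qed
  show ?thesis
  proof (rule int_matrix_dichotomy[of D trace_form, OF finite_D])
    fix H N assume N: "N \<noteq> 0"
      and GH: "\<And>a b. a \<in> D \<Longrightarrow> b \<in> D \<Longrightarrow> (\<Sum>c\<in>D. trace_form a c * H c b) = N * of_bool (a = b)"
      and HG: "\<And>a b. a \<in> D \<Longrightarrow> b \<in> D \<Longrightarrow> (\<Sum>c\<in>D. H a c * trace_form c b) = N * of_bool (a = b)"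
    have "semisimple (diagram_alg K \<delta> d D)"
      by (rule K.invertible_imp_semisimple[OF K_nonzero[OF N]]) (erule (1) GH, erule (1) HG)
    \<comment> \<open>A prime above the absolute value of \<open>N\<close> does not divide it, so
      the dual bases exist modulo \<open>p\<close>.\<close>
    moreover have "semisimple (diagram_alg (residue_ring (int p)) \<delta> d D)"
      if "Factorial_Ring.prime p" "p > nat \<bar>N\<bar>" for p
      by (rule scalar_extension.invertible_imp_semisimple[OF Fp[OF that(1)] Fp_nonzero[OF that(1) N that(2)]])
        (erule (1) GH, erule (1) HG)
    then have sub: "{p :: nat. Factorial_Ring.prime p} \<subseteq>
        {p. Factorial_Ring.prime p \<and> semisimple (diagram_alg (residue_ring (int p)) \<delta> d D)}
        \<union> {..nat \<bar>N\<bar>}"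
      by (auto simp: not_le[symmetric])
    have "infinite {p :: nat. Factorial_Ring.prime p \<and> semisimple (diagram_alg (residue_ring (int p)) \<delta> d D)}"
    proof
      assume "finite {p :: nat. Factorial_Ring.prime p \<and> semisimple (diagram_alg (residue_ring (int p)) \<delta> d D)}"
      then have "finite {p :: nat. Factorial_Ring.prime p}"
        by (intro finite_subset[OF sub] finite_UnI finite_atMost)
      then show False using primes_infinite by simp
    qed
    ultimately show ?thesis by blast
  next
    fix v c assume c: "c \<in> D" "v c \<noteq> 0" "\<And>a. a \<in> D \<Longrightarrow> (\<Sum>b\<in>D. trace_form a b * v b) = 0"
    have "\<not> semisimple (diagram_alg K \<delta> d D)"
    proof (rule K.singular_imp_not_semisimple[where v = v, OF c(1) K_nonzero[OF c(2)] c(3)])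
      show "add_pow K (int n) \<one>\<^bsub>K\<^esub> \<noteq> \<zero>\<^bsub>K\<^esub>" if "0 < n" "n \<le> card D" for n
        using K_nonzero[of "int n"] that by simp
    qed
    \<comment> \<open>Two lower bounds on \<open>p\<close> are combined: exceeding
      \<open>card D\<close> keeps the ranks of nonzero idempotents from vanishing, and exceeding the
      absolute value of \<open>v c\<close> keeps the kernel vector nonzero.\<close>
    moreover have "\<not> semisimple (diagram_alg (residue_ring (int p)) \<delta> d D)"
      if p: "Factorial_Ring.prime p" "p > max (card D) (nat \<bar>v c\<bar>)" for p
    proof (rule scalar_extension.singular_imp_not_semisimple[where v = v, OF Fp[OF p(1)] c(1) _ c(3)])
      show "add_pow (residue_ring (int p)) (v c) \<one>\<^bsub>residue_ring (int p)\<^esub> \<noteq> \<zero>\<^bsub>residue_ring (int p)\<^esub>"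
        using Fp_nonzero[OF p(1) c(2)] p(2) by simp
      show "add_pow (residue_ring (int p)) (int n) \<one>\<^bsub>residue_ring (int p)\<^esub> \<noteq> \<zero>\<^bsub>residue_ring (int p)\<^esub>"
        if "0 < n" "n \<le> card D" for n
        using Fp_nonzero[OF p(1), of "int n"] p(2) that by simp
    qed
    then have "{p :: nat. Factorial_Ring.prime p \<and> semisimple (diagram_alg (residue_ring (int p)) \<delta> d D)}
        \<subseteq> {..max (card D) (nat \<bar>v c\<bar>)}"
      by (metis (mono_tags, lifting) atMost_iff linorder_not_le mem_Collect_eq subsetI)
    then have "finite {p :: nat. Factorial_Ring.prime p \<and> semisimple (diagram_alg (residue_ring (int p)) \<delta> d D)}"
      by (rule finite_subset) simp
    ultimately show ?thesis by blast
  qed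
qed

end

theorem theoremA3:
  fixes K :: "('k, 'm) ring_scheme" and \<delta> :: int
  assumes "field K"
    and "\<forall>n::nat. n > 0 \<longrightarrow> [n] \<cdot>\<^bsub>K\<^esub> \<one>\<^bsub>K\<^esub> \<noteq> \<zero>\<^bsub>K\<^esub>"
  shows "(\<forall>r s :: nat. r + s > 0 \<longrightarrow>
            (semisimple (walled_brauer_alg K \<delta> r s) \<longleftrightarrow>
             infinite {p :: nat. Factorial_Ring.prime p \<and>
                semisimple (walled_brauer_alg (residue_ring (int p)) \<delta> r s)}))
       \<and> (\<forall>d :: nat. d > 0 \<longrightarrow>
            (semisimple (brauer_alg K \<delta> d) \<longleftrightarrow>
             infinite {p :: nat. Factorial_Ring.prime p \<and>
                semisimple (brauer_alg (residue_ring (int p)) \<delta> d)}))"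
proof -
  have "diagram_monoid (r + s) (walled_brauer_diagrams r s)" for r s
    by (intro diagram_monoid.intro subsetI compose_walled id_diagram_walled)
      (assumption | simp add: walled_brauer_diagrams_def)+
  moreover have "diagram_monoid d (brauer_diagrams d)" for d
    by (rule diagram_monoid.intro) (auto simp: compose_brauer_diagrams id_diagram_brauer)
  ultimately show ?thesis
    unfolding walled_brauer_alg_def brauer_alg_def
    using diagram_monoid.semisimple_iff_infinitely_many_primes[OF _ assms] by blast
qed

end
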